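(* Let $\widetilde\mu$ be a non-negative measure on $\mathbb R$ of at most polynomial growth, and let $\mu$ be a non-negative measure on $\mathbb R$ with $\mu\preccurlyeq\widetilde\mu$. Then $T(\mu)\le T(\widetilde\mu)$.
   Context: Measures are Borel measures. A non-negative measure $\mu$ on $\mathbb R$ has at most polynomial growth if $\int_{\mathbb R}\frac{d\mu(\lambda)}{1+|\lambda|^{2s}}<\infty$ for some $s<\infty$. For $a>0$, $\mathcal E(a)$ is the linear space of Fourier transforms $\widehat f(\lambda)=\int_{\mathbb R} f(x)e^{-i\lambda x}\,dx$ of complex-valued $C^\infty$ functions $f$ compactly supported in $(-a,a)$, regarded as elements of $L^2(\mu)$ by restriction to $\mathbb R$. The type of a measure $\mu$ of at most polynomial growth is $T(\mu)=\inf\{a>0:\mathcal E(a)\text{ is dense in }L^2(\mu)\}\in[0,\infty]$, with $\inf\emptyset=\infty$. For $\delta>0$ and $x\in\mathbb R$ let $I_{x,\delta}=[x-e^{-\delta|x|},x+e^{-\delta|x|}]$, and let $2I_{x,\delta}=[x-2e^{-\delta|x|},x+2e^{-\delta|x|}]$. One writes $\mu\preccurlyeq\widetilde\mu$ if there exist constants $\delta>0$, $C>0$ and $n\ge 0$ such that for all $x\in\mathbb R$, $\mu(I_{x,\delta})\le C(1+|x|)^n\left(\widetilde\mu(2I_{x,\delta})+e^{-2\delta|x|}\right)$. (If $\widetilde\mu$ has at most polynomial growth and $\mu\preccurlyeq\widetilde\mu$, then $\mu$ also has at most polynomial growth, so $T(\mu)$ is defined.) *)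

theory Defs
  imports "HOL-Analysis.Analysis"
begin

(* The exponent is taken non-negative: the condition concerns growth at infinity only, and
   larger s gives a weaker condition.  For s = 0 the library convention 0 powr 0 = 0 alters
   the weight at the single point 0 from 1/2 to 1, which does not affect finiteness. *)
definition polynomial_growth :: "real measure \<Rightarrow> bool" where
  "polynomial_growth M \<longleftrightarrow>
     (\<exists>s::real. s \<ge> 0 \<and> (\<integral>\<^sup>+ t. ennreal (1 / (1 + \<bar>t\<bar> powr (2 * s))) \<partial>M) < \<infinity>)"

definition smooth :: "(real \<Rightarrow> complex) \<Rightarrow> bool" where
  "smooth f \<longleftrightarrow>
     (\<forall>k x. ((\<lambda>g y. vector_derivative g (at y)) ^^ k) f differentiable (at x))"

definition fourier :: "(real \<Rightarrow> complex) \<Rightarrow> real \<Rightarrow> complex" where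
  "fourier f t = (LINT x|lborel. f x * exp (- (\<i> * of_real (t * x))))"

(* The support is bounded, hence compact, once it is contained in the open interval. *)
definition \<E> :: "real \<Rightarrow> (real \<Rightarrow> complex) set" where
  "\<E> a = {fourier f | f. smooth f \<and> closure {x. f x \<noteq> 0} \<subseteq> {- a<..<a}}"

(* L2 consists of functions rather than of classes modulo equality almost everywhere;
   L2_norm is accordingly a seminorm. *)
definition L2 :: "real measure \<Rightarrow> (real \<Rightarrow> complex) set" where
  "L2 M = {g \<in> borel_measurable M. integrable M (\<lambda>t. (cmod (g t))\<^sup>2)}"

definition L2_norm :: "real measure \<Rightarrow> (real \<Rightarrow> complex) \<Rightarrow> real" where
  "L2_norm M g = sqrt (LINT t|M. (cmod (g t))\<^sup>2)"

definition dense_in_L2 :: "real measure \<Rightarrow> (real \<Rightarrow> complex) set \<Rightarrow> bool" where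
  "dense_in_L2 M S \<longleftrightarrow>
     S \<subseteq> L2 M \<and> (\<forall>g\<in>L2 M. \<forall>\<epsilon>>0. \<exists>h\<in>S. L2_norm M (\<lambda>t. g t - h t) < \<epsilon>)"

(* The infimum is taken in the extended reals, where the infimum of the empty set is \<infinity>. *)
definition measure_type :: "real measure \<Rightarrow> ereal" where
  "measure_type M = Inf {ereal a | a. a > 0 \<and> dense_in_L2 M (\<E> a)}"

(* centred_interval c x \<delta> is the interval c I_{x,\<delta>}: same centre, length multiplied by c. *)
definition centred_interval :: "real \<Rightarrow> real \<Rightarrow> real \<Rightarrow> real set" where
  "centred_interval c x \<delta> = {x - c * exp (- \<delta> * \<bar>x\<bar>) .. x + c * exp (- \<delta> * \<bar>x\<bar>)}"

definition preccurly :: "real measure \<Rightarrow> real measure \<Rightarrow> bool" (infix \<open>\<preceq>\<close> 50) where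
  "M \<preceq> M' \<longleftrightarrow>
     (\<exists>\<delta> C n. \<delta> > 0 \<and> C > 0 \<and> n \<ge> 0 \<and>
       (\<forall>x. emeasure M (centred_interval 1 x \<delta>) \<le>
          ennreal (C * (1 + \<bar>x\<bar>) powr n) *
            (emeasure M' (centred_interval 2 x \<delta>) + ennreal (exp (- 2 * \<delta> * \<bar>x\<bar>)))))"

end

theory Submission
  imports Defs "HOL-Complex_Analysis.Complex_Analysis" "HOL-Real_Asymp.Real_Asymp"
begin

text \<open>
  The theorem compares two infima, so it is enough that density of \<open>\<E> a\<close> in \<open>L2 \<mu>'\<close> implies density of
  \<open>\<E> b\<close> in \<open>L2 \<mu>\<close> for every \<open>b > a\<close> (lemma \<open>dense_transfer\<close>). Suppose that \<open>\<E> b\<close> is not dense in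
  \<open>L2 \<mu>\<close>, and regard the elements of \<open>\<E> b\<close> as entire functions.

  Point evaluations are then bounded. Some continuous functional \<open>l \<noteq> 0\<close> on \<open>L2 \<mu>\<close> annihilates \<open>\<E> b\<close>.
  For \<open>F\<close> and \<open>\<Phi>\<close> in \<open>\<E> b\<close> the function \<open>(F t * \<Phi> z - F z * \<Phi> t) / (t - z)\<close> of \<open>t\<close> is again in \<open>\<E> b\<close>; applying
  \<open>l\<close> gives \<open>F = \<Phi> * A / B\<close>, where \<open>A\<close> and \<open>B\<close> are the Cauchy transforms under \<open>l\<close> of \<open>F\<close> and \<open>\<Phi>\<close>. On a line
  parallel to the real axis \<open>A\<close> is at most a multiple of the norm of \<open>F\<close>, while \<open>B\<close> is one fixed bounded
  holomorphic function, so that the negative part of \<open>ln (cmod B)\<close> is integrable against the Poisson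
  kernel. The Poisson kernel and the maximum principle turn this into
  \<open>cmod (F z) \<le> K * norm F * exp (\<epsilon> * \<bar>Re z\<bar>)\<close> on every horizontal strip, for every \<open>\<epsilon> > 0\<close>, with \<open>K\<close>
  independent of \<open>F\<close> (lemma \<open>evaluation_bound\<close>).

  On an interval of length comparable to \<open>exp (- \<delta> * \<bar>x\<bar>)\<close> around \<open>x\<close> such an \<open>F\<close> with \<open>\<epsilon> = \<delta> / 8\<close> is almost
  constant. Integrating the hypothesis \<open>\<mu> \<preceq> \<mu>'\<close> over \<open>x\<close> therefore bounds the square of the norm of \<open>F\<close> in
  \<open>L2 \<mu>\<close> by the integral of \<open>(1 + \<bar>s\<bar>) ^ k * (cmod (F s))\<^sup>2\<close> for \<open>\<mu>'\<close> plus the square of the supremum of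
  \<open>cmod F\<close> on one fixed disc (lemma \<open>norm_estimate\<close>).

  The supremum can be removed at the cost of a little type. Apply the estimate to \<open>sin (s * z) ^ p * F z\<close>
  with \<open>s * p\<close> equal to the loss of type. The zero of order \<open>p\<close> at \<open>0\<close> makes the supremum of this function on
  the disc smaller by the factor \<open>2 ^ p\<close> than its supremum on the disc of twice the radius, and the
  latter is controlled by the norm, since point evaluations are bounded. For large \<open>p\<close> the remainder is
  absorbed, and evaluation at \<open>\<i>\<close> is bounded on \<open>\<E> a1\<close>, where \<open>a < a1 < b\<close>, by a norm of \<open>L2 \<mu>'\<close> with
  polynomial weight (lemma \<open>point_evaluation\<close>).

  This is incompatible with density of \<open>\<E> a\<close> in \<open>L2 \<mu>'\<close>: if \<open>f\<close> in \<open>\<E> a\<close> is close to \<open>u t / (t - \<i>)\<close>, then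
  \<open>u t - (t - \<i>) * f t\<close>, multiplied by a fixed function that decays fast enough to absorb the weight,
  is small in the weighted norm, but its value at \<open>\<i>\<close> does not depend on \<open>f\<close>
  (lemma \<open>dense_imp_not_point_evaluation\<close>).
\<close>

section \<open>Smooth functions\<close>

text \<open>
  Smoothness is coinductive: a class of functions in which every member has a derivative that is again a
  member consists of smooth functions. All closure properties below are obtained by exhibiting such a
  class.
\<close>

lemma smooth_coinduct:
  assumes "P f"
    and step: "\<And>g. P g \<Longrightarrow> \<exists>g'. P g' \<and> (\<forall>x. (g has_vector_derivative g' x) (at x))"
  shows "smooth f"
proof -
  have *: "P (((\<lambda>g y. vector_derivative g (at y)) ^^ k) f)" for k
  proof (induction k)
    case 0
    then show ?case using assms by simp
  next
    case (Suc k)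
    then obtain g' where "P g'"
      "\<forall>x. ((((\<lambda>g y. vector_derivative g (at y)) ^^ k) f) has_vector_derivative g' x) (at x)"
      using step by blast
    moreover from this have "((\<lambda>g y. vector_derivative g (at y)) ^^ Suc k) f = g'"
      by (auto simp: fun_eq_iff intro!: vector_derivative_at)
    ultimately show ?case by simp
  qed
  show ?thesis
    unfolding smooth_def using step[OF *] by (meson differentiableI_vector)
qed

lemma smooth_derivative:
  assumes "smooth f"
  obtains f' where "smooth f'" "\<And>x. (f has_vector_derivative f' x) (at x)"
proof
  show "(f has_vector_derivative vector_derivative f (at x)) (at x)" for x
    using assms[unfolded smooth_def, rule_format, of 0 x] by (simp add: vector_derivative_works)
  show "smooth (\<lambda>x. vector_derivative f (at x))"
    unfolding smooth_def
  proof (intro allI)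
    fix k x
    show "((\<lambda>g y. vector_derivative g (at y)) ^^ k) (\<lambda>x. vector_derivative f (at x)) differentiable (at x)"
      using assms[unfolded smooth_def, rule_format, of "Suc k" x]
      by (simp add: funpow_Suc_right del: funpow.simps)
  qed
qed

lemma smooth_continuous: "smooth f \<Longrightarrow> continuous_on S f"
  by (meson smooth_derivative has_vector_derivative_continuous continuous_at_imp_continuous_on)

lemma smooth_lin: 
  assumes "smooth f" "smooth g"
  shows "smooth (\<lambda>x. c * f x + d * g x)"
proof (rule smooth_coinduct[where P = "\<lambda>h. \<exists>f g. smooth f \<and> smooth g \<and> h = (\<lambda>x. c * f x + d * g x)"])
  fix h assume "\<exists>f g. smooth f \<and> smooth g \<and> h = (\<lambda>x. c * f x + d * g x)"
  then obtain f g where h: "smooth f" "smooth g" "h = (\<lambda>x. c * f x + d * g x)" by blast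
  obtain f' where f': "smooth f'" "\<And>x. (f has_vector_derivative f' x) (at x)"
    using smooth_derivative[OF h(1)] by blast
  obtain g' where g': "smooth g'" "\<And>x. (g has_vector_derivative g' x) (at x)"
    using smooth_derivative[OF h(2)] by blast
  have "(h has_vector_derivative c * f' x + d * g' x) (at x)" for x
    unfolding h(3) by (intro has_vector_derivative_add has_vector_derivative_mult_right f'(2) g'(2))
  then show "\<exists>h'. (\<exists>f g. smooth f \<and> smooth g \<and> h' = (\<lambda>x. c * f x + d * g x)) \<and> (\<forall>x. (h has_vector_derivative h' x) (at x))"
    using f'(1) g'(1) by blast
qed (use assms in blast)

lemma smooth_affine: 
  assumes "smooth f"
  shows "smooth (\<lambda>x. f (k * x + \<tau>))"
proof (rule smooth_coinduct[where P = "\<lambda>h. \<exists>f c. smooth f \<and> h = (\<lambda>x. c * f (k * x + \<tau>))"])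
  fix h assume "\<exists>f c. smooth f \<and> h = (\<lambda>x. c * f (k * x + \<tau>))"
  then obtain f c where h: "smooth f" "h = (\<lambda>x. c * f (k * x + \<tau>))" by blast
  obtain f' where f': "smooth f'" "\<And>x. (f has_vector_derivative f' x) (at x)"
    using smooth_derivative[OF h(1)] by blast
  have "(h has_vector_derivative (c * of_real k) * f' (k * x + \<tau>)) (at x)" for x
  proof -
    have "((f \<circ> (\<lambda>x. k * x + \<tau>)) has_vector_derivative (k *\<^sub>R f' (k * x + \<tau>))) (at x)"
      by (rule vector_diff_chain_at) (auto intro!: derivative_eq_intros f')
    then have "((\<lambda>x. c * (f \<circ> (\<lambda>x. k * x + \<tau>)) x) has_vector_derivative c * (k *\<^sub>R f' (k * x + \<tau>))) (at x)"
      by (rule has_vector_derivative_mult_right)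
    then show ?thesis by (simp add: h o_def scaleR_conv_of_real mult.assoc)
  qed
  then show "\<exists>h'. (\<exists>f c. smooth f \<and> h' = (\<lambda>x. c * f (k * x + \<tau>))) \<and> (\<forall>x. (h has_vector_derivative h' x) (at x))"
    using f'(1) by blast
qed (use assms in \<open>force intro: exI[of _ 1]\<close>)

lemma smooth_cnj: 
  assumes "smooth f"
  shows "smooth (\<lambda>x. cnj (f x))"
proof (rule smooth_coinduct[where P = "\<lambda>h. \<exists>f. smooth f \<and> h = (\<lambda>x. cnj (f x))"])
  fix h assume "\<exists>f. smooth f \<and> h = (\<lambda>x. cnj (f x))"
  then obtain f where h: "smooth f" "h = (\<lambda>x. cnj (f x))" by blast
  obtain f' where f': "smooth f'" "\<And>x. (f has_vector_derivative f' x) (at x)"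
    using smooth_derivative[OF h(1)] by blast
  show "\<exists>h'. (\<exists>f. smooth f \<and> h' = (\<lambda>x. cnj (f x))) \<and> (\<forall>x. (h has_vector_derivative h' x) (at x))"
    using f' h(1) unfolding h(2) by (intro exI[of _ "\<lambda>x. cnj (f' x)"]) (blast intro: has_vector_derivative_cnj)
qed (use assms in blast)

text \<open>
  The products of two smooth functions are not closed under differentiation, but their finite sums are.
\<close>

inductive product_sum :: "(real \<Rightarrow> complex) \<Rightarrow> bool" where
  prod: "smooth f \<Longrightarrow> smooth g \<Longrightarrow> product_sum (\<lambda>x. f x * g x)"
| add: "product_sum f \<Longrightarrow> product_sum g \<Longrightarrow> product_sum (\<lambda>x. f x + g x)"

lemma smooth_mult:
  assumes "smooth f" "smooth g"
  shows "smooth (\<lambda>x. f x * g x)"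
proof (rule smooth_coinduct[where P = product_sum])
  fix h assume "product_sum h"
  then show "\<exists>h'. product_sum h' \<and> (\<forall>x. (h has_vector_derivative h' x) (at x))"
  proof induction
    case (prod f g)
    obtain f' where f': "smooth f'" "\<And>x. (f has_vector_derivative f' x) (at x)"
      using smooth_derivative[OF prod(1)] by blast
    obtain g' where g': "smooth g'" "\<And>x. (g has_vector_derivative g' x) (at x)"
      using smooth_derivative[OF prod(2)] by blast
    have "product_sum (\<lambda>x. f x * g' x + f' x * g x)"
      using prod f' g' by (intro product_sum.intros)
    then show ?case
      using has_vector_derivative_mult[OF f'(2) g'(2)] by blast
  next
    case (add f g)
    then obtain f' g' where "product_sum f'" "product_sum g'"
      "\<forall>x. (f has_vector_derivative f' x) (at x)" "\<forall>x. (g has_vector_derivative g' x) (at x)" by blast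
    then show ?case
      by (intro exI[of _ "\<lambda>x. f' x + g' x"]) (auto intro!: product_sum.intros derivative_intros)
  qed
qed (use assms product_sum.prod in blast)

text \<open>
  These functions vanish to infinite order at \<open>0\<close>; they are closed under differentiation
  because the factors \<open>p (1 / x)\<close> are.
\<close>

definition flat :: "real poly \<Rightarrow> real \<Rightarrow> real" where
  "flat p x = (if x > 0 then poly p (1 / x) * exp (- (1 / x)) else 0)"

lemma poly_exp_tendsto_0: "((\<lambda>s. poly p s * exp (- s)) \<longlongrightarrow> 0) (at_top :: real filter)"
proof -
  have "((\<lambda>s. \<Sum>i\<le>degree p. coeff p i * (s ^ i / exp s)) \<longlongrightarrow> (\<Sum>i\<le>degree p. coeff p i * 0)) at_top"
    by (intro tendsto_intros tendsto_power_div_exp_0)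
  then show ?thesis
    by (simp add: poly_altdef sum_distrib_right exp_minus field_simps sum_divide_distrib)
qed

lemma flat_tendsto_0: "((\<lambda>h. flat p h) \<longlongrightarrow> 0) (at 0)"
proof (rule filterlim_split_at)
  show "(flat p \<longlongrightarrow> 0) (at_left 0)"
    by (rule tendsto_eventually) (auto simp: flat_def eventually_at_filter)
  have "((\<lambda>h. poly p (inverse h) * exp (- inverse h)) \<longlongrightarrow> 0) (at_right (0::real))"
    by (rule filterlim_compose[OF poly_exp_tendsto_0 filterlim_inverse_at_top_right])
  then show "(flat p \<longlongrightarrow> 0) (at_right 0)"
    by (rule Lim_transform_eventually) (auto simp: flat_def eventually_at_filter inverse_eq_divide)
qed

lemma flat_derivative:
  "(flat p has_real_derivative flat ([:0, 0, 1:] * (p - pderiv p)) x) (at x)"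
proof -
  consider "x > 0" | "x < 0" | "x = 0" by linarith
  then show ?thesis
  proof cases
    case 1
    have "((\<lambda>x. poly p (1 / x) * exp (- (1 / x))) has_real_derivative flat ([:0, 0, 1:] * (p - pderiv p)) x) (at x)"
      using 1 by (auto intro!: derivative_eq_intros DERIV_chain'[where g = "poly p", OF _ poly_DERIV] simp: flat_def power2_eq_square field_simps)
    then show ?thesis
      by (rule has_field_derivative_transform_within_open[where S = "{0<..}"]) (use 1 in \<open>auto simp: flat_def\<close>)
  next
    case 2
    have "((\<lambda>x. 0) has_real_derivative flat ([:0, 0, 1:] * (p - pderiv p)) x) (at x)"
      using 2 by (auto simp: flat_def)
    then show ?thesis
      by (rule has_field_derivative_transform_within_open[where S = "{..<0}"]) (use 2 in \<open>auto simp: flat_def\<close>)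
  next
    case 3
    have "(flat p h) / h = flat ([:0, 1:] * p) h" for h
      by (auto simp: flat_def)
    then have "((\<lambda>h. flat p h / h) \<longlongrightarrow> 0) (at 0)"
      using flat_tendsto_0[of "[:0, 1:] * p"] by presburger
    then show ?thesis
      using 3 by (simp add: DERIV_def flat_def)
  qed
qed

lemma smooth_flat: "smooth (\<lambda>x. of_real (flat p x))"
proof (rule smooth_coinduct[where P = "\<lambda>h. \<exists>p. h = (\<lambda>x. of_real (flat p x))"])
  fix h :: "real \<Rightarrow> complex" assume "\<exists>p. h = (\<lambda>x. of_real (flat p x))"
  then obtain p where h: "h = (\<lambda>x. of_real (flat p x))" by blast
  have "(h has_vector_derivative of_real (flat ([:0, 0, 1:] * (p - pderiv p)) x)) (at x)" for x
    unfolding h by (rule has_vector_derivative_of_real)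
      (use flat_derivative in \<open>simp only: has_real_derivative_iff_has_vector_derivative\<close>)
  then show "\<exists>h'. (\<exists>p. h' = (\<lambda>x. of_real (flat p x))) \<and> (\<forall>x. (h has_vector_derivative h' x) (at x))"
    by (intro exI[of _ "\<lambda>x. of_real (flat ([:0, 0, 1:] * (p - pderiv p)) x)"]) auto
qed blast

lemma smooth_bump:
  obtains f :: "real \<Rightarrow> real" where "smooth (\<lambda>x. of_real (f x))"
    "\<And>x. f x \<ge> 0" "\<And>x. \<bar>x\<bar> \<ge> 1 \<Longrightarrow> f x = 0" "\<And>x. \<bar>x\<bar> < 1 \<Longrightarrow> f x > 0"
proof
  let ?f = "\<lambda>x. flat 1 (x + 1) * flat 1 (1 - x)"
  have "smooth (\<lambda>x. of_real (flat 1 (1 * x + 1)) * of_real (flat 1 ((-1) * x + 1)))"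
    by (intro smooth_mult smooth_affine[OF smooth_flat])
  then show "smooth (\<lambda>x. of_real (?f x))" by (simp add: algebra_simps)
qed (auto simp: flat_def)

section \<open>Fourier--Laplace transforms of test functions\<close>

text \<open>
  The closure of the support is compact, hence stays at a positive distance from the end points.
\<close>

lemma support_condition:
  fixes f :: "real \<Rightarrow> complex"
  shows "closure {x. f x \<noteq> 0} \<subseteq> {- a<..<a} \<longleftrightarrow> (\<exists>r<a. \<forall>x. \<bar>x\<bar> > r \<longrightarrow> f x = 0)"
proof
  assume L: "closure {x. f x \<noteq> 0} \<subseteq> {- a<..<a}"
  show "\<exists>r<a. \<forall>x. \<bar>x\<bar> > r \<longrightarrow> f x = 0"
  proof (cases "{x. f x \<noteq> 0} = {}")
    case True
    then show ?thesis by (intro exI[of _ "a - 1"]) auto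
  next
    case False
    have "bounded (closure {x. f x \<noteq> 0})"
      using L bounded_subset by (metis bounded_box(1) box_real(1))
    then have "compact (closure {x. f x \<noteq> 0})" by (simp add: compact_eq_bounded_closed)
    moreover have "closure {x. f x \<noteq> 0} \<noteq> {}" using False by simp
    moreover have "continuous_on (closure {x. f x \<noteq> 0}) abs" by (intro continuous_intros)
    ultimately have "\<exists>x\<in>closure {x. f x \<noteq> 0}. \<forall>y\<in>closure {x. f x \<noteq> 0}. \<bar>y\<bar> \<le> \<bar>x\<bar>"
      by (rule continuous_attains_sup)
    then obtain x where x: "x \<in> closure {x. f x \<noteq> 0}" "\<forall>y\<in>closure {x. f x \<noteq> 0}. \<bar>y\<bar> \<le> \<bar>x\<bar>"
      by (elim bexE)
    have "x \<in> {- a<..<a}" using x(1) L by (rule subsetD[rotated])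
    then have "\<bar>x\<bar> < a" by auto
    moreover have "f y = 0" if "\<bar>y\<bar> > \<bar>x\<bar>" for y
      using x(2) closure_subset[of "{x. f x \<noteq> 0}"] that by force
    ultimately show ?thesis by blast
  qed
next
  assume "\<exists>r<a. \<forall>x. \<bar>x\<bar> > r \<longrightarrow> f x = 0"
  then obtain r where r: "r < a" "\<And>x. \<bar>x\<bar> > r \<Longrightarrow> f x = 0" by blast
  have "closure {x. f x \<noteq> 0} \<subseteq> {-r..r}"
    by (rule closure_minimal) (use r in \<open>force+\<close>)
  then show "closure {x. f x \<noteq> 0} \<subseteq> {- a<..<a}" using r by auto
qed

definition test_fun :: "real \<Rightarrow> (real \<Rightarrow> complex) \<Rightarrow> bool" where
  "test_fun a f \<longleftrightarrow> smooth f \<and> (\<exists>r<a. \<forall>x. \<bar>x\<bar> > r \<longrightarrow> f x = 0)"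

definition fourier_ext :: "(real \<Rightarrow> complex) \<Rightarrow> complex \<Rightarrow> complex" where
  "fourier_ext f z = (LINT x|lborel. f x * exp (- (\<i> * (z * of_real x))))"

text \<open>
  Its restrictions to the real axis form \<open>\<E> a\<close>. Working with the entire functions
  themselves makes division by \<open>z - z0\<close> and evaluation off the real axis available.
\<close>

definition PW :: "real \<Rightarrow> (complex \<Rightarrow> complex) set" where
  "PW a = {fourier_ext f | f. test_fun a f}"

lemma E_eq_PW: "\<E> a = (\<lambda>F t. F (of_real t)) ` PW a"
proof -
  have "fourier f = (\<lambda>t. fourier_ext f (of_real t))" for f
    by (auto simp: fourier_def fourier_ext_def fun_eq_iff)
  then show ?thesis
    unfolding \<E>_def PW_def test_fun_def support_condition by auto
qed

lemma exp_vector_derivative: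
  "((\<lambda>x. exp (c * of_real x)) has_vector_derivative c * exp (c * of_real x)) (at x)" for c :: complex
proof -
  have "((\<lambda>z. exp (c * z)) has_field_derivative c * exp (c * of_real x)) (at (of_real x))"
    by (auto intro!: derivative_eq_intros)
  then show ?thesis by (rule has_vector_derivative_real_field)
qed

lemma PW_I: "test_fun a f \<Longrightarrow> fourier_ext f = F \<Longrightarrow> F \<in> PW a"
  unfolding PW_def by auto

lemma test_fun_smooth: "test_fun a f \<Longrightarrow> smooth f"
  unfolding test_fun_def by (rule conjunct1)

lemma test_fun_zero: "test_fun a f \<Longrightarrow> \<bar>x\<bar> > a \<Longrightarrow> f x = 0"
  unfolding test_fun_def by force

lemma compact_support_integral:
  fixes g :: "real \<Rightarrow> complex"
  assumes "continuous_on UNIV g" "\<And>x. \<bar>x\<bar> > a \<Longrightarrow> g x = 0"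
  shows "integrable lborel g" "(LINT x|lborel. g x) = integral {-a..a} g"
proof -
  have *: "(\<lambda>x. indicator {-a..a} x *\<^sub>R g x) = g"
    using assms(2) by (force simp: indicator_def)
  have "integrable lborel (\<lambda>x. indicator {-a..a} x *\<^sub>R g x)"
    by (rule borel_integrable_compact[OF compact_Icc continuous_on_subset[OF assms(1) subset_UNIV]])
  then show "integrable lborel g" by (simp add: *)
  have "set_integrable lborel {-a..a} g"
    unfolding set_integrable_def * by fact
  from set_borel_integral_eq_integral(2)[OF this] show "(LINT x|lborel. g x) = integral {-a..a} g"
    unfolding set_lebesgue_integral_def * .
qed

lemma fourier_ext_integral:
  assumes "test_fun a f"
  shows "integrable lborel (\<lambda>x. f x * exp (- (\<i> * (z * of_real x))))"
    "fourier_ext f z = integral {-a..a} (\<lambda>x. f x * exp (- (\<i> * (z * of_real x))))"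
proof -
  have "continuous_on UNIV (\<lambda>x. f x * exp (- (\<i> * (z * of_real x))))"
    by (intro continuous_intros smooth_continuous test_fun_smooth[OF assms])
  note * = compact_support_integral[OF this, of a]
  show "integrable lborel (\<lambda>x. f x * exp (- (\<i> * (z * of_real x))))"
    by (rule *) (use test_fun_zero[OF assms] in auto)
  show "fourier_ext f z = integral {-a..a} (\<lambda>x. f x * exp (- (\<i> * (z * of_real x))))"
    unfolding fourier_ext_def by (rule *) (use test_fun_zero[OF assms] in auto)
qed

lemma test_fun_support:
  assumes "test_fun a f" shows "\<exists>r<a. \<forall>x. \<bar>x\<bar> > r \<longrightarrow> f x = 0"
  using assms unfolding test_fun_def by (rule conjunct2)

lemma fourier_ext_lin:
  assumes f: "test_fun a f" and g: "test_fun b g"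
  shows "fourier_ext (\<lambda>x. c * f x + d * g x) z = c * fourier_ext f z + d * fourier_ext g z"
proof -
  have "fourier_ext (\<lambda>x. c * f x + d * g x) z = (LINT x|lborel. c * (f x * exp (- (\<i> * (z * of_real x)))) + d * (g x * exp (- (\<i> * (z * of_real x)))))"
    unfolding fourier_ext_def by (simp only: distrib_right mult.assoc)
  also have "\<dots> = c * fourier_ext f z + d * fourier_ext g z"
    unfolding fourier_ext_def
    using Bochner_Integration.integral_add[OF integrable_mult_right[OF fourier_ext_integral(1)[OF f, of z], of c]
      integrable_mult_right[OF fourier_ext_integral(1)[OF g, of z], of d]]
    by (simp only: integral_mult_right_zero)
  finally show ?thesis .
qed

lemma test_fun_mono: "test_fun a f \<Longrightarrow> a \<le> b \<Longrightarrow> test_fun b f"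
  unfolding test_fun_def by force

lemma PW_lin:
  assumes "F \<in> PW a" "G \<in> PW a"
  shows "(\<lambda>z. c * F z + d * G z) \<in> PW a"
proof -
  obtain f g where f: "test_fun a f" "F = fourier_ext f" and g: "test_fun a g" "G = fourier_ext g"
    using assms unfolding PW_def by blast
  have "test_fun a (\<lambda>x. c * f x + d * g x)"
  proof -
    obtain r where r: "r < a" "\<And>x. \<bar>x\<bar> > r \<Longrightarrow> f x = 0" using test_fun_support[OF f(1)] by blast
    obtain s where s: "s < a" "\<And>x. \<bar>x\<bar> > s \<Longrightarrow> g x = 0" using test_fun_support[OF g(1)] by blast
    have "\<exists>r<a. \<forall>x. \<bar>x\<bar> > r \<longrightarrow> c * f x + d * g x = 0"
      by (intro exI[of _ "max r s"]) (simp add: r s)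
    then show ?thesis unfolding test_fun_def by (intro conjI smooth_lin test_fun_smooth[OF f(1)] test_fun_smooth[OF g(1)])
  qed
  moreover have "fourier_ext (\<lambda>x. c * f x + d * g x) = (\<lambda>z. c * F z + d * G z)"
    unfolding f(2) g(2) by (rule ext) (rule fourier_ext_lin[OF f(1) g(1)])
  ultimately show ?thesis by (rule PW_I)
qed

lemma PW_zero: "a > 0 \<Longrightarrow> (\<lambda>z. 0) \<in> PW a"
proof -
  assume "a > 0"
  have "smooth (\<lambda>x. 0)"
  proof (rule smooth_coinduct[where P = "\<lambda>f. f = (\<lambda>x. 0)"])
    fix g :: "real \<Rightarrow> complex" assume g: "g = (\<lambda>x. 0)"
    show "\<exists>g'. g' = (\<lambda>x. 0) \<and> (\<forall>x. (g has_vector_derivative g' x) (at x))"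
      unfolding g by (rule exI[of _ "\<lambda>x. 0"]) (simp add: has_vector_derivative_const)
  qed (rule refl)
  then have "test_fun a (\<lambda>x. 0)" unfolding test_fun_def by (auto intro: exI[of _ "a - 1"])
  moreover have "fourier_ext (\<lambda>x. 0) = (\<lambda>z. 0)" by (auto simp: fourier_ext_def fun_eq_iff)
  ultimately show ?thesis by (rule PW_I)
qed

lemma PW_cnj:
  assumes "F \<in> PW a"
  shows "(\<lambda>z. cnj (F (cnj z))) \<in> PW a"
proof -
  obtain f where f: "test_fun a f" "F = fourier_ext f" using assms unfolding PW_def by blast
  let ?g = "\<lambda>x. cnj (f (- x))"
  have "smooth (\<lambda>x. f ((-1) * x + 0))" by (rule smooth_affine[OF test_fun_smooth[OF f(1)]])
  then have "smooth ?g" by (intro smooth_cnj) simp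
  moreover have "\<exists>r<a. \<forall>x. \<bar>x\<bar> > r \<longrightarrow> ?g x = 0"
  proof -
    obtain r where r: "r < a" "\<forall>x. \<bar>x\<bar> > r \<longrightarrow> f x = 0" using test_fun_support[OF f(1)] by blast
    show ?thesis using r(1) r(2)[rule_format, of "- x" for x] by (intro exI[of _ r]) simp
  qed
  ultimately have "test_fun a ?g" unfolding test_fun_def by (rule conjI)
  moreover have "fourier_ext ?g = (\<lambda>z. cnj (F (cnj z)))"
  proof
    fix z
    have "cnj (F (cnj z)) = (LINT x|lborel. cnj (f x * exp (- (\<i> * (cnj z * of_real x)))))"
      unfolding f(2) fourier_ext_def by (rule Bochner_Integration.integral_cnj[symmetric])
    also have "\<dots> = (LINT x|lborel. cnj (f x) * exp (\<i> * (z * of_real x)))"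
      by (simp add: exp_cnj)
    also have "\<dots> = fourier_ext ?g z"
      unfolding fourier_ext_def using lborel_integral_real_affine[of "-1" "\<lambda>x. cnj (f x) * exp (\<i> * (z * of_real x))" 0] by simp
    finally show "fourier_ext ?g z = cnj (F (cnj z))" by simp
  qed
  ultimately show ?thesis by (rule PW_I)
qed

lemma PW_exp:
  assumes "F \<in> PW a"
  shows "(\<lambda>z. exp (\<i> * of_real \<tau> * z) * F z) \<in> PW (a + \<bar>\<tau>\<bar>)"
proof -
  obtain f where f: "test_fun a f" "F = fourier_ext f" using assms unfolding PW_def by blast
  let ?g = "\<lambda>x. f (x + \<tau>)"
  have "smooth ?g"
    using smooth_affine[OF test_fun_smooth[OF f(1)], of 1 \<tau>] by simp
  moreover obtain r where r: "r < a" "\<And>x. \<bar>x\<bar> > r \<Longrightarrow> f x = 0" using test_fun_support[OF f(1)] by blast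
  have "?g x = 0" if "\<bar>x\<bar> > r + \<bar>\<tau>\<bar>" for x
    by (rule r) (use that in linarith)
  ultimately have "test_fun (a + \<bar>\<tau>\<bar>) ?g"
    using r(1) unfolding test_fun_def by (intro conjI exI[of _ "r + \<bar>\<tau>\<bar>"]) auto
  moreover have "fourier_ext ?g = (\<lambda>z. exp (\<i> * of_real \<tau> * z) * F z)"
  proof
    fix z
    have "F z = (LINT x|lborel. f (\<tau> + x) * exp (- (\<i> * (z * of_real (\<tau> + x)))))"
      unfolding f(2) fourier_ext_def using lborel_integral_real_affine[of 1 "\<lambda>x. f x * exp (- (\<i> * (z * of_real x)))" \<tau>] by simp
    then have "exp (\<i> * of_real \<tau> * z) * F z = (LINT x|lborel. exp (\<i> * of_real \<tau> * z) * (f (\<tau> + x) * exp (- (\<i> * (z * of_real (\<tau> + x))))))"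
      by simp
    also have "\<dots> = fourier_ext ?g z"
      unfolding fourier_ext_def
      by (rule Bochner_Integration.integral_cong) (simp_all add: algebra_simps exp_add[symmetric] mult_exp_exp)
    finally show "fourier_ext ?g z = exp (\<i> * of_real \<tau> * z) * F z" by simp
  qed
  ultimately show ?thesis by (rule PW_I)
qed

text \<open>
  Differentiation of the test function becomes multiplication by \<open>\<i> * z\<close> through
  integration by parts.
\<close>

lemma fourier_ext_derivative:
  assumes "test_fun a f" and f': "smooth f'" "\<And>x. (f has_vector_derivative f' x) (at x)"
  shows "test_fun a f'" "fourier_ext f' z = \<i> * z * fourier_ext f z"
proof -
  obtain r where r: "r < a" "\<And>x. \<bar>x\<bar> > r \<Longrightarrow> f x = 0" using test_fun_support[OF assms(1)] by blast
  have "f' x = 0" if "\<bar>x\<bar> > r" for x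
  proof -
    have "((\<lambda>x. 0) has_vector_derivative f' x) (at x)"
      by (rule has_vector_derivative_transform_within_open[OF f'(2), of "{x. \<bar>x\<bar> > r}"])
        (use that r in \<open>simp_all add: open_Collect_less continuous_on_rabs\<close>)
    then show ?thesis by (rule vector_derivative_unique_at[OF _ has_vector_derivative_const])
  qed
  then have "\<exists>r<a. \<forall>x. \<bar>x\<bar> > r \<longrightarrow> f' x = 0" using r(1) by (intro exI[of _ r]) simp
  with f'(1) show tf: "test_fun a f'" unfolding test_fun_def by (rule conjI)
  let ?e = "\<lambda>x. exp (- (\<i> * (z * of_real x)))"
  define b where "b = \<bar>a\<bar> + 1"
  have tb: "test_fun b f" "test_fun b f'"
    by (rule test_fun_mono[OF assms(1)], simp add: b_def, rule test_fun_mono[OF tf], simp add: b_def)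
  have D: "((\<lambda>x. f x * ?e x) has_vector_derivative f' x * ?e x - \<i> * z * (f x * ?e x)) (at x)" for x
  proof -
    have "((\<lambda>x. f x * exp (- \<i> * z * of_real x)) has_vector_derivative
        f x * (- \<i> * z * exp (- \<i> * z * of_real x)) + f' x * exp (- \<i> * z * of_real x)) (at x)"
      by (rule has_vector_derivative_mult[OF f'(2) exp_vector_derivative])
    moreover have e: "exp (- \<i> * z * of_real x) = ?e x" for x by (simp add: mult.assoc)
    moreover have "f x * (- \<i> * z * E) + f' x * E = f' x * E - \<i> * z * (f x * E)" for E by (simp add: algebra_simps)
    ultimately show ?thesis by (simp only: e)
  qed
  have "-b \<le> b" by (simp add: b_def)
  then have "((\<lambda>x. f' x * ?e x - \<i> * z * (f x * ?e x)) has_integral (f b * ?e b - f (-b) * ?e (-b))) {-b..b}"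
    by (rule fundamental_theorem_of_calculus[OF _ has_vector_derivative_at_within[OF D]])
  moreover have "f b = 0" "f (-b) = 0" by (rule test_fun_zero[OF assms(1)], simp add: b_def)+
  ultimately have "integral {-b..b} (\<lambda>x. f' x * ?e x - \<i> * z * (f x * ?e x)) = 0"
    by (simp add: integral_unique)
  moreover have "(\<lambda>x. f' x * ?e x) integrable_on {-b..b}" "(\<lambda>x. f x * ?e x) integrable_on {-b..b}"
    by (intro integrable_continuous_real continuous_intros smooth_continuous test_fun_smooth[OF tb(1)] test_fun_smooth[OF tb(2)])+
  ultimately show "fourier_ext f' z = \<i> * z * fourier_ext f z"
    unfolding fourier_ext_integral(2)[OF tb(1)] fourier_ext_integral(2)[OF tb(2)]
    by (simp add: integral_diff integrable_on_mult_right integral_mult_right)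
qed

lemma PW_times_z:
  assumes "F \<in> PW a"
  shows "(\<lambda>z. z * F z) \<in> PW a"
proof -
  obtain f where f: "test_fun a f" "F = fourier_ext f" using assms unfolding PW_def by blast
  obtain f' where f': "smooth f'" "\<And>x. (f has_vector_derivative f' x) (at x)"
    using smooth_derivative[OF test_fun_smooth[OF f(1)]] by blast
  note * = fourier_ext_derivative[OF f(1) f']
  have "fourier_ext f' \<in> PW a" by (rule PW_I[OF *(1) refl])
  from PW_lin[OF this this, of "-\<i>" 0] show ?thesis by (simp add: * f(2) algebra_simps)
qed

text \<open>
  The quotient is, up to the factor \<open>\<i>\<close>, the transform of the solution \<open>h\<close> of
  \<open>h' = \<i> * z0 * h + g\<close> that vanishes near \<open>- \<infinity>\<close>. It also vanishes
  near \<open>\<infinity>\<close>, since the integral of \<open>g s * exp (- \<i> * z0 * s)\<close> is the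
  value of \<open>F\<close> at \<open>z0\<close>.
\<close>

lemma PW_divide:
  assumes "F \<in> PW a" "F z0 = 0"
  obtains H where "H \<in> PW a" "\<And>z. (z - z0) * H z = F z"
proof -
  obtain g where g: "test_fun a g" "F = fourier_ext g" using assms unfolding PW_def by blast
  obtain r where r: "r < a" "\<And>x. \<bar>x\<bar> > r \<Longrightarrow> g x = 0" using test_fun_support[OF g(1)] by blast
  define b where "b = max \<bar>a\<bar> \<bar>r\<bar> + 1"
  have gc: "continuous_on S g" for S by (rule smooth_continuous[OF test_fun_smooth[OF g(1)]])
  let ?k = "\<lambda>s. g s * exp (- (\<i> * (z0 * of_real s)))"
  define p where "p x = (if x \<ge> -b then integral {-b..x} ?k else 0)" for x
  have kc: "continuous_on S ?k" for S by (intro continuous_intros gc)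
  have k0: "?k x = 0" if "\<bar>x\<bar> > r" for x using r that by simp
  have p0: "p x = 0" if "x < - r" for x
  proof (cases "x \<ge> -b")
    case True
    have "integral {-b..x} ?k = integral {-b..x} (\<lambda>x. 0)"
      by (rule integral_cong) (use that k0 in auto)
    then show ?thesis by (simp add: p_def)
  qed (simp add: p_def)
  have "integral {-b..b} ?k = 0"
    using fourier_ext_integral(2)[OF test_fun_mono[OF g(1)], of b z0] assms(2) g(2) by (simp add: b_def)
  have p1: "p x = 0" if "x > r" for x
  proof (cases "x \<ge> - b")
    case True
    define c where "c = max x b"
    have I: "?k integrable_on S" if "S = {u..v}" for S u v
      unfolding that by (intro integrable_continuous_real kc)
    have *: "integral {-b..y} ?k + integral {y..c} ?k = integral {-b..c} ?k" if "-b \<le> y" "y \<le> c" for y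
      by (rule Henstock_Kurzweil_Integration.integral_combine) (use that I in auto)
    have z: "integral {y..c} ?k = 0" if "y > r" for y
    proof -
      have "integral {y..c} ?k = integral {y..c} (\<lambda>x. 0)"
        by (rule integral_cong) (use that k0 in auto)
      then show ?thesis by simp
    qed
    have "b > r" "b > 0" by (auto simp: b_def)
    then have "integral {-b..x} ?k = 0"
      using *[of x] *[of b] z[of x] z[of b] that True \<open>integral {-b..b} ?k = 0\<close> by (auto simp: c_def)
    then show ?thesis by (simp add: p_def)
  next
    case False
    then show ?thesis by (simp add: p_def)
  qed
  have pd: "(p has_vector_derivative ?k x) (at x)" for x
  proof (cases "x > -b")
    case True
    have "((\<lambda>x. integral {-b..x} ?k) has_vector_derivative ?k x) (at x within {-b..x+1})"
      by (rule integral_has_vector_derivative) (use True kc in auto)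
    then have "((\<lambda>x. integral {-b..x} ?k) has_vector_derivative ?k x) (at x)"
      using True by (subst (asm) at_within_interior) auto
    then show ?thesis
      by (rule has_vector_derivative_transform_within_open[of _ _ _ "{-b<..}"]) (use True in \<open>auto simp: p_def\<close>)
  next
    case False
    then have "x < - r" by (auto simp: b_def)
    have "((\<lambda>x. 0) has_vector_derivative ?k x) (at x)"
      using k0[of x] \<open>x < - r\<close> by auto
    then show ?thesis
      by (rule has_vector_derivative_transform_within_open[of _ _ _ "{..<-r}"])
        (use p0 \<open>x < - r\<close> in auto)
  qed
  define h where "h x = p x * exp (\<i> * (z0 * of_real x))" for x
  have hd: "(h has_vector_derivative \<i> * z0 * h x + g x) (at x)" for x
  proof -
    have "(h has_vector_derivative p x * (\<i> * z0 * exp (\<i> * (z0 * of_real x))) + ?k x * exp (\<i> * (z0 * of_real x))) (at x)"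
      unfolding h_def
      using has_vector_derivative_mult[OF pd[of x] exp_vector_derivative[of "\<i> * z0" x]]
      by (simp only: mult.assoc)
    moreover have "?k x * exp (\<i> * (z0 * of_real x)) = g x"
      by (simp add: mult.assoc mult_exp_exp)
    moreover have "p x * (\<i> * z0 * exp (\<i> * (z0 * of_real x))) = \<i> * z0 * h x"
      by (simp add: h_def)
    ultimately show ?thesis by (simp only:)
  qed
  have hs: "smooth h"
  proof (rule smooth_coinduct[where P = "\<lambda>q. \<exists>c u. smooth u \<and> q = (\<lambda>x. c * h x + u x)"])
    show "\<exists>c u. smooth u \<and> h = (\<lambda>x. c * h x + u x)"
      using smooth_lin[OF test_fun_smooth[OF g(1)] test_fun_smooth[OF g(1)], of 0 0]
      by (intro exI[of _ 1] exI[of _ "\<lambda>x. 0"]) simp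
    fix q assume "\<exists>c u. smooth u \<and> q = (\<lambda>x. c * h x + u x)"
    then obtain c u where q: "smooth u" "q = (\<lambda>x. c * h x + u x)" by blast
    obtain u' where u': "smooth u'" "\<And>x. (u has_vector_derivative u' x) (at x)"
      using smooth_derivative[OF q(1)] by blast
    have "(q has_vector_derivative c * (\<i> * z0 * h x + g x) + u' x) (at x)" for x
      unfolding q by (intro has_vector_derivative_add has_vector_derivative_mult_right hd u')
    moreover have "smooth (\<lambda>x. c * g x + 1 * u' x)"
      by (rule smooth_lin[OF test_fun_smooth[OF g(1)] u'(1)])
    moreover have "c * (\<i> * z0 * h x + g x) + u' x = c * (\<i> * z0) * h x + (c * g x + 1 * u' x)" for x
      by (simp add: algebra_simps)
    ultimately have "\<forall>x. (q has_vector_derivative c * (\<i> * z0) * h x + (c * g x + 1 * u' x)) (at x)"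
        "smooth (\<lambda>x. c * g x + 1 * u' x)" by simp_all
    then show "\<exists>q'. (\<exists>c u. smooth u \<and> q' = (\<lambda>x. c * h x + u x)) \<and> (\<forall>x. (q has_vector_derivative q' x) (at x))"
      by (intro exI[of _ "\<lambda>x. c * (\<i> * z0) * h x + (c * g x + 1 * u' x)"] conjI
        exI[of _ "c * (\<i> * z0)"] exI[of _ "\<lambda>x. c * g x + 1 * u' x"] refl)
  qed
  have ht: "test_fun a h"
  proof (unfold test_fun_def, intro conjI hs exI[of _ r] r(1) allI impI)
    fix x assume "\<bar>x\<bar> > r"
    then have "p x = 0" using p0[of x] p1[of x] by linarith
    then show "h x = 0" by (simp add: h_def)
  qed
  have "smooth (\<lambda>x. (\<i> * z0) * h x + 1 * g x)"
    by (rule smooth_lin[OF hs test_fun_smooth[OF g(1)]])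
  with fourier_ext_derivative(2)[OF ht _ hd]
  have 1: "fourier_ext (\<lambda>x. \<i> * z0 * h x + g x) z = \<i> * z * fourier_ext h z" for z by simp
  have 2: "fourier_ext (\<lambda>x. \<i> * z0 * h x + g x) z = \<i> * z0 * fourier_ext h z + fourier_ext g z" for z
    using fourier_ext_lin[OF ht g(1), of "\<i> * z0" 1 z] by simp
  have H: "fourier_ext h \<in> PW a" by (rule PW_I[OF ht refl])
  have "(z - z0) * (\<i> * fourier_ext h z) = F z" for z
    using 1[of z] 2[of z] unfolding g(2) by (simp add: algebra_simps)
  moreover have "(\<lambda>z. \<i> * fourier_ext h z) \<in> PW a" using PW_lin[OF H H, of \<i> 0] by simp
  ultimately show ?thesis using that by blast
qed

lemma PW_holomorphic: "F \<in> PW a \<Longrightarrow> F holomorphic_on S"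
proof -
  assume "F \<in> PW a"
  then obtain f where f: "test_fun a f" "F = fourier_ext f" unfolding PW_def by blast
  have fc: "continuous_on S f" for S by (rule smooth_continuous[OF test_fun_smooth[OF f(1)]])
  have "(\<lambda>z. integral (cbox (-a) a) (\<lambda>x. f x * exp (- (\<i> * (z * of_real x))))) holomorphic_on UNIV"
  proof (rule leibniz_rule_holomorphic)
    show "((\<lambda>z. f t * exp (- (\<i> * (z * of_real t)))) has_field_derivative
        f t * (- (\<i> * of_real t)) * exp (- (\<i> * (z * of_real t)))) (at z within UNIV)" for z t
      by (auto intro!: derivative_eq_intros)
    show "(\<lambda>t. f t * exp (- (\<i> * (z * of_real t)))) integrable_on cbox (- a) a" for z
      by (auto intro!: integrable_continuous_real continuous_intros fc)
    show "continuous_on (UNIV \<times> cbox (- a) a)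
        (\<lambda>(z, t). f t * (- (\<i> * of_real t)) * exp (- (\<i> * (z * of_real t))))"
      unfolding split_def
      by (intro continuous_intros continuous_on_compose2[OF fc[of UNIV]]) auto
  qed auto
  moreover have "F = (\<lambda>z. integral (cbox (-a) a) (\<lambda>x. f x * exp (- (\<i> * (z * of_real x)))))"
    unfolding f(2) using fourier_ext_integral(2)[OF f(1)] by (auto simp: fun_eq_iff)
  ultimately show ?thesis using holomorphic_on_subset by blast
qed

lemma PW_growth:
  assumes "F \<in> PW a" "a > 0"
  obtains C where "C > 0" "\<And>z. cmod (F z) \<le> C * exp (a * \<bar>Im z\<bar>)"
proof -
  obtain f where f: "test_fun a f" "F = fourier_ext f" using assms unfolding PW_def by blast
  have fc: "continuous_on S f" for S by (rule smooth_continuous[OF test_fun_smooth[OF f(1)]])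
  define C where "C = integral {-a..a} (\<lambda>x. cmod (f x)) + 1"
  have "C > 0" unfolding C_def by (intro add_nonneg_pos integral_nonneg integrable_continuous_real continuous_intros fc) auto
  moreover have "cmod (F z) \<le> C * exp (a * \<bar>Im z\<bar>)" for z
  proof -
    have "cmod (F z) = norm (integral {-a..a} (\<lambda>x. f x * exp (- (\<i> * (z * of_real x)))))"
      using f fourier_ext_integral(2)[OF f(1)] by simp
    also have "\<dots> \<le> integral {-a..a} (\<lambda>x. cmod (f x) * exp (a * \<bar>Im z\<bar>))"
    proof (rule integral_norm_bound_integral)
      fix x assume "x \<in> {-a..a}"
      then have "\<bar>Im z * x\<bar> \<le> \<bar>Im z\<bar> * a"
        unfolding abs_mult by (intro mult_left_mono) auto
      then have "Im z * x \<le> a * \<bar>Im z\<bar>" by (simp add: mult.commute)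
      then show "norm (f x * exp (- (\<i> * (z * of_real x)))) \<le> cmod (f x) * exp (a * \<bar>Im z\<bar>)"
        by (auto simp: norm_mult intro!: mult_left_mono)
    qed (auto intro!: integrable_continuous_real continuous_intros fc)
    also have "\<dots> \<le> C * exp (a * \<bar>Im z\<bar>)"
      unfolding C_def by simp
    finally show ?thesis .
  qed
  ultimately show ?thesis using that by blast
qed

text \<open>
  The class is closed under multiplication by powers of \<open>z\<close>, and its members are bounded on
  the real axis.
\<close>

lemma PW_decay:
  assumes "F \<in> PW a" "a > 0"
  obtains C where "C > 0" "\<And>t. cmod (F (of_real t)) \<le> C / (1 + \<bar>t\<bar>) ^ k"
proof -
  have 1: "(\<lambda>z. z ^ k * F z) \<in> PW a" if "F \<in> PW a" for k F
  proof (induction k)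
    case (Suc k)
    then show ?case using PW_times_z[OF Suc] by (simp add: mult.assoc)
  qed (use that in simp)
  obtain C where C: "C > 0" "\<And>z. cmod (F z) \<le> C * exp (a * \<bar>Im z\<bar>)"
    using PW_growth[OF assms] by blast
  obtain D where D: "D > 0" "\<And>z. cmod (z ^ k * F z) \<le> D * exp (a * \<bar>Im z\<bar>)"
    using PW_growth[OF 1[OF assms(1)] assms(2), of k] by blast
  have "cmod (F (of_real t)) \<le> (2 ^ k * (C + D)) / (1 + \<bar>t\<bar>) ^ k" for t
  proof -
    have "(1 + \<bar>t\<bar>) ^ k \<le> (2 * max 1 \<bar>t\<bar>) ^ k" by (intro power_mono) auto
    also have "\<dots> \<le> 2 ^ k * (1 + \<bar>t\<bar> ^ k)"
      by (auto simp: power_mult_distrib max_def)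
    finally have "cmod (F (of_real t)) * (1 + \<bar>t\<bar>) ^ k \<le> cmod (F (of_real t)) * (2 ^ k * (1 + \<bar>t\<bar> ^ k))"
      by (intro mult_left_mono) auto
    also have "\<dots> = 2 ^ k * (cmod (F (of_real t)) + cmod (of_real t ^ k * F (of_real t)))"
      by (simp add: norm_mult norm_power algebra_simps)
    also have "\<dots> \<le> 2 ^ k * (C + D)"
      using C(2)[of "of_real t"] D(2)[of "of_real t"] by (intro mult_left_mono add_mono) auto
    finally show ?thesis by (simp add: field_simps)
  qed
  moreover have "2 ^ k * (C + D) > 0" using C D by simp
  ultimately show ?thesis using that by blast
qed

text \<open>
  The transform of a rescaled bump. Stretching the transform horizontally shrinks the support of the bump,
  so the dilations stay in the class; they tend to \<open>1\<close> pointwise and serve as a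
  multiplicative approximate unit.
\<close>

lemma PW_bump:
  assumes "a > 0"
  shows "\<exists>F. F \<in> PW a \<and> F \<i> \<noteq> 0 \<and> F 0 = 1 \<and> (\<forall>t. cmod (F (of_real t)) \<le> 1) \<and>
    (\<forall>k::nat. (\<lambda>z. F (z / of_nat (Suc k))) \<in> PW a)"
proof -
  obtain f :: "real \<Rightarrow> real" where f: "smooth (\<lambda>x. of_real (f x))"
    "\<And>x. f x \<ge> 0" "\<And>x. \<bar>x\<bar> \<ge> 1 \<Longrightarrow> f x = 0" "\<And>x. \<bar>x\<bar> < 1 \<Longrightarrow> f x > 0"
    using smooth_bump by metis
  have scaled: "test_fun b (\<lambda>x. of_real (f (c * x)))" if "c > 0" "c * b > 1" for b c
  proof -
    have "\<bar>c * x\<bar> \<ge> 1" if "\<bar>x\<bar> > 1 / c" for x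
      using that \<open>c > 0\<close> by (simp add: abs_mult field_simps)
    then have "f (c * x) = 0" if "\<bar>x\<bar> > 1 / c" for x
      using that f(3) by blast
    moreover have "1 / c < b" using that by (simp add: field_simps)
    ultimately show ?thesis
      using smooth_affine[OF f(1), of c 0] unfolding test_fun_def by (intro conjI exI[of _ "1 / c"]) simp_all
  qed
  define g where "g x = f (2 / a * x)" for x
  have g: "test_fun a (\<lambda>x. of_real (g x))" unfolding g_def by (rule scaled) (use assms in auto)
  have gc: "continuous_on S g" for S
  proof -
    have "smooth (\<lambda>x. of_real (g x))" using g unfolding test_fun_def by (rule conjunct1)
    from continuous_on_Re[OF smooth_continuous[OF this]]
    have "continuous_on S (\<lambda>x. Re (of_real (g x)))" .
    then show ?thesis by simp
  qed
  have g0: "g x \<ge> 0" for x using f by (simp add: g_def)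
  have intor: "integral {-a..a} (\<lambda>x. complex_of_real (k x)) = of_real (integral {-a..a} k)"
    if "continuous_on {-a..a} k" for k
    using integral_linear[OF integrable_continuous_real[OF that] bounded_linear_of_real] by (simp add: o_def)
  have pos: "integral {-a..a} (\<lambda>x. g x * exp (c * x)) > 0" for c :: real
  proof -
    have "integral {-a..a} (\<lambda>x. g x * exp (c * x)) \<noteq> 0"
    proof
      assume "integral {-a..a} (\<lambda>x. g x * exp (c * x)) = 0"
      moreover have "(\<lambda>x. g x * exp (c * x)) integrable_on {-a..a}"
        by (intro integrable_continuous_real continuous_intros gc)
      ultimately have "((\<lambda>x. g x * exp (c * x)) has_integral 0) (cbox (-a) a)"
        by (auto simp: has_integral_iff)
      then have "g 0 * exp (c * 0) = 0"
        by (intro has_integral_0_cbox_imp_0[of "-a" a]) (use g0 assms in \<open>auto intro!: continuous_intros gc simp: box_real\<close>)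
      then show False using f(4)[of 0] by (simp add: g_def)
    qed
    moreover have "integral {-a..a} (\<lambda>x. g x * exp (c * x)) \<ge> 0"
      by (intro integral_nonneg integrable_continuous_real continuous_intros gc) (auto simp: g0)
    ultimately show ?thesis by simp
  qed
  define I where "I = integral {-a..a} g"
  have "I > 0" using pos[of 0] by (simp add: I_def)
  define F where "F z = fourier_ext (\<lambda>x. of_real (g x)) z / of_real I" for z
  have FG: "F = (\<lambda>z. (1 / of_real I) * fourier_ext (\<lambda>x. of_real (g x)) z + 0 * fourier_ext (\<lambda>x. of_real (g x)) z)"
    by (auto simp: F_def)
  have int: "fourier_ext (\<lambda>x. of_real (g x)) z = integral {-a..a} (\<lambda>x. of_real (g x) * exp (- (\<i> * (z * of_real x))))" for z
    by (rule fourier_ext_integral(2)[OF g])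
  show ?thesis
  proof (intro exI[of _ F] conjI allI)
    show "F \<in> PW a" unfolding FG by (rule PW_lin) (use g in \<open>auto simp: PW_def\<close>)
    have "fourier_ext (\<lambda>x. of_real (g x)) \<i> = integral {-a..a} (\<lambda>x. of_real (g x * exp (1 * x)))"
      unfolding int by (rule integral_cong) (simp add: exp_of_real mult.assoc[symmetric])
    also have "\<dots> = of_real (integral {-a..a} (\<lambda>x. g x * exp (1 * x)))"
      by (rule intor) (intro continuous_intros gc)
    finally show "F \<i> \<noteq> 0" using pos[of 1] \<open>I > 0\<close> by (simp add: F_def)
    have "fourier_ext (\<lambda>x. of_real (g x)) 0 = of_real I"
      unfolding int I_def using intor[OF gc] by simp
    then show "F 0 = 1" using \<open>I > 0\<close> by (simp add: F_def)
    show "cmod (F (of_real t)) \<le> 1" for t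
    proof -
      have "cmod (fourier_ext (\<lambda>x. of_real (g x)) (of_real t)) \<le> I"
        unfolding int I_def
        by (rule integral_norm_bound_integral)
          (auto simp: norm_mult g0 intro!: integrable_continuous_real continuous_intros gc)
      then show ?thesis using \<open>I > 0\<close> by (simp add: F_def norm_divide)
    qed
    show "(\<lambda>z. F (z / of_nat (Suc k))) \<in> PW a" for k
    proof -
      let ?c = "real (Suc k)"
      have t: "test_fun a (\<lambda>x. of_real (g (?c * x)))"
        unfolding g_def mult.assoc[symmetric]
        by (rule scaled) (use assms in \<open>auto simp: field_simps add_pos_nonneg\<close>)
      have "fourier_ext (\<lambda>x. of_real (g x)) (z / of_nat (Suc k)) = of_real ?c * fourier_ext (\<lambda>x. of_real (g (?c * x))) z" for z
      proof -
        have "fourier_ext (\<lambda>x. of_real (g x)) (z / of_nat (Suc k)) =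
          \<bar>?c\<bar> *\<^sub>R (LINT x|lborel. of_real (g (0 + ?c * x)) * exp (- (\<i> * (z / of_nat (Suc k) * of_real (0 + ?c * x)))))"
          unfolding fourier_ext_def by (rule lborel_integral_real_affine) simp
        also have "\<dots> = of_real ?c * fourier_ext (\<lambda>x. of_real (g (?c * x))) z"
          unfolding fourier_ext_def scaleR_conv_of_real by (simp del: of_nat_Suc)
        finally show ?thesis .
      qed
      then have "(\<lambda>z. F (z / of_nat (Suc k))) = (\<lambda>z. (of_real ?c / of_real I) * fourier_ext (\<lambda>x. of_real (g (?c * x))) z + 0 * fourier_ext (\<lambda>x. of_real (g (?c * x))) z)"
        by (auto simp: F_def fun_eq_iff simp del: of_nat_Suc)
      then show ?thesis using t by (simp only:) (rule PW_lin, auto simp: PW_def)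
    qed
  qed
qed

section \<open>Logarithmic means of bounded holomorphic functions\<close>

lemma integral_period:
  fixes u :: "real \<Rightarrow> real"
  assumes cont: "continuous_on UNIV u" and per: "\<And>x. u (x + p) = u x" and "b \<le> a" "a \<le> b + p"
  shows "integral {a..a + p} u = integral {b..b + p} u"
proof -
  have int: "u integrable_on {x..y}" for x y
    by (intro integrable_continuous_real continuous_on_subset[OF cont]) auto
  have "integral {b + p..a + p} u = integral {b..a} u"
    using integral_shift_real_ivl[of "b + p" p "a + p" u] per by simp
  moreover have "integral {b..a} u + integral {a..b + p} u = integral {b..b + p} u"
    by (rule Henstock_Kurzweil_Integration.integral_combine) (use assms int in auto)
  moreover have "integral {a..b + p} u + integral {b + p..a + p} u = integral {a..a + p} u"
    by (rule Henstock_Kurzweil_Integration.integral_combine) (use assms int in auto)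
  ultimately show ?thesis by linarith
qed

lemma riemann_sum_lower:
  fixes u :: "real \<Rightarrow> real"
  assumes cont: "continuous_on UNIV u" and "h > 0"
    and close: "\<And>x y. x \<in> {a..a + real n * h} \<Longrightarrow> y \<in> {a..a + real n * h} \<Longrightarrow> \<bar>x - y\<bar> \<le> h \<Longrightarrow> u x - \<kappa> \<le> u y"
  shows "h * (\<Sum>k<n. u (a + real k * h)) - real n * h * \<kappa> \<le> integral {a..a + real n * h} u"
  using close
proof (induction n)
  case (Suc n)
  have int: "u integrable_on {x..y}" for x y
    by (intro integrable_continuous_real continuous_on_subset[OF cont]) auto
  let ?b = "a + real n * h" and ?c = "a + real (Suc n) * h"
  have c: "?c = ?b + h" by (simp add: algebra_simps)
  have IH: "h * (\<Sum>k<n. u (a + real k * h)) - real n * h * \<kappa> \<le> integral {a..?b} u"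
    by (rule Suc.IH, rule Suc.prems) (use \<open>h > 0\<close> in \<open>auto simp: algebra_simps\<close>)
  have b: "a \<le> ?b" using \<open>h > 0\<close> by simp
  have "integral {a..?b} u + integral {?b..?c} u = integral {a..?c} u"
    by (rule Henstock_Kurzweil_Integration.integral_combine) (use b c int \<open>h > 0\<close> in auto)
  moreover have "integral {?b..?c} (\<lambda>x. u ?b - \<kappa>) \<le> integral {?b..?c} u"
  proof (rule integral_le)
    show "u ?b - \<kappa> \<le> u x" if "x \<in> {?b..?c}" for x
      proof (rule Suc.prems)
      show "x \<in> {a..?c}" using that b by auto
    qed (use that b c \<open>h > 0\<close> in auto)
  qed (use int in auto)
  moreover have "integral {?b..?c} (\<lambda>x. u ?b - \<kappa>) = h * (u ?b - \<kappa>)"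
    using c \<open>h > 0\<close> by (simp add: algebra_simps)
  ultimately show ?case using IH by (simp add: algebra_simps)
qed simp

lemma max_on_circle:
  assumes "continuous_on (cball 0 1) P" "P holomorphic_on ball 0 1"
  obtains \<theta> where "\<theta> \<in> {-pi..pi}" "cmod (P 0) \<le> cmod (P (cis \<theta>))"
proof -
  have "continuous_on (sphere 0 1) (\<lambda>\<zeta>. cmod (P \<zeta>))"
    by (intro continuous_intros continuous_on_subset[OF assms(1)]) auto
  then have "\<exists>\<zeta>\<in>sphere 0 1. \<forall>\<xi>\<in>sphere 0 1. cmod (P \<xi>) \<le> cmod (P \<zeta>)"
    by (intro continuous_attains_sup) auto
  then obtain \<zeta> where \<zeta>: "cmod \<zeta> = 1" "\<And>\<xi>. cmod \<xi> = 1 \<Longrightarrow> cmod (P \<xi>) \<le> cmod (P \<zeta>)" by auto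
  have "cmod (P 0) \<le> cmod (P \<zeta>)"
    by (rule maximum_modulus_frontier[of P "ball 0 1"]) (use assms \<zeta> in auto)
  moreover have "cis (Arg \<zeta>) = \<zeta>"
    using \<zeta>(1) cis_Arg[of \<zeta>] by (cases "\<zeta> = 0") (auto simp: sgn_eq)
  ultimately show ?thesis
    using that[of "Arg \<zeta>"] Arg_bounded[of \<zeta>] by simp
qed

text \<open>
  The submean value inequality for \<open>ln (cmod g)\<close>. The product of the \<open>N\<close>
  rotations of \<open>g\<close> by the \<open>N\<close>-th roots of unity is holomorphic with value
  \<open>g 0 ^ N\<close> at \<open>0\<close>, so at some point of the circle it has at least this modulus;
  taking logarithms, some mean of \<open>ln (cmod g + \<epsilon>)\<close> over \<open>N\<close>
  equidistant points is at least \<open>ln (cmod (g 0))\<close>, and these means converge to the integral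
  mean uniformly in the position of the points.
\<close>

lemma circle_mean:
  assumes cont: "continuous_on (cball 0 1) g" and hol: "g holomorphic_on ball 0 1" and "\<epsilon> > 0"
  shows "cmod (g 0) \<le> exp (1 / (2 * pi) * integral {-pi..pi} (\<lambda>\<theta>. ln (cmod (g (cis \<theta>)) + \<epsilon>)))"
proof (cases "g 0 = 0")
  case True
  then show ?thesis by simp
next
  case False
  define u where "u \<theta> = ln (cmod (g (cis \<theta>)) + \<epsilon>)" for \<theta>
  have pos: "cmod (g \<zeta>) + \<epsilon> > 0" for \<zeta> using \<open>\<epsilon> > 0\<close> by (simp add: add_nonneg_pos)
  have ucont: "continuous_on UNIV u"
    unfolding u_def
    by (intro continuous_intros continuous_on_compose2[OF cont]) (auto simp: pos less_imp_neq[OF pos, symmetric])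
  have uper: "u (x + 2 * pi) = u x" for x
    by (simp add: u_def cis.code)
  have main: "ln (cmod (g 0)) * (2 * pi) \<le> integral {-pi..pi} u + 2 * pi * \<kappa>" if "\<kappa> > 0" for \<kappa>
  proof -
    \<comment> \<open>the interval contains one full period starting anywhere in \<open>{-pi..pi}\<close>\<close>
    have "uniformly_continuous_on {-pi..3 * pi} u"
      by (intro compact_uniformly_continuous continuous_on_subset[OF ucont]) auto
    then obtain d where d: "d > 0"
      "\<And>x y. x \<in> {-pi..3 * pi} \<Longrightarrow> y \<in> {-pi..3 * pi} \<Longrightarrow> dist y x < d \<Longrightarrow> dist (u y) (u x) < \<kappa>"
      unfolding uniformly_continuous_on_def using \<open>\<kappa> > 0\<close> by metis
    obtain N :: nat where N: "real N > 2 * pi / d" using reals_Archimedean2 by blast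
    have N0: "N > 0" proof (rule gr0I)
      assume "N = 0"
      moreover have "2 * pi / d > 0" using d(1) by simp
      ultimately show False using N by simp
    qed
    define h where "h = 2 * pi / real N"
    have h: "h > 0" "real N * h = 2 * pi" "h < d"
      using N0 N d(1) by (auto simp: h_def field_simps)
    define P where "P \<zeta> = (\<Prod>k<N. g (cis (real k * h) * \<zeta>))" for \<zeta>
    have "continuous_on (cball 0 1) P"
      unfolding P_def by (intro continuous_intros continuous_on_compose2[OF cont]) (auto simp: norm_mult)
    moreover have "(g \<circ> (\<lambda>\<zeta>. cis (real k * h) * \<zeta>)) holomorphic_on ball 0 1" for k
      by (intro holomorphic_on_compose_gen[OF _ hol] holomorphic_intros) (auto simp: norm_mult)
    then have "P holomorphic_on ball 0 1"
      unfolding P_def o_def by (intro holomorphic_intros)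
    ultimately obtain \<theta> where \<theta>: "\<theta> \<in> {-pi..pi}" "cmod (P 0) \<le> cmod (P (cis \<theta>))"
      by (rule max_on_circle)
    have "cmod (g 0) ^ N = cmod (P 0)" by (simp add: P_def prod_norm[symmetric] norm_power)
    also note \<theta>(2)
    also have "cmod (P (cis \<theta>)) = (\<Prod>k<N. cmod (g (cis (\<theta> + real k * h))))"
      by (simp add: P_def prod_norm[symmetric] cis_mult add.commute)
    also have "\<dots> \<le> (\<Prod>k<N. exp (u (\<theta> + real k * h)))"
      by (intro prod_mono) (auto simp: u_def pos \<open>\<epsilon> > 0\<close> less_imp_le)
    also have "\<dots> = exp (\<Sum>k<N. u (\<theta> + real k * h))" by (simp add: exp_sum)
    finally have "ln (cmod (g 0) ^ N) \<le> ln (exp (\<Sum>k<N. u (\<theta> + real k * h)))"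
      using False by (subst ln_le_cancel_iff) auto
    then have "real N * ln (cmod (g 0)) \<le> (\<Sum>k<N. u (\<theta> + real k * h))"
      using False by (simp add: ln_realpow)
    then have "h * (real N * ln (cmod (g 0))) \<le> h * (\<Sum>k<N. u (\<theta> + real k * h))"
      using h(1) by (intro mult_left_mono) auto
    also have "\<dots> - real N * h * \<kappa> \<le> integral {\<theta>..\<theta> + real N * h} u"
    proof (rule riemann_sum_lower[OF ucont h(1)])
      fix x y assume "x \<in> {\<theta>..\<theta> + real N * h}" "y \<in> {\<theta>..\<theta> + real N * h}" "\<bar>x - y\<bar> \<le> h"
      then have "dist (u x) (u y) < \<kappa>"
        using \<theta>(1) h by (intro d(2)) (auto simp: dist_real_def)
      then show "u x - \<kappa> \<le> u y" by (auto simp: dist_real_def)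
    qed
    also have "integral {\<theta>..\<theta> + real N * h} u = integral {-pi..-pi + 2 * pi} u"
      unfolding h(2) by (rule integral_period[OF ucont uper]) (use \<theta> in auto)
    finally have "h * (real N * ln (cmod (g 0))) \<le> integral {-pi..pi} u + real N * h * \<kappa>" by simp
    moreover have "h * (real N * ln (cmod (g 0))) = 2 * pi * ln (cmod (g 0))"
    proof -
      have "h * (real N * ln (cmod (g 0))) = (real N * h) * ln (cmod (g 0))" by (simp only: ac_simps)
      then show ?thesis by (simp only: h(2))
    qed
    ultimately show ?thesis unfolding h(2) by (simp only: mult.commute)
  qed
  have "ln (cmod (g 0)) * (2 * pi) \<le> integral {-pi..pi} u"
  proof (rule field_le_epsilon)
    fix e :: real assume "e > 0"
    then show "ln (cmod (g 0)) * (2 * pi) \<le> integral {-pi..pi} u + e"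
      using main[of "e / (2 * pi)"] by simp
  qed
  then have "ln (cmod (g 0)) \<le> 1 / (2 * pi) * integral {-pi..pi} u"
    by (simp add: field_simps)
  then show ?thesis using False unfolding u_def by (metis exp_le_cancel_iff exp_ln zero_less_norm_iff)
qed

text \<open>
  The Cayley transform centred at \<open>Complex x y\<close> carries the unit disc to the upper half-plane
  and the circle point \<open>cis \<theta>\<close> to \<open>x + y * tan (\<theta> / 2)\<close>. The
  singularity at \<open>cis pi\<close> is avoided by passing to the limit of circles of radius less than
  one; the positive \<open>\<epsilon>\<close> keeps the logarithms bounded.
\<close>

lemma half_plane_mean_circle:
  assumes cont: "continuous_on {z. Im z \<ge> 0} G" and hol: "G holomorphic_on {z. Im z > 0}"
    and bd: "\<And>z. Im z \<ge> 0 \<Longrightarrow> cmod (G z) \<le> M" and "\<epsilon> > 0" "y > 0"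
  shows "(\<lambda>\<theta>. ln (cmod (G (of_real (x + y * tan (\<theta> / 2)))) + \<epsilon>)) absolutely_integrable_on {-pi<..<pi}" (is ?I)
    "cmod (G (Complex x y)) \<le> exp (1 / (2 * pi) *
        integral {-pi<..<pi} (\<lambda>\<theta>. ln (cmod (G (of_real (x + y * tan (\<theta> / 2)))) + \<epsilon>)))"
proof -
  define \<phi> where "\<phi> \<zeta> = of_real x + \<i> * of_real y * ((1 - \<zeta>) / (1 + \<zeta>))" for \<zeta> :: complex
  have M: "M \<ge> 0" using bd[of 0] norm_ge_zero[of "G 0"] by (simp del: norm_ge_zero)
  have pos: "cmod (G \<zeta>) + \<epsilon> > 0" for \<zeta> using \<open>\<epsilon> > 0\<close> by (simp add: add_nonneg_pos)
  have Re_quot: "Re ((1 - \<zeta>) / (1 + \<zeta>)) > 0" if "cmod \<zeta> < 1" for \<zeta>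
  proof -
    have ne: "1 + \<zeta> \<noteq> 0" using that by (metis add_eq_0_iff less_irrefl norm_minus_cancel norm_one)
    have "Re ((1 - \<zeta>) / (1 + \<zeta>)) = (1 - (cmod \<zeta>)\<^sup>2) / (cmod (1 + \<zeta>))\<^sup>2"
      unfolding Re_divide' cmod_power2 by (simp add: power2_eq_square algebra_simps)
    moreover have "(cmod \<zeta>)\<^sup>2 < 1" using that by (simp add: power_less_one_iff abs_square_less_1)
    ultimately show ?thesis using ne by simp
  qed
  have Im_\<phi>: "Im (\<phi> \<zeta>) > 0" if "cmod \<zeta> < 1" for \<zeta>
  proof -
    have "Im (of_real x + \<i> * of_real y * q) = y * Re q" for q by simp
    then show ?thesis using Re_quot[OF that] \<open>y > 0\<close> unfolding \<phi>_def by (metis mult_pos_pos)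
  qed
  have \<phi>_cis: "\<phi> (cis \<theta>) = of_real (x + y * tan (\<theta> / 2))" if "\<theta> \<in> {-pi<..<pi}" for \<theta>
  proof -
    have c: "cos (\<theta> / 2) > 0" using that by (intro cos_gt_zero_pi) auto
    define w where "w = cis (\<theta> / 2)"
    have w: "cis \<theta> = w * w" "w \<noteq> 0" by (auto simp: w_def cis_mult)
    have wc: "w * cnj w = 1" by (simp add: w_def cis_cnj cis_mult)
    have "(1 - cis \<theta>) / (1 + cis \<theta>) = (w * (cnj w - w)) / (w * (cnj w + w))"
      by (simp add: w(1) ring_distribs wc)
    also have "\<dots> = (cnj w - w) / (cnj w + w)" using w(2) by simp
    also have "\<dots> = - \<i> * of_real (tan (\<theta> / 2))"
    proof -
      have "cnj w - w = - 2 * \<i> * of_real (sin (\<theta> / 2))" "cnj w + w = 2 * of_real (cos (\<theta> / 2))"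
        by (auto simp: w_def complex_eq_iff)
      then show ?thesis using c by (simp only:) (simp add: tan_def)
    qed
    finally have "\<phi> (cis \<theta>) = of_real x + \<i> * of_real y * (- \<i> * of_real (tan (\<theta> / 2)))"
      unfolding \<phi>_def by (simp only:)
    then show ?thesis by (simp add: complex_eq_iff)
  qed
  define r where "r n = 1 - 1 / (real n + 2)" for n :: nat
  have r: "0 < r n" "r n < 1" for n by (auto simp: r_def field_simps)
  have rlim: "r \<longlonglongrightarrow> 1" unfolding r_def by real_asymp
  define f where "f n \<theta> = ln (cmod (G (\<phi> (of_real (r n) * cis \<theta>))) + \<epsilon>)" for n \<theta>
  define f' where "f' \<theta> = ln (cmod (G (of_real (x + y * tan (\<theta> / 2)))) + \<epsilon>)" for \<theta>
  have lt1: "cmod (of_real (r n) * \<zeta>) < 1" if "cmod \<zeta> \<le> 1" for n \<zeta>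
  proof -
    have "r n * cmod \<zeta> \<le> r n * 1" using that r[of n] by (intro mult_left_mono) auto
    then have "r n * cmod \<zeta> < 1" using r(2)[of n] by simp
    then show ?thesis using r(1)[of n] by (simp add: norm_mult)
  qed
  have ne1: "1 + of_real (r n) * \<zeta> \<noteq> 0" if "cmod \<zeta> \<le> 1" for n \<zeta>
    using lt1[OF that, of n] by (metis add_eq_0_iff less_irrefl norm_minus_cancel norm_one)
  have cont': "continuous_on (cball 0 1) (\<lambda>\<zeta>. \<phi> (of_real (r n) * \<zeta>))" for n
    unfolding \<phi>_def by (intro continuous_intros) (simp add: ne1)
  have gcont: "continuous_on (cball 0 1) (\<lambda>\<zeta>. G (\<phi> (of_real (r n) * \<zeta>)))" for n
  proof (rule continuous_on_compose2[OF cont cont'])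
    show "(\<lambda>\<zeta>. \<phi> (of_real (r n) * \<zeta>)) ` cball 0 1 \<subseteq> {z. 0 \<le> Im z}"
      using Im_\<phi>[OF lt1] by (auto intro: less_imp_le)
  qed
  have hol': "(\<lambda>\<zeta>. \<phi> (of_real (r n) * \<zeta>)) holomorphic_on ball 0 1" for n
    unfolding \<phi>_def by (intro holomorphic_intros) (simp add: ne1)
  have "(G \<circ> (\<lambda>\<zeta>. \<phi> (of_real (r n) * \<zeta>))) holomorphic_on ball 0 1" for n
  proof (rule holomorphic_on_compose_gen[OF hol' hol])
    show "(\<lambda>\<zeta>. \<phi> (of_real (r n) * \<zeta>)) ` ball 0 1 \<subseteq> {z. 0 < Im z}"
      using Im_\<phi>[OF lt1] by auto
  qed
  then have ghol: "(\<lambda>\<zeta>. G (\<phi> (of_real (r n) * \<zeta>))) holomorphic_on ball 0 1" for n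
    by (simp add: o_def)
  have fmean: "cmod (G (Complex x y)) \<le> exp (1 / (2 * pi) * integral {-pi<..<pi} (f n))" for n
  proof -
    have "\<phi> 0 = Complex x y" by (auto simp: \<phi>_def complex_eq_iff)
    then show ?thesis
      using circle_mean[OF gcont ghol \<open>\<epsilon> > 0\<close>, of n] by (simp add: f_def[abs_def] integral_open_interval_real)
  qed
  have bound: "\<bar>ln (cmod (G z) + \<epsilon>)\<bar> \<le> \<bar>ln \<epsilon>\<bar> + \<bar>ln (M + \<epsilon>)\<bar>" if "Im z \<ge> 0" for z
  proof -
    have "ln \<epsilon> \<le> ln (cmod (G z) + \<epsilon>)" using \<open>\<epsilon> > 0\<close> pos by (subst ln_le_cancel_iff) auto
    moreover have "ln (cmod (G z) + \<epsilon>) \<le> ln (M + \<epsilon>)"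
      using \<open>\<epsilon> > 0\<close> pos bd[OF that] M by (subst ln_le_cancel_iff) auto
    ultimately show ?thesis by linarith
  qed
  have fint: "f n integrable_on {-pi<..<pi}" for n
  proof -
    have "continuous_on {-pi..pi} (f n)"
      unfolding f_def
      by (intro continuous_intros continuous_on_compose2[OF gcont[of n]]) (auto simp: less_imp_neq[OF pos, symmetric])
    then show ?thesis using integrable_continuous_real integrable_on_open_interval_real by blast
  qed
  have const: "(\<lambda>\<theta>. \<bar>ln \<epsilon>\<bar> + \<bar>ln (M + \<epsilon>)\<bar>) integrable_on {-pi<..<pi}"
    using integrable_on_open_interval_real integrable_const_ivl by blast
  have lim: "(\<lambda>n. f n \<theta>) \<longlonglongrightarrow> f' \<theta>" if "\<theta> \<in> {-pi<..<pi}" for \<theta>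
  proof -
    have "1 + cis \<theta> \<noteq> 0"
    proof
      assume "1 + cis \<theta> = 0"
      then have "cos \<theta> = -1" by (simp add: complex_eq_iff)
      moreover have "cos \<theta> > cos pi"
      proof (cases "\<theta> \<ge> 0")
        case True then show ?thesis using that by (intro cos_monotone_0_pi) auto
      next
        case False
        then have "cos pi < cos (- \<theta>)" using that by (intro cos_monotone_0_pi) auto
        then show ?thesis by simp
      qed
      ultimately show False by simp
    qed
    then have "(\<lambda>n. \<phi> (of_real (r n) * cis \<theta>)) \<longlonglongrightarrow> \<phi> (of_real 1 * cis \<theta>)"
      unfolding \<phi>_def by (intro tendsto_intros rlim) auto
    then have "(\<lambda>n. \<phi> (of_real (r n) * cis \<theta>)) \<longlonglongrightarrow> of_real (x + y * tan (\<theta> / 2))"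
      using \<phi>_cis[OF that] by simp
    then have "(\<lambda>n. G (\<phi> (of_real (r n) * cis \<theta>))) \<longlonglongrightarrow> G (of_real (x + y * tan (\<theta> / 2)))"
      by (rule continuous_on_tendsto_compose[OF cont]) (auto intro!: less_imp_le[OF Im_\<phi>] always_eventually lt1)
    then show ?thesis
      unfolding f_def f'_def by (intro tendsto_intros) (auto simp: less_imp_neq[OF pos, symmetric])
  qed
  have dom: "norm (f n \<theta>) \<le> \<bar>ln \<epsilon>\<bar> + \<bar>ln (M + \<epsilon>)\<bar>" for n \<theta>
    unfolding f_def real_norm_def by (rule bound, rule less_imp_le, rule Im_\<phi>, rule lt1) simp
  note DC = dominated_convergence[OF fint const dom lim]
  have "norm (f' \<theta>) \<le> \<bar>ln \<epsilon>\<bar> + \<bar>ln (M + \<epsilon>)\<bar>" for \<theta>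
    unfolding f'_def real_norm_def by (rule bound) simp
  then have "f' absolutely_integrable_on {-pi<..<pi}"
    using absolutely_integrable_integrable_bound[OF _ DC(1) const] by blast
  then show ?I unfolding f'_def[abs_def] .
  have "(\<lambda>n. exp (1 / (2 * pi) * integral {-pi<..<pi} (f n))) \<longlonglongrightarrow> exp (1 / (2 * pi) * integral {-pi<..<pi} f')"
    by (intro tendsto_intros DC(2))
  then have "cmod (G (Complex x y)) \<le> exp (1 / (2 * pi) * integral {-pi<..<pi} f')"
    by (rule Lim_bounded2[where N = 0]) (use fmean in auto)
  then show "cmod (G (Complex x y)) \<le> exp (1 / (2 * pi) *
        integral {-pi<..<pi} (\<lambda>\<theta>. ln (cmod (G (of_real (x + y * tan (\<theta> / 2)))) + \<epsilon>)))"
    unfolding f'_def[abs_def] .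
qed

text \<open>
  The Poisson kernel of the upper half-plane without its factor \<open>1 / pi\<close>.
\<close>

definition poisson :: "real \<Rightarrow> real \<Rightarrow> real \<Rightarrow> real" where
  "poisson x y t = y / ((t - x)\<^sup>2 + y\<^sup>2)"

text \<open>
  The substitution \<open>\<theta> = 2 * arctan ((t - x) / y)\<close> in the previous mean.
\<close>

lemma half_plane_mean:
  assumes cont: "continuous_on {z. Im z \<ge> 0} G" and hol: "G holomorphic_on {z. Im z > 0}"
    and bd: "\<And>z. Im z \<ge> 0 \<Longrightarrow> cmod (G z) \<le> M" and "\<epsilon> > 0" "y > 0"
  shows "integrable lborel (\<lambda>t. ln (cmod (G (of_real t)) + \<epsilon>) * poisson x y t)"
    "cmod (G (Complex x y)) \<le> exp (1 / pi * (LINT t|lborel. ln (cmod (G (of_real t)) + \<epsilon>) * poisson x y t))"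
proof -
  define f where "f \<theta> = ln (cmod (G (of_real (x + y * tan (\<theta> / 2)))) + \<epsilon>)" for \<theta>
  define g where "g t = 2 * arctan ((t - x) / y)" for t
  have pos: "cmod (G \<zeta>) + \<epsilon> > 0" for \<zeta> using \<open>\<epsilon> > 0\<close> by (simp add: add_nonneg_pos)
  have img: "range g = {-pi<..<pi}"
  proof (intro equalityI subsetI)
    fix \<theta> assume "\<theta> \<in> range g"
    then obtain t where "\<theta> = 2 * arctan ((t - x) / y)" unfolding g_def by blast
    then show "\<theta> \<in> {-pi<..<pi}" using arctan_bounded[of "(t - x) / y"] by auto
  next
    fix \<theta> assume "\<theta> \<in> {-pi<..<pi}"
    then have "\<theta> = g (x + y * tan (\<theta> / 2))" using \<open>y > 0\<close> by (simp add: g_def arctan_tan)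
    then show "\<theta> \<in> range g" by blast
  qed
  have der: "(g has_field_derivative 2 * poisson x y t) (at t within UNIV)" for t
  proof -
    have "1 + ((t - x) / y)\<^sup>2 = ((t - x)\<^sup>2 + y\<^sup>2) / y\<^sup>2" using \<open>y > 0\<close> by (simp add: power_divide field_simps)
    then have "2 * (inverse (1 + ((t - x) / y)\<^sup>2) * (1 / y)) = 2 * poisson x y t"
      using \<open>y > 0\<close> by (simp add: poisson_def field_simps power2_eq_square)
    moreover have "(g has_field_derivative 2 * (inverse (1 + ((t - x) / y)\<^sup>2) * (1 / y))) (at t)"
      unfolding g_def using \<open>y > 0\<close> by (auto intro!: derivative_eq_intros)
    ultimately show ?thesis by simp
  qed
  have inj: "inj g" using \<open>y > 0\<close> by (auto simp: g_def inj_def arctan_eq_iff)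
  have fg: "f (g t) = ln (cmod (G (of_real t)) + \<epsilon>)" for t
  proof -
    have "x + y * tan (g t / 2) = t" using \<open>y > 0\<close> by (simp add: g_def tan_arctan)
    then show ?thesis unfolding f_def by (simp only:)
  qed
  have pp: "poisson x y t \<ge> 0" for t using \<open>y > 0\<close> by (simp add: poisson_def)
  have abs: "\<bar>2 * poisson x y t\<bar> * f (g t) = 2 * (ln (cmod (G (of_real t)) + \<epsilon>) * poisson x y t)" for t
    using pp[of t] by (simp add: fg)
  have "f absolutely_integrable_on range g \<and> integral (range g) f = integral (range g) f"
    using half_plane_mean_circle(1)[OF cont hol bd \<open>\<epsilon> > 0\<close> \<open>y > 0\<close>, of x] unfolding img f_def[abs_def] by auto
  then have *: "(\<lambda>t. 2 * (ln (cmod (G (of_real t)) + \<epsilon>) * poisson x y t)) absolutely_integrable_on UNIV"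
    "integral UNIV (\<lambda>t. 2 * (ln (cmod (G (of_real t)) + \<epsilon>) * poisson x y t)) = integral {-pi<..<pi} f"
    using has_absolute_integral_change_of_variables_1'[OF _ der inj, of f "integral (range g) f"]
    unfolding abs img by auto
  define k where "k t = ln (cmod (G (of_real t)) + \<epsilon>) * poisson x y t" for t
  have "continuous_on UNIV k"
    unfolding k_def poisson_def using \<open>y > 0\<close>
    by (intro continuous_intros continuous_on_compose2[OF cont])
      (auto simp: less_imp_neq[OF pos, symmetric] sum_power2_eq_zero_iff)
  then have m: "k \<in> borel_measurable lborel"
    by (simp add: borel_measurable_continuous_onI)
  have abs_k: "k absolutely_integrable_on UNIV"
    using absolutely_integrable_scaleR_left[OF *(1), of "1/2"] by (simp add: k_def[abs_def])
  then have "integrable lebesgue k" by (simp add: set_integrable_def)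
  then show I: "integrable lborel (\<lambda>t. ln (cmod (G (of_real t)) + \<epsilon>) * poisson x y t)"
    using integrable_completion[OF m] unfolding k_def by simp
  have "integral {-pi<..<pi} f = 2 * integral UNIV k"
    using *(2) by (simp add: k_def[abs_def])
  also have "integral UNIV k = (LINT t|lebesgue. k t)"
    using set_lebesgue_integral_eq_integral(2)[OF abs_k] by (simp add: set_lebesgue_integral_def)
  also have "\<dots> = (LINT t|lborel. k t)" by (rule integral_completion[OF m])
  finally have "1 / (2 * pi) * integral {-pi<..<pi} f = 1 / pi * (LINT t|lborel. k t)" by simp
  then show "cmod (G (Complex x y)) \<le> exp (1 / pi * (LINT t|lborel. ln (cmod (G (of_real t)) + \<epsilon>) * poisson x y t))"
    using half_plane_mean_circle(2)[OF cont hol bd \<open>\<epsilon> > 0\<close> \<open>y > 0\<close>, of x] unfolding k_def f_def[abs_def] by simp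
qed

section \<open>Quotients of bounded holomorphic functions in a half-plane\<close>

lemma poisson_nonneg: "y > 0 \<Longrightarrow> poisson x y t \<ge> 0"
  by (simp add: poisson_def)

text \<open>
  Harnack's inequality for the kernel: along the broken line \<open>y = \<eta> * (1 +
  \<bar>x\<bar>)\<close> the constant of comparison with a fixed kernel grows only linearly in
  \<open>x\<close>.
\<close>

lemma poisson_compare:
  assumes "y0 > 0" "\<eta> > 0"
  obtains A where "A > 0" "\<And>x t. poisson x (\<eta> * (1 + \<bar>x\<bar>)) t \<le> A * (1 + \<bar>x\<bar>) * poisson x0 y0 t"
proof
  define c where "c = 2 * (\<bar>x0\<bar> + 1)\<^sup>2 + y0\<^sup>2"
  define A where "A = \<eta> / y0 * (2 + c / \<eta>\<^sup>2)"
  have "c \<ge> 0" by (simp add: c_def)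
  then show "A > 0" using assms by (simp add: A_def add_pos_nonneg)
  fix x t :: real
  define X where "X = 1 + \<bar>x\<bar>"
  define y where "y = \<eta> * X"
  have X: "X \<ge> 1" by (simp add: X_def)
  have y: "y > 0" using X assms by (simp add: y_def)
  have "(t - x0)\<^sup>2 \<le> 2 * (t - x)\<^sup>2 + 2 * (x - x0)\<^sup>2"
    using sum_squares_bound[of "t - x" "x - x0"] by (simp add: power2_eq_square algebra_simps)
  moreover have "(x - x0)\<^sup>2 \<le> ((\<bar>x0\<bar> + 1) * X)\<^sup>2"
  proof (rule power2_le_iff_abs_le[THEN iffD2])
    have "\<bar>x - x0\<bar> \<le> \<bar>x\<bar> + \<bar>x0\<bar>" by simp
    also have "\<dots> \<le> (\<bar>x0\<bar> + 1) * X" by (simp add: X_def algebra_simps)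
    finally show "\<bar>x - x0\<bar> \<le> (\<bar>x0\<bar> + 1) * X" .
    show "0 \<le> (\<bar>x0\<bar> + 1) * X" using X by simp
  qed
  moreover have "y0\<^sup>2 * 1 \<le> y0\<^sup>2 * X\<^sup>2" using X by (intro mult_left_mono) auto
  moreover have "c * X\<^sup>2 = 2 * ((\<bar>x0\<bar> + 1) * X)\<^sup>2 + y0\<^sup>2 * X\<^sup>2"
  proof -
    have "(2 * p + q) * r = 2 * (p * r) + q * r" for p q r :: real by (simp add: algebra_simps)
    then show ?thesis unfolding c_def power_mult_distrib .
  qed
  ultimately have "(t - x0)\<^sup>2 + y0\<^sup>2 \<le> 2 * (t - x)\<^sup>2 + c * X\<^sup>2" by linarith
  also have "c * X\<^sup>2 = c / \<eta>\<^sup>2 * y\<^sup>2" using assms by (simp add: y_def power_mult_distrib)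
  also have "2 * (t - x)\<^sup>2 + c / \<eta>\<^sup>2 * y\<^sup>2 \<le> (2 + c / \<eta>\<^sup>2) * ((t - x)\<^sup>2 + y\<^sup>2)"
    using \<open>c \<ge> 0\<close> by (simp add: algebra_simps)
  finally have *: "(t - x0)\<^sup>2 + y0\<^sup>2 \<le> (2 + c / \<eta>\<^sup>2) * ((t - x)\<^sup>2 + y\<^sup>2)" .
  have p1: "(t - x0)\<^sup>2 + y0\<^sup>2 > 0" and p2: "(t - x)\<^sup>2 + y\<^sup>2 > 0"
    using assms y by (auto simp: add_nonneg_pos)
  have "A * X * poisson x0 y0 t = y * (2 + c / \<eta>\<^sup>2) / ((t - x0)\<^sup>2 + y0\<^sup>2)"
    using assms by (simp add: A_def y_def poisson_def)
  moreover have "y / ((t - x)\<^sup>2 + y\<^sup>2) \<le> y * (2 + c / \<eta>\<^sup>2) / ((t - x0)\<^sup>2 + y0\<^sup>2)"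
  proof -
    have "y / Q \<le> y * k / P" if "P \<le> k * Q" "P > 0" "Q > 0" for P Q k
      using mult_left_mono[OF that(1), of y] y that by (simp add: field_simps)
    from this[OF * p1 p2] show ?thesis .
  qed
  ultimately have "poisson x y t \<le> A * X * poisson x0 y0 t" by (simp only: poisson_def)
  then show "poisson x (\<eta> * (1 + \<bar>x\<bar>)) t \<le> A * (1 + \<bar>x\<bar>) * poisson x0 y0 t"
    by (simp add: X_def y_def)
qed

text \<open>
  The submean inequality at one point where \<open>\<beta>\<close> does not vanish bounds the integrals of
  \<open>- ln (cmod \<beta> + \<epsilon>)\<close> against one Poisson kernel, uniformly in
  \<open>\<epsilon>\<close>. These integrands increase as \<open>\<epsilon>\<close> decreases, so their
  supremum is integrable and its tails are uniformly small. The smallness of the tails is what later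
  yields growth of order \<open>exp (\<epsilon> * \<bar>x\<bar>)\<close> for arbitrarily small
  \<open>\<epsilon>\<close>.
\<close>

lemma log_integrals_bounded:
  assumes cont: "continuous_on {z. Im z \<ge> 0} \<beta>" and hol: "\<beta> holomorphic_on {z. Im z > 0}"
    and bd: "\<And>z. Im z \<ge> 0 \<Longrightarrow> cmod (\<beta> z) \<le> 1 / 2" and w0: "y0 > 0" "\<beta> (Complex x0 y0) \<noteq> 0"
    and "\<kappa> > 0"
  obtains R K where "\<forall>\<epsilon>. 0 < \<epsilon> \<longrightarrow> \<epsilon> \<le> 1/2 \<longrightarrow> (LINT t|lborel. - ln (cmod (\<beta> (of_real t)) + \<epsilon>) * poisson x0 y0 t) \<le> K"
    "\<forall>\<epsilon>. 0 < \<epsilon> \<longrightarrow> \<epsilon> \<le> 1/2 \<longrightarrow> (LINT t|lborel. indicator {t. \<bar>t\<bar> > R} t * (- ln (cmod (\<beta> (of_real t)) + \<epsilon>) * poisson x0 y0 t)) \<le> \<kappa>"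
proof -
  define q where "q \<epsilon> t = - ln (cmod (\<beta> (of_real t)) + \<epsilon>) * poisson x0 y0 t" for \<epsilon> t
  define K where "K = - pi * ln (cmod (\<beta> (Complex x0 y0)))"
  have int: "integrable lborel (q \<epsilon>)" and qK: "(LINT t|lborel. q \<epsilon> t) \<le> K" if "\<epsilon> > 0" for \<epsilon>
  proof -
    note H = half_plane_mean[OF cont hol bd \<open>\<epsilon> > 0\<close> \<open>y0 > 0\<close>, where x = x0]
    have q: "q \<epsilon> = (\<lambda>t. - (ln (cmod (\<beta> (of_real t)) + \<epsilon>) * poisson x0 y0 t))"
      by (simp add: q_def fun_eq_iff)
    show "integrable lborel (q \<epsilon>)" unfolding q using H(1) by simp
    have "ln (cmod (\<beta> (Complex x0 y0))) \<le> 1 / pi * (LINT t|lborel. ln (cmod (\<beta> (of_real t)) + \<epsilon>) * poisson x0 y0 t)"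
      using H(2) w0(2) by (metis exp_le_cancel_iff exp_ln zero_less_norm_iff)
    then show "(LINT t|lborel. q \<epsilon> t) \<le> K" unfolding q K_def by (simp add: field_simps)
  qed
  have qnn: "q \<epsilon> t \<ge> 0" if "0 < \<epsilon>" "\<epsilon> \<le> 1/2" for \<epsilon> t
  proof -
    have "cmod (\<beta> (of_real t)) + \<epsilon> \<le> 1" using bd[of "of_real t"] that by simp
    moreover have "cmod (\<beta> (of_real t)) + \<epsilon> > 0" using that by (simp add: add_nonneg_pos)
    ultimately have "ln (cmod (\<beta> (of_real t)) + \<epsilon>) \<le> 0" by simp
    then show ?thesis unfolding q_def by (intro mult_nonneg_nonneg poisson_nonneg w0) simp
  qed
  have qmono: "q \<epsilon> t \<le> q \<epsilon>' t" if "0 < \<epsilon>'" "\<epsilon>' \<le> \<epsilon>" for \<epsilon> \<epsilon>' t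
  proof -
    have "cmod (\<beta> (of_real t)) + \<epsilon>' > 0" using that by (simp add: add_nonneg_pos)
    then have "ln (cmod (\<beta> (of_real t)) + \<epsilon>') \<le> ln (cmod (\<beta> (of_real t)) + \<epsilon>)"
      using that by (subst ln_le_cancel_iff) auto
    then show ?thesis unfolding q_def by (intro mult_right_mono poisson_nonneg w0) simp
  qed
  define e where "e n = 1 / real (n + 2)" for n
  have e: "0 < e n" "e n \<le> 1/2" for n by (auto simp: e_def field_simps)
  have edec: "e n \<le> e m" if "m \<le> n" for m n using that by (auto simp: e_def field_simps)
  define Q where "Q t = (SUP n. ennreal (q (e n) t))" for t
  have meas [measurable]: "(\<lambda>t. ennreal (q (e n) t)) \<in> borel_measurable lborel" for n
    using borel_measurable_integrable[OF int[OF e(1)]] by (rule measurable_compose) simp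
  have Qmeas [measurable]: "Q \<in> borel_measurable lborel" unfolding Q_def by measurable
  have "(\<integral>\<^sup>+t. Q t \<partial>lborel) = (SUP n. \<integral>\<^sup>+t. ennreal (q (e n) t) \<partial>lborel)"
    unfolding Q_def
    by (rule nn_integral_monotone_convergence_SUP)
      (auto simp: incseq_def le_fun_def intro!: ennreal_leI qmono e edec)
  also have "\<dots> \<le> ennreal K"
  proof (rule SUP_least)
    fix n
    have "(\<integral>\<^sup>+t. ennreal (q (e n) t) \<partial>lborel) = ennreal (LINT t|lborel. q (e n) t)"
      by (rule nn_integral_eq_integral[OF int[OF e(1)]]) (rule AE_I2, rule qnn, rule e, rule e)
    then show "(\<integral>\<^sup>+t. ennreal (q (e n) t) \<partial>lborel) \<le> ennreal K"
      using qK[OF e(1)] by (simp add: ennreal_leI)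
  qed
  finally have Qfin: "(\<integral>\<^sup>+t. Q t \<partial>lborel) < \<infinity>" by (simp add: le_less_trans ennreal_less_top)
  have "(\<lambda>m. \<integral>\<^sup>+t. indicator {t. \<bar>t\<bar> > real m} t * Q t \<partial>lborel) \<longlonglongrightarrow> (\<integral>\<^sup>+t. 0 \<partial>(lborel :: real measure))"
  proof (rule nn_integral_dominated_convergence[where w = Q])
    show "AE t in lborel. (\<lambda>m. indicator {t. \<bar>t\<bar> > real m} t * Q t) \<longlonglongrightarrow> 0"
    proof (rule AE_I2)
      fix t :: real
      obtain m0 where "\<bar>t\<bar> \<le> real m0" using real_arch_simple by blast
      then have "\<forall>\<^sub>F m in sequentially. indicator {t. \<bar>t\<bar> > real m} t * Q t = 0"
        by (intro eventually_sequentiallyI[of m0]) (auto simp: indicator_def)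
      then show "(\<lambda>m. indicator {t. \<bar>t\<bar> > real m} t * Q t) \<longlonglongrightarrow> 0"
        by (rule tendsto_eventually)
    qed
  qed (use Qfin in \<open>auto simp: indicator_def\<close>)
  then have "\<forall>\<^sub>F m in sequentially. (\<integral>\<^sup>+t. indicator {t. \<bar>t\<bar> > real m} t * Q t \<partial>lborel) < ennreal \<kappa>"
    by (rule order_tendstoD(2)) (use \<open>\<kappa> > 0\<close> in simp)
  then obtain m where m: "(\<integral>\<^sup>+t. indicator {t. \<bar>t\<bar> > real m} t * Q t \<partial>lborel) < ennreal \<kappa>"
    using eventually_happens'[OF sequentially_bot] by blast
  show ?thesis
  proof (rule that[of K "real m"]; intro allI impI)
    fix \<epsilon> :: real assume \<epsilon>: "0 < \<epsilon>" "\<epsilon> \<le> 1/2"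
    show "(LINT t|lborel. - ln (cmod (\<beta> (of_real t)) + \<epsilon>) * poisson x0 y0 t) \<le> K"
      using qK[OF \<epsilon>(1)] unfolding q_def .
    obtain n :: nat where n: "1 / \<epsilon> < real n" using reals_Archimedean2 by blast
    have "e n \<le> \<epsilon>" using n \<epsilon> by (simp add: e_def field_simps)
    then have qQ: "ennreal (q \<epsilon> t) \<le> Q t" for t
      unfolding Q_def by (intro SUP_upper2[of n]) (auto intro!: ennreal_leI qmono e)
    have nn: "0 \<le> indicator {t. \<bar>t\<bar> > real m} t * q \<epsilon> t" for t
      by (rule mult_nonneg_nonneg[OF indicator_pos_le qnn[OF \<epsilon>]])
    have "integrable lborel (\<lambda>t. indicator {t. \<bar>t\<bar> > real m} t * q \<epsilon> t)"
      using integrable_mult_indicator[OF _ int[OF \<epsilon>(1)], of "{t. \<bar>t\<bar> > real m}"] by simp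
    from nn_integral_eq_integral[OF this AE_I2[OF nn]]
    have "ennreal (LINT t|lborel. indicator {t. \<bar>t\<bar> > real m} t * q \<epsilon> t)
        = (\<integral>\<^sup>+t. ennreal (indicator {t. \<bar>t\<bar> > real m} t * q \<epsilon> t) \<partial>lborel)" by simp
    also have "\<dots> \<le> (\<integral>\<^sup>+t. indicator {t. \<bar>t\<bar> > real m} t * Q t \<partial>lborel)"
      using qQ by (intro nn_integral_mono) (auto simp: indicator_def)
    also note m
    finally show "(LINT t|lborel. indicator {t. \<bar>t\<bar> > real m} t * (- ln (cmod (\<beta> (of_real t)) + \<epsilon>) * poisson x0 y0 t)) \<le> \<kappa>"
      using \<open>\<kappa> > 0\<close> ennreal_leI[of \<kappa>] unfolding q_def by (meson not_less nle_le)
  qed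
qed

text \<open>
  If \<open>G * \<beta>\<close> is bounded by \<open>D\<close> on the real line, then \<open>ln (cmod G /
  D)\<close> is at most \<open>- ln (cmod \<beta>)\<close> there, and the Poisson integral of the latter
  bounds \<open>ln (cmod G / D)\<close> in the half-plane. At height \<open>\<eta> * (1 +
  \<bar>x\<bar>)\<close> the part of that integral over a large bounded set is bounded, and the rest is
  small compared with \<open>x\<close>. The constant \<open>M\<close> is independent of the bound
  \<open>K\<close> on \<open>G\<close>.
\<close>

lemma quotient_bound:
  assumes cont: "continuous_on {z. Im z \<ge> 0} \<beta>" and hol: "\<beta> holomorphic_on {z. Im z > 0}"
    and bd: "\<And>z. Im z \<ge> 0 \<Longrightarrow> cmod (\<beta> z) \<le> 1 / 2" and w0: "Im w0 > 0" "\<beta> w0 \<noteq> 0"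
    and "\<eta> > 0" "\<epsilon> > 0"
  obtains M where "M > 0"
    "\<And>G D K x. continuous_on {z. Im z \<ge> 0} G \<Longrightarrow> G holomorphic_on {z. Im z > 0} \<Longrightarrow>
      (\<And>z. Im z \<ge> 0 \<Longrightarrow> cmod (G z) \<le> K) \<Longrightarrow> D > 0 \<Longrightarrow>
      (\<And>t::real. cmod (G (of_real t)) * cmod (\<beta> (of_real t)) \<le> D) \<Longrightarrow>
      cmod (G (Complex x (\<eta> * (1 + \<bar>x\<bar>)))) \<le> M * D * exp (\<epsilon> * \<bar>x\<bar>)"
proof -
  define x0 y0 where "x0 = Re w0" and "y0 = Im w0"
  have w: "y0 > 0" "\<beta> (Complex x0 y0) \<noteq> 0" using w0 by (auto simp: x0_def y0_def)
  obtain A where A: "A > 0" "\<And>x t. poisson x (\<eta> * (1 + \<bar>x\<bar>)) t \<le> A * (1 + \<bar>x\<bar>) * poisson x0 y0 t"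
    using poisson_compare[OF w(1) \<open>\<eta> > 0\<close>] by blast
  define \<kappa> where "\<kappa> = \<epsilon> * pi / A"
  have "\<kappa> > 0" using A \<open>\<epsilon> > 0\<close> by (simp add: \<kappa>_def)
  define q where "q \<epsilon> t = - ln (cmod (\<beta> (of_real t)) + \<epsilon>)" for \<epsilon> t
  obtain R K0 where K: "\<And>\<epsilon>. 0 < \<epsilon> \<Longrightarrow> \<epsilon> \<le> 1/2 \<Longrightarrow> (LINT t|lborel. q \<epsilon> t * poisson x0 y0 t) \<le> K0"
    and R: "\<And>\<epsilon>. 0 < \<epsilon> \<Longrightarrow> \<epsilon> \<le> 1/2 \<Longrightarrow> (LINT t|lborel. indicator {t. \<bar>t\<bar> > R} t * (q \<epsilon> t * poisson x0 y0 t)) \<le> \<kappa>"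
  proof (rule log_integrals_bounded[OF cont hol bd w \<open>\<kappa> > 0\<close>])
    fix R K0
    assume 1: "\<forall>\<epsilon>. 0 < \<epsilon> \<longrightarrow> \<epsilon> \<le> 1/2 \<longrightarrow> (LINT t|lborel. - ln (cmod (\<beta> (of_real t)) + \<epsilon>) * poisson x0 y0 t) \<le> K0"
      and 2: "\<forall>\<epsilon>. 0 < \<epsilon> \<longrightarrow> \<epsilon> \<le> 1/2 \<longrightarrow> (LINT t|lborel. indicator {t. \<bar>t\<bar> > R} t * (- ln (cmod (\<beta> (of_real t)) + \<epsilon>) * poisson x0 y0 t)) \<le> \<kappa>"
    show thesis
      by (rule that[OF 1[rule_format, folded q_def] 2[rule_format, folded q_def]])
  qed
  define p where "p = y0 / ((\<bar>R\<bar> + \<bar>x0\<bar>)\<^sup>2 + y0\<^sup>2)"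
  have p: "p > 0" using w(1) by (simp add: p_def add_nonneg_pos)
  \<comment> \<open>\<open>p\<close> is a lower bound of the fixed kernel on \<open>{-R..R}\<close>, and \<open>1 / \<eta>\<close> is an upper bound of all kernels in question\<close>
  define B where "B = 1 / (\<eta> * p)"
  have "B > 0" using p \<open>\<eta> > 0\<close> by (simp add: B_def)
  have pw: "poisson x (\<eta> * (1 + \<bar>x\<bar>)) t \<le> B * poisson x0 y0 t + A * (1 + \<bar>x\<bar>) * (indicator {t. \<bar>t\<bar> > R} t * poisson x0 y0 t)" for x t
  proof (cases "\<bar>t\<bar> > R")
    case True
    then show ?thesis using A(2)[of x t] \<open>B > 0\<close> poisson_nonneg[OF w(1), of x0 t] by (simp add: add_increasing)
  next
    case False
    define y where "y = \<eta> * (1 + \<bar>x\<bar>)"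
    have y: "y \<ge> \<eta>" using \<open>\<eta> > 0\<close> by (simp add: y_def)
    have "poisson x y t \<le> y / y\<^sup>2"
      unfolding poisson_def using y \<open>\<eta> > 0\<close> by (intro divide_left_mono) (auto simp: add_nonneg_pos)
    also have "\<dots> = 1 / y" by (simp add: power2_eq_square)
    also have "\<dots> \<le> 1 / \<eta>" using y \<open>\<eta> > 0\<close> by (intro divide_left_mono) auto
    also have "\<dots> = B * p" using p by (simp add: B_def)
    also have "\<dots> \<le> B * poisson x0 y0 t"
    proof -
      have "\<bar>t - x0\<bar> \<le> \<bar>R\<bar> + \<bar>x0\<bar>" using False by auto
      then have "(t - x0)\<^sup>2 \<le> (\<bar>R\<bar> + \<bar>x0\<bar>)\<^sup>2" by (simp add: abs_le_square_iff[symmetric])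
      then have "p \<le> poisson x0 y0 t"
        unfolding p_def poisson_def using w(1) by (intro divide_left_mono) (auto simp: add_nonneg_pos)
      then show ?thesis using \<open>B > 0\<close> by simp
    qed
    finally show ?thesis using False by (simp add: y_def)
  qed
  define M where "M = 3 * exp (B * K0 / pi + \<epsilon>)"
  show ?thesis
  proof (rule that[of M])
    show "M > 0" by (simp add: M_def)
    fix G D K x
    assume Gc: "continuous_on {z. Im z \<ge> 0} G" and Gh: "G holomorphic_on {z. Im z > 0}"
      and Gb: "\<And>z. Im z \<ge> 0 \<Longrightarrow> cmod (G z) \<le> K" and "D > 0"
      and GD: "\<And>t::real. cmod (G (of_real t)) * cmod (\<beta> (of_real t)) \<le> D"
    define y where "y = \<eta> * (1 + \<bar>x\<bar>)"
    have y: "y > 0" using \<open>\<eta> > 0\<close> by (simp add: y_def add_pos_nonneg)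
    \<comment> \<open>the choice of \<open>K'\<close> makes \<open>e = D / K'\<close> at most one half and keeps \<open>K'\<close> an upper bound for \<open>cmod G\<close>\<close>
    define K' where "K' = max K (2 * D)"
    define e where "e = D / K'"
    have K': "K' > 0" using \<open>D > 0\<close> by (simp add: K'_def)
    have e: "0 < e" "e \<le> 1/2" using \<open>D > 0\<close> K' by (auto simp: e_def field_simps K'_def)
    have eK: "e * K' = D" using K' by (simp add: e_def)
    have pos: "cmod z + e > 0" for z using e by (simp add: add_nonneg_pos)
    \<comment> \<open>from \<open>cmod G \<le> min K' (D / cmod \<beta>)\<close>; the normalization by \<open>3 * D\<close> avoids integrating a constant against the Poisson kernel\<close>
    have key: "ln (cmod (G (of_real t) / of_real (3 * D)) + 1 / 3) \<le> q e t" for t :: real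
    proof -
      define g b where "g = cmod (G (of_real t))" and "b = cmod (\<beta> (of_real t))"
      have b: "0 \<le> b" "b \<le> 1/2" using bd[of "of_real t"] by (auto simp: b_def)
      have g: "0 \<le> g" "g \<le> K'" using Gb[of "of_real t"] by (auto simp: g_def K'_def)
      have "g * (b + e) \<le> 2 * D"
      proof -
        have "g * e \<le> K' * e" using g e by (intro mult_right_mono) auto
        moreover have "g * b \<le> D" using GD[of t] by (simp add: g_def b_def)
        ultimately show ?thesis using eK by (simp add: algebra_simps)
      qed
      moreover have "D * (b + e) \<le> D * 1" using b e \<open>D > 0\<close> by (intro mult_left_mono) auto
      ultimately have "(g + D) * (b + e) \<le> 3 * D" by (simp add: algebra_simps)
      then have "(g + D) / (3 * D) \<le> 1 / (b + e)"
        using b e \<open>D > 0\<close> by (simp add: field_simps)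
      moreover have "cmod (G (of_real t) / of_real (3 * D)) + 1 / 3 = (g + D) / (3 * D)"
        using \<open>D > 0\<close> by (simp add: norm_divide norm_mult g_def field_simps)
      ultimately have "ln (cmod (G (of_real t) / of_real (3 * D)) + 1 / 3) \<le> ln (1 / (b + e))"
        using g \<open>D > 0\<close> b e by (subst ln_le_cancel_iff) auto
      also have "\<dots> = q e t" using b e by (simp add: q_def b_def ln_div)
      finally show ?thesis .
    qed
    have q0: "q e t \<ge> 0" for t
      using bd[of "of_real t"] e pos[of "\<beta> (of_real t)"] by (simp add: q_def)
    define H where "H z = G z / of_real (3 * D)" for z
    have Hc: "continuous_on {z. Im z \<ge> 0} H"
      unfolding H_def using \<open>D > 0\<close> by (intro continuous_intros Gc) auto
    have Hh: "H holomorphic_on {z. Im z > 0}"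
      unfolding H_def using \<open>D > 0\<close> by (intro holomorphic_intros Gh) auto
    have Hb: "cmod (H z) \<le> K / (3 * D)" if "Im z \<ge> 0" for z
      using Gb[OF that] \<open>D > 0\<close> by (simp add: H_def norm_divide norm_mult divide_right_mono)
    have third: "(1 / 3 :: real) > 0" by simp
    note HM = half_plane_mean[OF Hc Hh Hb third y, where x = x]
    have intq0: "integrable lborel (\<lambda>t. q e t * poisson x0 y0 t)"
      using half_plane_mean(1)[OF cont hol bd e(1) w(1), of x0] by (simp add: q_def)
    have intqR: "integrable lborel (\<lambda>t. indicator {t. \<bar>t\<bar> > R} t * (q e t * poisson x0 y0 t))"
      using integrable_mult_indicator[OF _ intq0, of "{t. \<bar>t\<bar> > R}"] by simp
    have "(LINT t|lborel. ln (cmod (H (of_real t)) + 1 / 3) * poisson x y t)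
        \<le> (LINT t|lborel. B * (q e t * poisson x0 y0 t) + A * (1 + \<bar>x\<bar>) * (indicator {t. \<bar>t\<bar> > R} t * (q e t * poisson x0 y0 t)))"
    proof (rule integral_mono[OF HM(1)])
      show "integrable lborel (\<lambda>t. B * (q e t * poisson x0 y0 t) + A * (1 + \<bar>x\<bar>) * (indicator {t. \<bar>t\<bar> > R} t * (q e t * poisson x0 y0 t)))"
        by (intro Bochner_Integration.integrable_add integrable_mult_right intq0 intqR)
      fix t :: real
      have "ln (cmod (H (of_real t)) + 1 / 3) * poisson x y t \<le> q e t * poisson x y t"
        using key[of t] poisson_nonneg[OF y, of x t] unfolding H_def by (rule mult_right_mono)
      also have "\<dots> \<le> q e t * (B * poisson x0 y0 t + A * (1 + \<bar>x\<bar>) * (indicator {t. \<bar>t\<bar> > R} t * poisson x0 y0 t))"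
        using pw[of x t] q0[of t] unfolding y_def by (rule mult_left_mono)
      finally show "ln (cmod (H (of_real t)) + 1 / 3) * poisson x y t \<le>
          B * (q e t * poisson x0 y0 t) + A * (1 + \<bar>x\<bar>) * (indicator {t. \<bar>t\<bar> > R} t * (q e t * poisson x0 y0 t))"
        by (simp add: algebra_simps)
    qed
    also have "\<dots> = B * (LINT t|lborel. q e t * poisson x0 y0 t) + A * (1 + \<bar>x\<bar>) * (LINT t|lborel. indicator {t. \<bar>t\<bar> > R} t * (q e t * poisson x0 y0 t))"
      using Bochner_Integration.integral_add[OF integrable_mult_right[OF intq0, of B] integrable_mult_right[OF intqR, of "A * (1 + \<bar>x\<bar>)"]]
      by (simp only: integral_mult_right_zero)
    also have "\<dots> \<le> B * K0 + A * (1 + \<bar>x\<bar>) * \<kappa>"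
      using K[OF e] R[OF e] \<open>B > 0\<close> \<open>A > 0\<close> by (intro add_mono mult_left_mono) auto
    also have "\<dots> = pi * (B * K0 / pi + \<epsilon> * (1 + \<bar>x\<bar>))"
      using A(1) by (simp add: \<kappa>_def field_simps)
    finally have I: "(LINT t|lborel. ln (cmod (H (of_real t)) + 1 / 3) * poisson x y t) \<le> pi * (B * K0 / pi + \<epsilon> * (1 + \<bar>x\<bar>))" .
    have "1 / pi * I \<le> Z" if "I \<le> pi * Z" for I Z using that by (simp add: field_simps)
    from this[OF I]
    have "1 / pi * (LINT t|lborel. ln (cmod (H (of_real t)) + 1 / 3) * poisson x y t) \<le> B * K0 / pi + \<epsilon> * (1 + \<bar>x\<bar>)" .
    with HM(2) have "cmod (H (Complex x y)) \<le> exp (B * K0 / pi + \<epsilon> * (1 + \<bar>x\<bar>))"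
      by (meson exp_le_cancel_iff order_trans)
    moreover have "cmod (G (Complex x y)) = 3 * D * cmod (H (Complex x y))"
      using \<open>D > 0\<close> by (simp add: H_def norm_divide norm_mult)
    ultimately have "cmod (G (Complex x y)) \<le> 3 * D * exp (B * K0 / pi + \<epsilon> * (1 + \<bar>x\<bar>))"
      using \<open>D > 0\<close> by simp
    also have "\<dots> = M * D * exp (\<epsilon> * \<bar>x\<bar>)"
      by (simp add: M_def exp_add[symmetric] algebra_simps)
    finally show "cmod (G (Complex x (\<eta> * (1 + \<bar>x\<bar>)))) \<le> M * D * exp (\<epsilon> * \<bar>x\<bar>)"
      unfolding y_def .
  qed
qed

section \<open>From two horizontal lines to a strip\<close>

text \<open>
  The comparison function for the maximum principle below: twice the hyperbolic cosine has no zeros in a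
  region that widens slowly around the real axis, and grows there like \<open>exp \<bar>Re
  z\<bar>\<close>.
\<close>

lemma exp_plus_exp_minus_lower:
  assumes "\<bar>Im z\<bar> \<le> 1/2 + \<bar>Re z\<bar> / 2"
  shows "exp \<bar>Re z\<bar> / 4 \<le> cmod (exp z + exp (- z))"
proof (cases "\<bar>Re z\<bar> \<le> 1")
  case True
  have "exp \<bar>Re z\<bar> \<le> exp 1" using True by simp
  also have "\<dots> \<le> 4" using exp_le by simp
  finally have 1: "exp \<bar>Re z\<bar> / 4 \<le> 1" by simp
  have "\<bar>Im z\<bar> \<le> pi / 3" using assms True pi_gt3 by linarith
  then have "cos (pi / 3) \<le> cos \<bar>Im z\<bar>" by (intro cos_monotone_0_pi_le) auto
  then have c: "1 / 2 \<le> cos (Im z)" by (simp add: cos_60)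
  have "2 \<le> exp (Re z) + exp (- Re z)"
    using cosh_real_ge_1[of "Re z"] by (simp add: cosh_def)
  then have "2 * (1 / 2) \<le> (exp (Re z) + exp (- Re z)) * cos (Im z)"
    using c by (intro mult_mono) auto
  also have "\<dots> = Re (exp z + exp (- z))" by (simp add: Re_exp algebra_simps)
  also have "\<dots> \<le> cmod (exp z + exp (- z))" by (rule complex_Re_le_cmod)
  finally show ?thesis using 1 by simp
next
  case False
  define r where "r = \<bar>Re z\<bar>"
  have r: "r \<ge> 1" using False by (simp add: r_def)
  have "exp r - exp (- r) \<le> cmod (exp z + exp (- z))"
  proof (cases "Re z \<ge> 0")
    case True
    then show ?thesis using norm_diff_ineq[of "exp z" "exp (- z)"] by (simp add: r_def)
  next
    case False
    then show ?thesis using norm_diff_ineq[of "exp (- z)" "exp z"] by (simp add: r_def add.commute)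
  qed
  moreover have "exp (- r) \<le> exp r / 2"
  proof -
    have "2 \<le> exp (2 * r)" using exp_ge_add_one_self[of "2 * r"] r by linarith
    then have "exp (- r) * 2 \<le> exp (- r) * exp (2 * r)" by (intro mult_left_mono) auto
    then show ?thesis by (simp add: exp_add[symmetric])
  qed
  moreover have "exp r > 0" by simp
  ultimately have "exp r / 4 \<le> cmod (exp z + exp (- z))" by linarith
  then show ?thesis by (simp add: r_def)
qed

lemma exp_plus_exp_minus_upper: "cmod (exp z + exp (- z)) \<le> 2 * exp \<bar>Re z\<bar>"
proof -
  have "cmod (exp z + exp (- z)) \<le> exp (Re z) + exp (- Re z)"
    using norm_triangle_ineq[of "exp z" "exp (- z)"] by simp
  also have "\<dots> \<le> exp \<bar>Re z\<bar> + exp \<bar>Re z\<bar>" by (intro add_mono) auto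
  finally show ?thesis by simp
qed

text \<open>
  The maximum principle for the quotient of \<open>F\<close> by \<open>exp (3 * \<epsilon> * z) + exp (-
  (3 * \<epsilon> * z))\<close> in the region \<open>\<bar>Im z\<bar> < y1 + \<eta> * (1 + \<bar>Re
  z\<bar>)\<close>. Since \<open>F\<close> is of exponential type and bounded on the real axis, it grows
  at most like \<open>exp (\<epsilon> * \<bar>Re z\<bar>)\<close> in a region as narrow as this, while the
  denominator grows like \<open>exp (3 * \<epsilon> * \<bar>Re z\<bar>)\<close>; hence the quotient tends
  to \<open>0\<close> at infinity and is bounded by its supremum on the two boundary curves.
\<close>

lemma widening_strip_bound:
  assumes hol: "F holomorphic_on UNIV" and grow: "\<And>z. cmod (F z) \<le> C * exp (b * \<bar>Im z\<bar>)"
    and par: "b > 0" "y1 > 0" "\<epsilon> > 0" "\<eta> > 0" "3 * \<epsilon> * (y1 + 1) \<le> 1/2" "\<eta> \<le> 1/2" "b * \<eta> \<le> \<epsilon>" "B > 0"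
    and bdry: "\<And>z. \<bar>Im z\<bar> = y1 + \<eta> * (1 + \<bar>Re z\<bar>) \<Longrightarrow> cmod (F z) \<le> B * exp (2 * \<epsilon> * \<bar>Re z\<bar>)"
    and z: "\<bar>Im z\<bar> \<le> y1"
  shows "cmod (F z) \<le> 8 * B * exp (3 * \<epsilon> * \<bar>Re z\<bar>)"
proof -
  define h where "h x = y1 + \<eta> * (1 + \<bar>x\<bar>)" for x
  define E where "E z = exp (of_real (3 * \<epsilon>) * z) + exp (- (of_real (3 * \<epsilon>) * z))" for z :: complex
  have C: "C \<ge> 0" using grow[of 0] norm_ge_zero[of "F 0"] by (simp del: norm_ge_zero)
  have Elow: "exp (3 * \<epsilon> * \<bar>Re z\<bar>) / 4 \<le> cmod (E z)" if "\<bar>Im z\<bar> \<le> h (Re z)" for z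
  proof -
    have "3 * \<epsilon> * \<bar>Im z\<bar> \<le> 3 * \<epsilon> * h (Re z)" using that par by (intro mult_left_mono) auto
    also have "\<dots> = 3 * \<epsilon> * (y1 + \<eta>) + \<eta> * (3 * \<epsilon> * \<bar>Re z\<bar>)" by (simp add: h_def algebra_simps)
    also have "\<dots> \<le> 3 * \<epsilon> * (y1 + 1) + (1/2) * (3 * \<epsilon> * \<bar>Re z\<bar>)"
      using par by (intro add_mono mult_left_mono mult_right_mono) auto
    finally have "\<bar>Im (of_real (3 * \<epsilon>) * z)\<bar> \<le> 1/2 + \<bar>Re (of_real (3 * \<epsilon>) * z)\<bar> / 2"
      using par by (simp add: abs_mult)
    from exp_plus_exp_minus_lower[OF this] show ?thesis using par by (simp add: E_def abs_mult)
  qed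
  have Epos: "E z \<noteq> 0" if "\<bar>Im z\<bar> \<le> h (Re z)" for z
    using Elow[OF that] exp_gt_zero[of "3 * \<epsilon> * \<bar>Re z\<bar>"] by (auto simp del: exp_gt_zero)
  define C' where "C' = C * exp (b * (y1 + \<eta>)) + 1"
  have C': "C' > 0" using C by (simp add: C'_def add_nonneg_pos)
  have far: "cmod (F z) \<le> C' * exp (\<epsilon> * \<bar>Re z\<bar>)" if "\<bar>Im z\<bar> \<le> h (Re z)" for z
  proof -
    have "b * \<bar>Im z\<bar> \<le> b * h (Re z)" using that par by simp
    also have "\<dots> = b * (y1 + \<eta>) + (b * \<eta>) * \<bar>Re z\<bar>" by (simp add: h_def algebra_simps)
    also have "\<dots> \<le> b * (y1 + \<eta>) + \<epsilon> * \<bar>Re z\<bar>" using par by (intro add_mono mult_right_mono) auto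
    finally have "cmod (F z) \<le> C * exp (b * (y1 + \<eta>) + \<epsilon> * \<bar>Re z\<bar>)"
      using grow[of z] C by (meson exp_le_cancel_iff mult_left_mono order_trans)
    also have "\<dots> \<le> C' * exp (\<epsilon> * \<bar>Re z\<bar>)" by (simp add: C'_def exp_add algebra_simps)
    finally show ?thesis .
  qed
  define X where "X = max (\<bar>Re z\<bar> + 1) (C' / (B * \<epsilon>))"
  have X: "X > \<bar>Re z\<bar>" "X > 0" by (auto simp: X_def)
  have "C' \<le> B * exp (\<epsilon> * X)"
  proof -
    have "C' = B * (\<epsilon> * (C' / (B * \<epsilon>)))" using par by simp
    also have "\<dots> \<le> B * (\<epsilon> * X)" using par by (intro mult_left_mono) (auto simp: X_def)
    also have "\<dots> \<le> B * exp (\<epsilon> * X)"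
      using exp_ge_add_one_self[of "\<epsilon> * X"] par by (intro mult_left_mono) linarith+
    finally show ?thesis .
  qed
  then have C'X: "C' * exp (\<epsilon> * X) \<le> B * exp (2 * \<epsilon> * X)"
    using mult_right_mono[of C' "B * exp (\<epsilon> * X)" "exp (\<epsilon> * X)"]
    by (simp add: mult.assoc mult_exp_exp mult.left_commute mult.commute)
  define S where "S = {z. \<bar>Re z\<bar> < X \<and> \<bar>Im z\<bar> < h (Re z)}"
  define S' where "S' = {z. \<bar>Re z\<bar> \<le> X \<and> \<bar>Im z\<bar> \<le> h (Re z)}"
  have opS: "open S"
    unfolding S_def h_def by (intro open_Collect_conj open_Collect_less continuous_intros)
  have clS': "closed S'"
    unfolding S'_def h_def by (intro closed_Collect_conj closed_Collect_le continuous_intros)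
  have SS: "closure S \<subseteq> S'"
    by (rule closure_minimal[OF _ clS']) (auto simp: S_def S'_def)
  have bS: "bounded S"
  proof (rule bounded_subset[of "cbox (Complex (-X) (- h X)) (Complex X (h X))"])
    show "S \<subseteq> cbox (Complex (-X) (- h X)) (Complex X (h X))"
    proof
      fix w assume "w \<in> S"
      then have w: "\<bar>Re w\<bar> < X" "\<bar>Im w\<bar> < h (Re w)" by (auto simp: S_def)
      have "\<eta> * \<bar>Re w\<bar> \<le> \<eta> * X" using w par by (intro mult_left_mono) auto
      then have "h (Re w) \<le> h X" using X by (simp add: h_def algebra_simps)
      then show "w \<in> cbox (Complex (-X) (- h X)) (Complex X (h X))"
        using w by (auto simp: in_cbox_complex_iff)
    qed
  qed (rule bounded_cbox)
  have "cmod (F z / E z) \<le> 4 * B"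
  proof (rule maximum_modulus_frontier[of "\<lambda>z. F z / E z" S])
    have Eh: "E holomorphic_on A" for A unfolding E_def by (intro holomorphic_intros)
    have q: "(\<lambda>z. F z / E z) holomorphic_on S'"
      by (intro holomorphic_intros holomorphic_on_subset[OF hol] Eh) (auto simp: S'_def Epos)
    show "(\<lambda>z. F z / E z) holomorphic_on interior S"
      by (rule holomorphic_on_subset[OF q]) (use interior_subset closure_subset SS in blast)
    show "continuous_on (closure S) (\<lambda>z. F z / E z)"
      by (rule continuous_on_subset[OF holomorphic_on_imp_continuous_on[OF q] SS])
    have "\<bar>Im z\<bar> < h (Re z)"
      using z par by (simp add: h_def add_pos_nonneg le_less_trans)
    then show "z \<in> S" using X by (simp add: S_def)
    fix w assume "w \<in> frontier S"
    then have w: "w \<in> S'" "w \<notin> S" using SS opS by (auto simp: frontier_def interior_open)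
    have "cmod (F w) \<le> B * exp (2 * \<epsilon> * \<bar>Re w\<bar>)"
    proof (cases "\<bar>Im w\<bar> = h (Re w)")
      case True
      then show ?thesis using bdry[of w] by (simp add: h_def)
    next
      case False
      then have "\<bar>Re w\<bar> = X" "\<bar>Im w\<bar> \<le> h (Re w)" using w by (auto simp: S_def S'_def)
      then show ?thesis using far[of w] C'X by simp
    qed
    also have "\<dots> \<le> B * exp (3 * \<epsilon> * \<bar>Re w\<bar>)" using par by (simp add: mult_right_mono)
    also have "\<dots> = 4 * B * (exp (3 * \<epsilon> * \<bar>Re w\<bar>) / 4)" by simp
    also have "\<dots> \<le> 4 * B * cmod (E w)" using par w Elow[of w] by (intro mult_left_mono) (auto simp: S'_def)
    finally show "cmod (F w / E w) \<le> 4 * B"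
      using w Epos[of w] by (simp add: S'_def norm_divide divide_le_eq)
  qed (rule bS)
  moreover have Ez: "E z \<noteq> 0" using z par by (intro Epos) (simp add: h_def add_increasing2)
  ultimately have "cmod (F z) \<le> 4 * B * cmod (E z)" by (simp add: norm_divide divide_le_eq)
  also have "\<dots> \<le> 4 * B * (2 * exp (3 * \<epsilon> * \<bar>Re z\<bar>))"
    using exp_plus_exp_minus_upper[of "of_real (3 * \<epsilon>) * z"] par
    by (intro mult_left_mono) (auto simp: E_def abs_mult)
  finally show ?thesis by simp
qed

text \<open>
  Multiplication by \<open>exp (\<i> * b * z)\<close> makes \<open>F\<close> bounded in the upper
  half-plane \<open>Im z \<ge> y1\<close> and does not change its modulus on a horizontal line except by a
  constant, so the bound for quotients applies; for the lower half-plane the same is done with the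
  function \<open>cnj (F (cnj z))\<close>.
\<close>

lemma strip_bound:
  assumes cont: "continuous_on {z. Im z \<ge> 0} \<beta>" and hol: "\<beta> holomorphic_on {z. Im z > 0}"
    and bd: "\<And>z. Im z \<ge> 0 \<Longrightarrow> cmod (\<beta> z) \<le> 1 / 2" and w0: "Im w0 > 0" "\<beta> w0 \<noteq> 0"
    and "y1 > 0" "b > 0" "\<epsilon> > 0"
  obtains M where "M > 0"
    "\<And>F C D z. F holomorphic_on UNIV \<Longrightarrow> (\<And>z. cmod (F z) \<le> C * exp (b * \<bar>Im z\<bar>)) \<Longrightarrow> D > 0 \<Longrightarrow>
      (\<And>t. cmod (F (Complex t y1)) * cmod (\<beta> (of_real t)) \<le> D) \<Longrightarrow>
      (\<And>t. cmod (F (Complex t (- y1))) * cmod (\<beta> (of_real t)) \<le> D) \<Longrightarrow>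
      \<bar>Im z\<bar> \<le> y1 \<Longrightarrow> cmod (F z) \<le> M * D * exp (\<epsilon> * \<bar>Re z\<bar>)"
proof -
  define e where "e = min (\<epsilon> / 3) (1 / (6 * (y1 + 1)))"
  define \<eta> where "\<eta> = min (1/2) (e / b)"
  have e: "e > 0" "3 * e \<le> \<epsilon>" using assms by (auto simp: e_def)
  have "e * (6 * (y1 + 1)) \<le> (1 / (6 * (y1 + 1))) * (6 * (y1 + 1))"
    using \<open>y1 > 0\<close> by (intro mult_right_mono) (auto simp: e_def)
  then have e': "3 * e * (y1 + 1) \<le> 1/2" using \<open>y1 > 0\<close> by (simp add: algebra_simps)
  have \<eta>: "\<eta> > 0" "\<eta> \<le> 1/2" proof -
    show "\<eta> > 0" using e(1) \<open>b > 0\<close> by (simp add: \<eta>_def)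
    show "\<eta> \<le> 1/2" unfolding \<eta>_def by (rule min.cobounded1)
  qed
  have "b * \<eta> \<le> b * (e / b)" using \<open>b > 0\<close> by (intro mult_left_mono) (auto simp: \<eta>_def)
  then have b\<eta>: "b * \<eta> \<le> e" using \<open>b > 0\<close> by simp
  show ?thesis
  proof (rule quotient_bound[OF cont hol bd w0 \<eta>(1) e(1)])
    fix M :: real assume M: "M > 0" and
      bound: "\<And>G D K x. continuous_on {z. Im z \<ge> 0} G \<Longrightarrow> G holomorphic_on {z. Im z > 0} \<Longrightarrow>
      (\<And>z. Im z \<ge> 0 \<Longrightarrow> cmod (G z) \<le> K) \<Longrightarrow> D > 0 \<Longrightarrow>
      (\<And>t::real. cmod (G (of_real t)) * cmod (\<beta> (of_real t)) \<le> D) \<Longrightarrow>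
      cmod (G (Complex x (\<eta> * (1 + \<bar>x\<bar>)))) \<le> M * D * exp (e * \<bar>x\<bar>)"
    have upper: "cmod (F (Complex x (y1 + \<eta> * (1 + \<bar>x\<bar>)))) \<le> M * D * exp e * exp (2 * e * \<bar>x\<bar>) * exp (b * y1)"
      if F: "F holomorphic_on UNIV" "\<And>z. cmod (F z) \<le> C * exp (b * \<bar>Im z\<bar>)" "D > 0"
        "\<And>t. cmod (F (Complex t y1)) * cmod (\<beta> (of_real t)) \<le> D" for F C D x
    proof -
      define G where "G z = F (z + \<i> * of_real y1) * exp (\<i> * of_real b * z)" for z
      have "(F \<circ> (\<lambda>z. z + \<i> * of_real y1)) holomorphic_on UNIV"
        by (rule holomorphic_on_compose_gen[OF _ F(1)]) (auto intro!: holomorphic_intros)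
      then have Gh: "G holomorphic_on A" for A
        unfolding G_def o_def by (intro holomorphic_intros) (rule holomorphic_on_subset, auto)
      have C: "C \<ge> 0" using F(2)[of 0] norm_ge_zero[of "F 0"] by (simp del: norm_ge_zero)
      have Gb: "cmod (G z) \<le> C * exp (b * y1)" if "Im z \<ge> 0" for z
      proof -
        have "cmod (G z) \<le> C * exp (b * (Im z + y1)) * exp (- (b * Im z))"
          using F(2)[of "z + \<i> * of_real y1"] that \<open>y1 > 0\<close> by (simp add: G_def norm_mult)
        also have "\<dots> = C * exp (b * y1)" by (simp add: mult.assoc mult_exp_exp algebra_simps)
        finally show ?thesis .
      qed
      have "cmod (G (of_real t)) = cmod (F (Complex t y1))" for t
      proof -
        have "of_real t + \<i> * of_real y1 = Complex t y1" by (simp add: complex_eq_iff)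
        then show ?thesis by (simp add: G_def norm_mult)
      qed
      then have "cmod (G (Complex x (\<eta> * (1 + \<bar>x\<bar>)))) \<le> M * D * exp (e * \<bar>x\<bar>)"
        using F(3,4) by (intro bound[OF holomorphic_on_imp_continuous_on[OF Gh] Gh Gb]) auto
      moreover have "cmod (G (Complex x (\<eta> * (1 + \<bar>x\<bar>)))) =
          cmod (F (Complex x (y1 + \<eta> * (1 + \<bar>x\<bar>)))) * exp (- (b * (\<eta> * (1 + \<bar>x\<bar>))))"
      proof -
        have "Complex x (\<eta> * (1 + \<bar>x\<bar>)) + \<i> * of_real y1 = Complex x (y1 + \<eta> * (1 + \<bar>x\<bar>))"
          by (simp add: complex_eq_iff)
        then show ?thesis by (simp add: G_def norm_mult)
      qed
      moreover have "n \<le> r * exp u" if "N \<le> r" "N = n * exp (- u)" for n N r u :: real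
        using that by (simp add: exp_minus field_simps)
      ultimately have "cmod (F (Complex x (y1 + \<eta> * (1 + \<bar>x\<bar>)))) \<le> M * D * exp (e * \<bar>x\<bar>) * exp (b * (\<eta> * (1 + \<bar>x\<bar>)))"
        by blast
      also have "\<dots> \<le> M * D * exp (e * \<bar>x\<bar>) * exp (e * (1 + \<bar>x\<bar>))"
      proof -
        have "b * (\<eta> * (1 + \<bar>x\<bar>)) \<le> e * (1 + \<bar>x\<bar>)"
          using mult_right_mono[OF b\<eta>, of "1 + \<bar>x\<bar>"] by (simp add: mult.assoc)
        then show ?thesis using M F(3) by (intro mult_left_mono) auto
      qed
      also have "\<dots> = M * D * exp e * exp (2 * e * \<bar>x\<bar>) * 1"
        by (simp add: mult.assoc mult_exp_exp algebra_simps)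
      also have "\<dots> \<le> M * D * exp e * exp (2 * e * \<bar>x\<bar>) * exp (b * y1)"
        using M F(3) \<open>b > 0\<close> \<open>y1 > 0\<close> by (intro mult_left_mono) auto
      finally show ?thesis .
    qed
    define M' where "M' = 8 * (M * exp e * exp (b * y1))"
    show thesis
    proof (rule that[of M'])
      show "M' > 0" using M by (simp add: M'_def)
      fix F C D z
      assume F: "F holomorphic_on UNIV" "\<And>z. cmod (F z) \<le> C * exp (b * \<bar>Im z\<bar>)" "D > 0"
        "\<And>t. cmod (F (Complex t y1)) * cmod (\<beta> (of_real t)) \<le> D"
        "\<And>t. cmod (F (Complex t (- y1))) * cmod (\<beta> (of_real t)) \<le> D" and z: "\<bar>Im z\<bar> \<le> y1"
      define F'' where "F'' z = cnj (F (cnj z))" for z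
      have F''h: "F'' holomorphic_on UNIV"
        proof -
        have "F holomorphic_on cnj ` UNIV" by (rule holomorphic_on_subset[OF F(1)]) simp
        from holomorphic_on_compose_cnj_cnj[OF this open_UNIV] show ?thesis by (simp add: o_def F''_def[abs_def])
      qed
      have F''b: "cmod (F'' z) \<le> C * exp (b * \<bar>Im z\<bar>)" for z
        using F(2)[of "cnj z"] by (simp add: F''_def)
      have F''D: "cmod (F'' (Complex t y1)) * cmod (\<beta> (of_real t)) \<le> D" for t
      proof -
        have "cnj (Complex t y1) = Complex t (- y1)" by (simp add: complex_eq_iff)
        then show ?thesis using F(5)[of t] by (simp add: F''_def)
      qed
      let ?B = "M * D * exp e * exp (b * y1)"
      have "cmod (F z) \<le> 8 * ?B * exp (3 * e * \<bar>Re z\<bar>)"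
      proof (rule widening_strip_bound[OF F(1,2) \<open>b > 0\<close> \<open>y1 > 0\<close> e(1) \<eta>(1) e' \<eta>(2) b\<eta> _ _ z])
        show "?B > 0" using M F(3) by simp
        fix w assume w: "\<bar>Im w\<bar> = y1 + \<eta> * (1 + \<bar>Re w\<bar>)"
        show "cmod (F w) \<le> ?B * exp (2 * e * \<bar>Re w\<bar>)"
        proof (cases "Im w \<ge> 0")
          case True
          then have "w = Complex (Re w) (y1 + \<eta> * (1 + \<bar>Re w\<bar>))" using w by (simp add: complex_eq_iff)
          then show ?thesis using upper[OF F(1-4), of "Re w"] by (simp add: mult_ac)
        next
          case False
          then have "cnj w = Complex (Re w) (y1 + \<eta> * (1 + \<bar>Re w\<bar>))" using w by (simp add: complex_eq_iff)
          then have "cmod (F w) = cmod (F'' (Complex (Re w) (y1 + \<eta> * (1 + \<bar>Re w\<bar>))))"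
            unfolding F''_def by (metis complex_cnj_cnj complex_mod_cnj)
          then show ?thesis using upper[OF F''h F''b F(3) F''D, of "Re w"] by (simp add: mult_ac)
        qed
      qed
      also have "\<dots> \<le> 8 * ?B * exp (\<epsilon> * \<bar>Re z\<bar>)"
        using M F(3) e(2) by (intro mult_left_mono) (auto intro!: mult_right_mono)
      finally show "cmod (F z) \<le> M' * D * exp (\<epsilon> * \<bar>Re z\<bar>)" by (simp add: M'_def mult_ac)
    qed
  qed
qed

section \<open>Square integrable functions and annihilating functionals\<close>

lemma L2_D:
  assumes "G \<in> L2 M" shows "G \<in> borel_measurable M" "integrable M (\<lambda>t. (cmod (G t))\<^sup>2)"
  using assms unfolding L2_def by auto

lemma L2_dominated:
  assumes "G \<in> L2 M" "H \<in> borel_measurable M" "\<And>t. cmod (H t) \<le> c * cmod (G t)"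
  shows "H \<in> L2 M"
proof -
  have "integrable M (\<lambda>t. (cmod (H t))\<^sup>2)"
  proof (rule Bochner_Integration.integrable_bound)
    show "integrable M (\<lambda>t. c\<^sup>2 * (cmod (G t))\<^sup>2)" using L2_D(2)[OF assms(1)] by (rule integrable_mult_right)
    show "(\<lambda>t. (cmod (H t))\<^sup>2) \<in> borel_measurable M" using assms(2) by measurable
    have "(cmod (H t))\<^sup>2 \<le> c\<^sup>2 * (cmod (G t))\<^sup>2" for t
      using power_mono[OF assms(3)[of t], of 2] by (simp add: power_mult_distrib)
    then show "AE t in M. norm ((cmod (H t))\<^sup>2) \<le> norm (c\<^sup>2 * (cmod (G t))\<^sup>2)"
      by (intro AE_I2) simp
  qed
  then show ?thesis using assms(2) unfolding L2_def by simp
qed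

lemma norm_lin_sq: "(cmod (a + b))\<^sup>2 \<le> 2 * (cmod a)\<^sup>2 + 2 * (cmod b)\<^sup>2"
proof -
  have "(cmod (a + b))\<^sup>2 \<le> (cmod a + cmod b)\<^sup>2" by (intro power_mono norm_triangle_ineq) simp
  also have "\<dots> \<le> 2 * (cmod a)\<^sup>2 + 2 * (cmod b)\<^sup>2"
    using sum_squares_bound[of "cmod a" "cmod b"] by (simp add: power2_sum)
  finally show ?thesis .
qed

lemma L2_lin:
  assumes "G \<in> L2 M" "H \<in> L2 M"
  shows "(\<lambda>t. c * G t + d * H t) \<in> L2 M"
proof -
  note [measurable] = L2_D(1)[OF assms(1)] L2_D(1)[OF assms(2)]
  have "integrable M (\<lambda>t. (cmod (c * G t + d * H t))\<^sup>2)"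
  proof (rule Bochner_Integration.integrable_bound)
    show "integrable M (\<lambda>t. 2 * (cmod c)\<^sup>2 * (cmod (G t))\<^sup>2 + 2 * (cmod d)\<^sup>2 * (cmod (H t))\<^sup>2)"
      by (intro Bochner_Integration.integrable_add integrable_mult_right L2_D(2) assms)
    show "(\<lambda>t. (cmod (c * G t + d * H t))\<^sup>2) \<in> borel_measurable M" by measurable
    have "(cmod (c * G t + d * H t))\<^sup>2 \<le> 2 * (cmod c)\<^sup>2 * (cmod (G t))\<^sup>2 + 2 * (cmod d)\<^sup>2 * (cmod (H t))\<^sup>2" for t
      using norm_lin_sq[of "c * G t" "d * H t"] by (simp add: norm_mult power_mult_distrib)
    then show "AE t in M. norm ((cmod (c * G t + d * H t))\<^sup>2) \<le> norm (2 * (cmod c)\<^sup>2 * (cmod (G t))\<^sup>2 + 2 * (cmod d)\<^sup>2 * (cmod (H t))\<^sup>2)"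
      by (intro AE_I2) simp
  qed
  moreover have "(\<lambda>t. c * G t + d * H t) \<in> borel_measurable M" by measurable
  ultimately show ?thesis unfolding L2_def by simp
qed

lemma L2_diff: "G \<in> L2 M \<Longrightarrow> H \<in> L2 M \<Longrightarrow> (\<lambda>t. G t - H t) \<in> L2 M"
  using L2_lin[of G M H 1 "-1"] by simp

lemma L2_scale: "G \<in> L2 M \<Longrightarrow> (\<lambda>t. c * G t) \<in> L2 M"
  using L2_lin[of G M G c 0] by simp

lemma L2_norm_nonneg: "L2_norm M G \<ge> 0"
  unfolding L2_norm_def by (intro real_sqrt_ge_zero Bochner_Integration.integral_nonneg) simp

lemma L2_norm_sq: "(L2_norm M G)\<^sup>2 = (LINT t|M. (cmod (G t))\<^sup>2)"
  unfolding L2_norm_def by (intro real_sqrt_pow2 Bochner_Integration.integral_nonneg) simp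

lemma L2_norm_mono:
  assumes "G \<in> L2 M" "H \<in> borel_measurable M" "\<And>t. cmod (H t) \<le> c * cmod (G t)" "c \<ge> 0"
  shows "L2_norm M H \<le> c * L2_norm M G"
proof (rule power2_le_imp_le)
  have "(LINT t|M. (cmod (H t))\<^sup>2) \<le> (LINT t|M. c\<^sup>2 * (cmod (G t))\<^sup>2)"
    by (rule integral_mono[OF L2_D(2)[OF L2_dominated[OF assms(1-3)]] integrable_mult_right[OF L2_D(2)[OF assms(1)]]])
      (use power_mono[OF assms(3), of _ 2] in \<open>simp add: power_mult_distrib\<close>)
  then show "(L2_norm M H)\<^sup>2 \<le> (c * L2_norm M G)\<^sup>2"
    by (simp add: power_mult_distrib L2_norm_sq)
  show "0 \<le> c * L2_norm M G" using assms(4) L2_norm_nonneg[of M G] by simp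
qed

definition inner_L2 :: "real measure \<Rightarrow> (real \<Rightarrow> complex) \<Rightarrow> (real \<Rightarrow> complex) \<Rightarrow> complex" where
  "inner_L2 M G H = (LINT t|M. G t * cnj (H t))"

lemma inner_L2_integrable:
  assumes "G \<in> L2 M" "H \<in> L2 M"
  shows "integrable M (\<lambda>t. G t * cnj (H t))"
proof (rule Bochner_Integration.integrable_bound)
  note [measurable] = L2_D(1)[OF assms(1)] L2_D(1)[OF assms(2)]
  show "integrable M (\<lambda>t. (cmod (G t))\<^sup>2 + (cmod (H t))\<^sup>2)"
    by (intro Bochner_Integration.integrable_add L2_D(2) assms)
  have "(\<lambda>t. cnj (H t)) \<in> borel_measurable M"
    by (rule measurable_compose[OF L2_D(1)[OF assms(2)]]) (intro borel_measurable_continuous_onI continuous_intros)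
  then show "(\<lambda>t. G t * cnj (H t)) \<in> borel_measurable M" using L2_D(1)[OF assms(1)] by (intro borel_measurable_times)
  have "norm (G t * cnj (H t)) \<le> norm ((cmod (G t))\<^sup>2 + (cmod (H t))\<^sup>2)" for t
  proof -
    have "2 * (cmod (G t) * cmod (H t)) \<le> (cmod (G t))\<^sup>2 + (cmod (H t))\<^sup>2"
      using sum_squares_bound[of "cmod (G t)" "cmod (H t)"] by (simp only: mult.assoc)
    moreover have "cmod (G t) * cmod (H t) \<ge> 0" by simp
    ultimately have "cmod (G t) * cmod (H t) \<le> (cmod (G t))\<^sup>2 + (cmod (H t))\<^sup>2" by linarith
    then show ?thesis by (simp add: norm_mult)
  qed
  then show "AE t in M. norm (G t * cnj (H t)) \<le> norm ((cmod (G t))\<^sup>2 + (cmod (H t))\<^sup>2)"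
    by (intro AE_I2)
qed

lemma inner_L2_lin_left:
  assumes "F \<in> L2 M" "G \<in> L2 M" "H \<in> L2 M"
  shows "inner_L2 M (\<lambda>t. c * F t + d * G t) H = c * inner_L2 M F H + d * inner_L2 M G H"
proof -
  have "inner_L2 M (\<lambda>t. c * F t + d * G t) H = (LINT t|M. c * (F t * cnj (H t)) + d * (G t * cnj (H t)))"
    unfolding inner_L2_def by (simp only: distrib_right mult.assoc)
  also have "\<dots> = c * inner_L2 M F H + d * inner_L2 M G H"
    unfolding inner_L2_def
    using Bochner_Integration.integral_add[OF integrable_mult_right[OF inner_L2_integrable[OF assms(1,3)], of c]
      integrable_mult_right[OF inner_L2_integrable[OF assms(2,3)], of d]]
    by (simp only: integral_mult_right_zero)
  finally show ?thesis .
qed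

lemma inner_L2_swap: "inner_L2 M G H = cnj (inner_L2 M H G)"
  unfolding inner_L2_def by (subst Bochner_Integration.integral_cnj[symmetric]) (simp add: mult.commute)

lemma inner_L2_self: "inner_L2 M G G = of_real ((L2_norm M G)\<^sup>2)"
  unfolding inner_L2_def L2_norm_sq complex_norm_square[symmetric] by (rule integral_complex_of_real)

lemma L2_norm_lin_sq:
  assumes "G \<in> L2 M" "H \<in> L2 M"
  shows "(L2_norm M (\<lambda>t. G t + c * H t))\<^sup>2 = (L2_norm M G)\<^sup>2 + 2 * Re (c * inner_L2 M H G) + (cmod c)\<^sup>2 * (L2_norm M H)\<^sup>2"
proof -
  have L: "(\<lambda>t. 1 * G t + c * H t) \<in> L2 M" by (rule L2_lin[OF assms])
  have "inner_L2 M (\<lambda>t. 1 * G t + c * H t) (\<lambda>t. 1 * G t + c * H t)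
      = 1 * inner_L2 M G (\<lambda>t. 1 * G t + c * H t) + c * inner_L2 M H (\<lambda>t. 1 * G t + c * H t)"
    by (rule inner_L2_lin_left[OF assms L])
  also have "inner_L2 M G (\<lambda>t. 1 * G t + c * H t) = cnj (1 * inner_L2 M G G + c * inner_L2 M H G)"
    by (subst inner_L2_swap, subst inner_L2_lin_left[OF assms assms(1)]) (rule refl)
  also have "inner_L2 M H (\<lambda>t. 1 * G t + c * H t) = cnj (1 * inner_L2 M G H + c * inner_L2 M H H)"
    by (subst inner_L2_swap, subst inner_L2_lin_left[OF assms assms(2)]) (rule refl)
  finally have "complex_of_real ((L2_norm M (\<lambda>t. G t + c * H t))\<^sup>2) =
      cnj (inner_L2 M G G) + (cnj (c * inner_L2 M H G) + c * inner_L2 M H G) + c * cnj c * cnj (inner_L2 M H H)"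
    unfolding inner_L2_self[symmetric] using inner_L2_swap[of M G H]
    by (simp add: algebra_simps)
  also have "cnj (c * inner_L2 M H G) + c * inner_L2 M H G = of_real (2 * Re (c * inner_L2 M H G))"
    using complex_add_cnj[of "c * inner_L2 M H G"] by (simp add: add.commute)
  also have "c * cnj c = of_real ((cmod c)\<^sup>2)" by (rule complex_norm_square[symmetric])
  finally have "complex_of_real ((L2_norm M (\<lambda>t. G t + c * H t))\<^sup>2) =
     of_real ((L2_norm M G)\<^sup>2 + 2 * Re (c * inner_L2 M H G) + (cmod c)\<^sup>2 * (L2_norm M H)\<^sup>2)"
    unfolding inner_L2_self by simp
  then show ?thesis by (simp only: of_real_eq_iff)
qed

text \<open>
  Evaluate the lower bound at \<open>c = - cnj w / (Q + 1)\<close>. The lemma yields the Cauchy--Schwarz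
  inequality, and for small \<open>e\<close> it says that the error of an almost best approximation is
  almost orthogonal to the subspace.
\<close>

lemma optimize_quadratic:
  fixes w :: complex and Q e :: real
  assumes "Q \<ge> 0" and *: "\<And>c. - e \<le> 2 * Re (c * w) + (cmod c)\<^sup>2 * Q"
  shows "(cmod w)\<^sup>2 \<le> e * (Q + 1)"
proof -
  define s where "s = 1 / (Q + 1)"
  define W where "W = (cmod w)\<^sup>2"
  have s: "s > 0" "s * (Q + 1) = 1" using assms(1) by (auto simp: s_def)
  have "Re (- of_real s * cnj w * w) = - s * W"
  proof -
    have "cnj w * w = of_real W" unfolding W_def complex_norm_square by (rule mult.commute)
    then show ?thesis by (simp add: mult.assoc)
  qed
  moreover have "(cmod (- of_real s * cnj w))\<^sup>2 = s\<^sup>2 * W" using s by (simp add: norm_mult power_mult_distrib W_def)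
  ultimately have "2 * (s * W) \<le> e + s\<^sup>2 * W * Q" using *[of "- of_real s * cnj w"] by simp
  moreover have "s\<^sup>2 * W * Q \<le> s * W"
  proof -
    have "s * Q \<le> 1" using s by (simp add: algebra_simps)
    then have "(s * Q) * (s * W) \<le> 1 * (s * W)" using s by (intro mult_right_mono) (auto simp: W_def)
    then show ?thesis by (simp add: power2_eq_square mult_ac)
  qed
  ultimately have "s * W \<le> e" by linarith
  then have "(s * W) * (Q + 1) \<le> e * (Q + 1)" using assms(1) by (intro mult_right_mono) auto
  moreover have "(s * W) * (Q + 1) = (s * (Q + 1)) * W" by (simp only: mult_ac)
  ultimately show ?thesis unfolding s(2) W_def by (simp only: mult_1)
qed

lemma cauchy_schwarz_L2:
  assumes "G \<in> L2 M" "H \<in> L2 M"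
  shows "cmod (inner_L2 M G H) \<le> L2_norm M G * L2_norm M H"
proof -
  have sq: "(cmod (c * inner_L2 M G H))\<^sup>2 \<le> (L2_norm M H)\<^sup>2 * ((cmod c)\<^sup>2 * (L2_norm M G)\<^sup>2 + 1)" for c :: complex
  proof (rule optimize_quadratic)
    fix d
    have "0 \<le> (L2_norm M (\<lambda>t. H t + (d * c) * G t))\<^sup>2" by simp
    also note L2_norm_lin_sq[OF assms(2,1)]
    finally show "- (L2_norm M H)\<^sup>2 \<le> 2 * Re (d * (c * inner_L2 M G H)) + (cmod d)\<^sup>2 * ((cmod c)\<^sup>2 * (L2_norm M G)\<^sup>2)"
      by (simp add: norm_mult power_mult_distrib mult_ac)
  qed simp
  have "(cmod (inner_L2 M G H))\<^sup>2 \<le> (L2_norm M G)\<^sup>2 * (L2_norm M H)\<^sup>2"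
  proof (rule field_le_epsilon)
    fix e :: real assume "e > 0"
    define c where "c = sqrt (((L2_norm M H)\<^sup>2 + 1) / e)"
    have c: "c\<^sup>2 = ((L2_norm M H)\<^sup>2 + 1) / e" "c > 0" using \<open>e > 0\<close> by (auto simp: c_def add_nonneg_pos)
    have "c\<^sup>2 * (cmod (inner_L2 M G H))\<^sup>2 \<le> (L2_norm M H)\<^sup>2 * (c\<^sup>2 * (L2_norm M G)\<^sup>2 + 1)"
      using sq[of "of_real c"] by (simp add: norm_mult power_mult_distrib)
    also have "\<dots> \<le> c\<^sup>2 * ((L2_norm M G)\<^sup>2 * (L2_norm M H)\<^sup>2) + c\<^sup>2 * e"
      using \<open>e > 0\<close> unfolding c(1) by (simp add: field_simps)
    finally have "c\<^sup>2 * (cmod (inner_L2 M G H))\<^sup>2 \<le> c\<^sup>2 * ((L2_norm M G)\<^sup>2 * (L2_norm M H)\<^sup>2 + e)"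
      by (simp add: distrib_left)
    then show "(cmod (inner_L2 M G H))\<^sup>2 \<le> (L2_norm M G)\<^sup>2 * (L2_norm M H)\<^sup>2 + e"
      using c(2) by simp
  qed
  then have "(cmod (inner_L2 M G H))\<^sup>2 \<le> (L2_norm M G * L2_norm M H)\<^sup>2" by (simp add: power_mult_distrib)
  then show ?thesis by (rule power2_le_imp_le) (simp add: L2_norm_nonneg)
qed

locale bounded_functional =
  fixes M :: "real measure" and l :: "(real \<Rightarrow> complex) \<Rightarrow> complex" and C :: real
  assumes sets_M [measurable_cong]: "sets M = sets borel"
    and C_nonneg: "C \<ge> 0"
    and lin: "\<And>F G c d. F \<in> L2 M \<Longrightarrow> G \<in> L2 M \<Longrightarrow> l (\<lambda>t. c * F t + d * G t) = c * l F + d * l G"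
    and bound: "\<And>F. F \<in> L2 M \<Longrightarrow> cmod (l F) \<le> C * L2_norm M F"

text \<open>
  The errors \<open>h n = g - F n\<close> of a minimizing sequence for the distance of \<open>g\<close> to
  \<open>S\<close> form a Cauchy sequence by the parallelogram law, hence the inner products with \<open>h
  n\<close> converge. Their limit is the functional.
\<close>

lemma annihilating_functional:
  assumes S: "S \<subseteq> L2 M" "S \<noteq> {}" and lin: "\<And>F G c d. F \<in> S \<Longrightarrow> G \<in> S \<Longrightarrow> (\<lambda>t. c * F t + d * G t) \<in> S"
    and g: "g \<in> L2 M" and far: "e > 0" "\<And>F. F \<in> S \<Longrightarrow> e \<le> L2_norm M (\<lambda>t. g t - F t)"
    and borel: "sets M = sets borel"
  shows "\<exists>l C. bounded_functional M l C \<and> (\<forall>F\<in>S. l F = 0) \<and> l g \<noteq> 0"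
proof -
  let ?d = "\<lambda>F. (L2_norm M (\<lambda>t. g t - F t))\<^sup>2"
  define D where "D = (INF F\<in>S. ?d F)"
  have bdd: "bdd_below (?d ` S)" by (rule bdd_belowI[of _ 0]) auto
  have DS: "D \<le> ?d F" if "F \<in> S" for F unfolding D_def by (rule cINF_lower[OF bdd that])
  have "e\<^sup>2 \<le> D"
    unfolding D_def by (rule cINF_greatest[OF S(2)]) (use far in \<open>intro power_mono, auto\<close>)
  then have D: "D > 0" using far(1) by (meson less_le_trans zero_less_power)
  have "\<exists>F\<in>S. ?d F < D + 1 / real (Suc n)" for n
  proof -
    have "D < D + 1 / real (Suc n)" by simp
    then show ?thesis unfolding D_def[symmetric] using cINF_less_iff[OF S(2) bdd] D_def by metis
  qed
  then obtain F where F: "\<And>n. F n \<in> S" "\<And>n. ?d (F n) < D + 1 / real (Suc n)" by metis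
  define h where "h n t = g t - F n t" for n t
  have FL: "F n \<in> L2 M" for n using F(1) S(1) by blast
  have hL: "h n \<in> L2 M" for n unfolding h_def[abs_def] by (rule L2_diff[OF g FL])
  have hn: "(L2_norm M (h n))\<^sup>2 < D + 1 / real (Suc n)" for n
    using F(2)[of n] unfolding h_def[abs_def] .
  have hD: "D \<le> (L2_norm M (\<lambda>t. h n t + c * G t))\<^sup>2" if "G \<in> S" for n c G
  proof -
    have "(\<lambda>t. 1 * F n t + (- c) * G t) \<in> S" by (rule lin[OF F(1) that])
    from DS[OF this] show ?thesis by (simp add: h_def algebra_simps)
  qed
  define N where "N = sqrt (D + 1)"
  have hN: "L2_norm M (h n) \<le> N" for n
  proof -
    have "1 / real (Suc n) \<le> 1" by simp
    then have "(L2_norm M (h n))\<^sup>2 \<le> D + 1" using hn[of n] by linarith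
    then show ?thesis unfolding N_def by (rule real_le_rsqrt)
  qed
  have small: "(cmod (inner_L2 M G (h n)))\<^sup>2 \<le> 1 / real (Suc n) * ((L2_norm M G)\<^sup>2 + 1)" if "G \<in> S" for G n
  proof (rule optimize_quadratic)
    fix c
    have GL: "G \<in> L2 M" using that S(1) by blast
    have "D \<le> (L2_norm M (h n))\<^sup>2 + 2 * Re (c * inner_L2 M G (h n)) + (cmod c)\<^sup>2 * (L2_norm M G)\<^sup>2"
      using hD[OF that, of n c] unfolding L2_norm_lin_sq[OF hL GL] .
    then show "- (1 / real (Suc n)) \<le> 2 * Re (c * inner_L2 M G (h n)) + (cmod c)\<^sup>2 * (L2_norm M G)\<^sup>2"
      using hn[of n] by linarith
  qed simp
  have cauchy_h: "(L2_norm M (\<lambda>t. h n t - h m t))\<^sup>2 \<le> 2 / real (Suc n) + 2 / real (Suc m)" for n m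
  proof -
    have "(\<lambda>t. 1 * F n t + (-1) * F m t) \<in> S" by (rule lin[OF F(1) F(1)])
    from hD[OF this, of n "1/2"]
    \<comment> \<open>the midpoint of two errors is again an error\<close>
    have mid: "D \<le> (L2_norm M (\<lambda>t. h n t + (1/2) * (h m t - h n t)))\<^sup>2"
      by (simp add: h_def)
    have dL: "(\<lambda>t. h m t - h n t) \<in> L2 M" by (rule L2_diff[OF hL hL])
    define a b p where "a = (L2_norm M (h n))\<^sup>2" and "b = (L2_norm M (\<lambda>t. h m t - h n t))\<^sup>2"
      and "p = Re (inner_L2 M (\<lambda>t. h m t - h n t) (h n))"
    have "(L2_norm M (\<lambda>t. h n t + 1 * (h m t - h n t)))\<^sup>2 = a + 2 * p + b"
      unfolding L2_norm_lin_sq[OF hL dL] by (simp add: a_def b_def p_def)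
    then have m: "(L2_norm M (h m))\<^sup>2 = a + 2 * p + b" by simp
    have "(L2_norm M (\<lambda>t. h n t + (1/2) * (h m t - h n t)))\<^sup>2 = a + p + b / 4"
      unfolding L2_norm_lin_sq[OF hL dL] by (simp add: a_def b_def p_def power2_eq_square norm_divide)
    with mid have "D \<le> a + p + b / 4" by simp
    with m hn[of n] hn[of m] have "b \<le> 2 * (1 / real (Suc n)) + 2 * (1 / real (Suc m))"
      unfolding a_def[symmetric] by linarith
    moreover have "b = (L2_norm M (\<lambda>t. h n t - h m t))\<^sup>2"
      unfolding b_def L2_norm_sq by (simp add: norm_minus_commute)
    ultimately show ?thesis by simp
  qed
  have conv: "convergent (\<lambda>n. inner_L2 M G (h n))" if GL: "G \<in> L2 M" for G
  proof -
    have diff: "inner_L2 M G (h n) - inner_L2 M G (h m) = inner_L2 M G (\<lambda>t. h n t - h m t)" for n m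
    proof -
      have "inner_L2 M (\<lambda>t. 1 * h n t + (-1) * h m t) G = 1 * inner_L2 M (h n) G + (-1) * inner_L2 M (h m) G"
        by (rule inner_L2_lin_left[OF hL hL GL])
      then show ?thesis using inner_L2_swap[of M G] by simp
    qed
    have "Cauchy (\<lambda>n. inner_L2 M G (h n))"
    proof (rule CauchyI)
      fix e :: real assume "e > 0"
      define a where "a = e / (L2_norm M G + 1)"
      have a: "a > 0" using \<open>e > 0\<close> L2_norm_nonneg[of M G] by (simp add: a_def add_nonneg_pos)
      obtain K :: nat where K: "4 / a\<^sup>2 < real K" using reals_Archimedean2 by blast
      have "norm (inner_L2 M G (h m) - inner_L2 M G (h n)) < e" if "m \<ge> K" "n \<ge> K" for m n
      proof -
        have Kp: "real K > 0" using K a by (meson divide_pos_pos less_trans zero_less_numeral zero_less_power)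
        have "2 / real (Suc m) \<le> 2 / real K" "2 / real (Suc n) \<le> 2 / real K"
          using that Kp by (auto intro!: divide_left_mono)
        then have "(L2_norm M (\<lambda>t. h m t - h n t))\<^sup>2 \<le> 4 / real K" using cauchy_h[of m n] by simp
        also have "\<dots> < a\<^sup>2" using K Kp a by (simp add: field_simps)
        finally have "L2_norm M (\<lambda>t. h m t - h n t) < a" by (rule power2_less_imp_less) (use a in simp)
        then have "L2_norm M G * L2_norm M (\<lambda>t. h m t - h n t) \<le> L2_norm M G * a"
          using L2_norm_nonneg[of M G] by (intro mult_left_mono) auto
        also have "\<dots> < (L2_norm M G + 1) * a" using a by (simp add: algebra_simps)
        also have "\<dots> = e" using L2_norm_nonneg[of M G] by (simp add: a_def)
        finally show ?thesis
          unfolding diff using cauchy_schwarz_L2[OF GL L2_diff[OF hL hL], of m n] by (rule le_less_trans[rotated])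
      qed
      then show "\<exists>K. \<forall>m\<ge>K. \<forall>n\<ge>K. norm (inner_L2 M G (h m) - inner_L2 M G (h n)) < e" by blast
    qed
    then show ?thesis by (simp add: Cauchy_convergent_iff)
  qed
  define l where "l G = lim (\<lambda>n. inner_L2 M G (h n))" for G
  have l: "(\<lambda>n. inner_L2 M G (h n)) \<longlonglongrightarrow> l G" if "G \<in> L2 M" for G
    using conv[OF that] unfolding l_def convergent_LIMSEQ_iff .
  show ?thesis
  proof (intro exI[of _ l] exI[of _ N] conjI ballI bounded_functional.intro)
    show "sets M = sets borel" by (rule borel)
    show "N \<ge> 0" using hN[of 0] L2_norm_nonneg[of M "h 0"] by linarith
    show "l (\<lambda>t. c * F t + d * G t) = c * l F + d * l G" if "F \<in> L2 M" "G \<in> L2 M" for F G c d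
    proof (rule LIMSEQ_unique[OF l[OF L2_lin[OF that]]])
      show "(\<lambda>n. inner_L2 M (\<lambda>t. c * F t + d * G t) (h n)) \<longlonglongrightarrow> c * l F + d * l G"
        unfolding inner_L2_lin_left[OF that hL] by (intro tendsto_intros l that)
    qed
    show "cmod (l F) \<le> N * L2_norm M F" if "F \<in> L2 M" for F
    proof (rule Lim_bounded[where M = 0])
      show "(\<lambda>n. cmod (inner_L2 M F (h n))) \<longlonglongrightarrow> cmod (l F)" by (intro tendsto_intros l that)
      show "\<forall>n\<ge>0. cmod (inner_L2 M F (h n)) \<le> N * L2_norm M F"
        using cauchy_schwarz_L2[OF that hL] mult_left_mono[OF hN L2_norm_nonneg[of M F]]
        by (metis mult.commute order_trans)
    qed
    have z: "(\<lambda>n. 1 / real (Suc n) * K) \<longlonglongrightarrow> 0" for K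
      using tendsto_mult[OF LIMSEQ_Suc[OF lim_1_over_n] tendsto_const[of K]] by simp
    show "l F = 0" if "F \<in> S" for F
    proof -
      have "(\<lambda>n. (cmod (inner_L2 M F (h n)))\<^sup>2) \<longlonglongrightarrow> 0"
      proof (rule tendsto_sandwich[OF _ _ tendsto_const z[of "(L2_norm M F)\<^sup>2 + 1"]])
        show "\<forall>\<^sub>F n in sequentially. (cmod (inner_L2 M F (h n)))\<^sup>2 \<le> 1 / real (Suc n) * ((L2_norm M F)\<^sup>2 + 1)"
          by (intro always_eventually allI small[OF that])
      qed simp
      moreover have "(\<lambda>n. (cmod (inner_L2 M F (h n)))\<^sup>2) \<longlonglongrightarrow> (cmod (l F))\<^sup>2"
        using that S(1) by (intro tendsto_intros l) blast
      ultimately have "(cmod (l F))\<^sup>2 = 0" using LIMSEQ_unique by blast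
      then show ?thesis by simp
    qed
    show "l g \<noteq> 0"
    proof
      assume "l g = 0"
      define K where "K = (L2_norm M g + N + 1)\<^sup>2 + 1"
      have "D - sqrt (1 / real (Suc n) * K) \<le> Re (inner_L2 M g (h n))" for n
      proof -
        have nF: "L2_norm M (F n) \<le> L2_norm M g + N + 1"
        proof (rule power2_le_imp_le)
          have "(L2_norm M (F n))\<^sup>2 = (L2_norm M (\<lambda>t. g t + (-1) * h n t))\<^sup>2" by (simp add: h_def)
          also have "\<dots> = (L2_norm M g)\<^sup>2 + 2 * Re (- inner_L2 M (h n) g) + (L2_norm M (h n))\<^sup>2"
            unfolding L2_norm_lin_sq[OF g hL] by simp
          also have "Re (- inner_L2 M (h n) g) \<le> cmod (inner_L2 M (h n) g)"
            using complex_Re_le_cmod[of "- inner_L2 M (h n) g"] by simp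
          also have "\<dots> \<le> N * L2_norm M g"
            using cauchy_schwarz_L2[OF hL g, of n] mult_right_mono[OF hN[of n] L2_norm_nonneg[of M g]] by linarith
          also have "(L2_norm M (h n))\<^sup>2 \<le> N\<^sup>2" using hN L2_norm_nonneg by (intro power_mono) auto
          finally have "(L2_norm M (F n))\<^sup>2 \<le> (L2_norm M g + N)\<^sup>2" by (simp add: power2_eq_square algebra_simps)
          also have "\<dots> \<le> (L2_norm M g + N + 1)\<^sup>2"
            using L2_norm_nonneg[of M g] hN[of 0] L2_norm_nonneg[of M "h 0"] by (intro power_mono) auto
          finally show "(L2_norm M (F n))\<^sup>2 \<le> (L2_norm M g + N + 1)\<^sup>2" .
          show "0 \<le> L2_norm M g + N + 1"
            using L2_norm_nonneg[of M g] hN[of 0] L2_norm_nonneg[of M "h 0"] by linarith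
        qed
        have "(cmod (inner_L2 M (F n) (h n)))\<^sup>2 \<le> 1 / real (Suc n) * ((L2_norm M (F n))\<^sup>2 + 1)" by (rule small[OF F(1)])
        also have "\<dots> \<le> 1 / real (Suc n) * K"
          unfolding K_def using power_mono[OF nF L2_norm_nonneg, of 2] by (intro mult_left_mono) auto
        finally have s: "cmod (inner_L2 M (F n) (h n)) \<le> sqrt (1 / real (Suc n) * K)" by (rule real_le_rsqrt)
        have "inner_L2 M (\<lambda>t. 1 * h n t + 1 * F n t) (h n) = 1 * inner_L2 M (h n) (h n) + 1 * inner_L2 M (F n) (h n)"
          by (rule inner_L2_lin_left[OF hL FL hL])
        then have "inner_L2 M g (h n) = of_real ((L2_norm M (h n))\<^sup>2) + inner_L2 M (F n) (h n)"
          by (simp add: inner_L2_self h_def)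
        then have "Re (inner_L2 M g (h n)) = (L2_norm M (h n))\<^sup>2 + Re (inner_L2 M (F n) (h n))" by simp
        moreover have "D \<le> (L2_norm M (h n))\<^sup>2" using DS[OF F(1)[of n]] by (simp add: h_def[abs_def])
        moreover have "- Re (inner_L2 M (F n) (h n)) \<le> cmod (inner_L2 M (F n) (h n))"
          using complex_Re_le_cmod[of "- inner_L2 M (F n) (h n)"] by simp
        ultimately show ?thesis using s by linarith
      qed
      moreover have "(\<lambda>n. D - sqrt (1 / real (Suc n) * K)) \<longlonglongrightarrow> D - sqrt 0"
        by (intro tendsto_intros z)
      moreover have "(\<lambda>n. Re (inner_L2 M g (h n))) \<longlonglongrightarrow> Re (l g)" by (intro tendsto_intros l g)
      ultimately have "D - sqrt 0 \<le> Re (l g)" by (meson LIMSEQ_le)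
      then show False using D \<open>l g = 0\<close> by simp
    qed
  qed
qed

section \<open>Cauchy transforms of a functional\<close>

text \<open>
  Polynomial growth, measured by natural powers of \<open>1 + \<bar>t\<bar>\<close>, which are
  submultiplicative under bounded translations and combine by addition of exponents.
\<close>

definition tempered :: "real measure \<Rightarrow> bool" where
  "tempered M \<longleftrightarrow> sets M = sets borel \<and> (\<exists>m::nat. (\<integral>\<^sup>+t. ennreal (1 / (1 + \<bar>t\<bar>) ^ m) \<partial>M) < \<infinity>)"

lemma one_plus_abs_pos: "(1 + \<bar>t\<bar> :: real) > 0" by simp

lemma tempered_sets: "tempered M \<Longrightarrow> sets M = sets borel"
  unfolding tempered_def by (rule conjunct1)

lemma tempered_PW_integrable:
  assumes "tempered M" "F \<in> PW a" "a > 0"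
  shows "integrable M (\<lambda>t. (1 + \<bar>t\<bar>) ^ k * (cmod (F (of_real t)))\<^sup>2)"
proof -
  obtain m where m: "(\<integral>\<^sup>+t. ennreal (1 / (1 + \<bar>t\<bar>) ^ m) \<partial>M) < \<infinity>"
    using assms(1) unfolding tempered_def by blast
  have [measurable_cong]: "sets M = sets borel" by (rule tempered_sets[OF assms(1)])
  have int: "integrable M (\<lambda>t. 1 / (1 + \<bar>t\<bar>) ^ m)"
    by (rule integrableI_nonneg) (use m in auto)
  obtain D where D: "D > 0" "\<And>t. cmod (F (of_real t)) \<le> D / (1 + \<bar>t\<bar>) ^ (k + m)"
    using PW_decay[OF assms(2,3)] by blast
  have "continuous_on UNIV (\<lambda>t. F (of_real t))"
    by (intro continuous_on_compose2[OF holomorphic_on_imp_continuous_on[OF PW_holomorphic[OF assms(2), of UNIV]]] continuous_intros) auto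
  then have [measurable]: "(\<lambda>t. F (complex_of_real t)) \<in> borel_measurable borel" by (rule borel_measurable_continuous_onI)
  have b: "(1 + \<bar>t\<bar>) ^ k * (cmod (F (of_real t)))\<^sup>2 \<le> D\<^sup>2 * (1 / (1 + \<bar>t\<bar>) ^ m)" for t
  proof -
    define s where "s = 1 + \<bar>t\<bar>"
    have s: "s \<ge> 1" by (simp add: s_def)
    have "(cmod (F (of_real t)))\<^sup>2 \<le> (D / s ^ (k + m))\<^sup>2"
      using D(2)[of t] by (intro power_mono) (auto simp: s_def)
    then have "s ^ k * (cmod (F (of_real t)))\<^sup>2 \<le> s ^ k * (D / s ^ (k + m))\<^sup>2"
      using s by (intro mult_left_mono) auto
    also have "\<dots> = D\<^sup>2 * (1 / s ^ m) * (1 / s ^ (k + m))"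
      using s by (simp add: power_divide power2_eq_square power_add field_simps)
    also have "\<dots> \<le> D\<^sup>2 * (1 / s ^ m) * 1"
      using s by (intro mult_left_mono) auto
    finally show ?thesis by (simp add: s_def)
  qed
  show ?thesis
  proof (rule Bochner_Integration.integrable_bound[OF integrable_mult_right[OF int, of "D\<^sup>2"]])
    show "(\<lambda>t. (1 + \<bar>t\<bar>) ^ k * (cmod (F (of_real t)))\<^sup>2) \<in> borel_measurable M" by measurable
    show "AE t in M. norm ((1 + \<bar>t\<bar>) ^ k * (cmod (F (of_real t)))\<^sup>2) \<le> norm (D\<^sup>2 * (1 / (1 + \<bar>t\<bar>) ^ m))"
      using b by (intro AE_I2) simp
  qed
qed

lemma PW_borel: "F \<in> PW a \<Longrightarrow> (\<lambda>t. F (of_real t)) \<in> borel_measurable (borel :: real measure)"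
  by (intro borel_measurable_continuous_onI continuous_on_compose2[OF holomorphic_on_imp_continuous_on[OF PW_holomorphic[of F a UNIV]]] continuous_intros) auto

lemma PW_L2:
  assumes "tempered M" "F \<in> PW a" "a > 0"
  shows "(\<lambda>t. F (of_real t)) \<in> L2 M"
proof -
  have "(\<lambda>t. F (of_real t)) \<in> borel_measurable M"
    using PW_borel[OF assms(2)] tempered_sets[OF assms(1)] by (simp cong: measurable_cong_sets)
  then show ?thesis
    using tempered_PW_integrable[OF assms, of 0] unfolding L2_def by simp
qed

lemma tempered_finite_interval:
  assumes "tempered M" shows "emeasure M {a<..b} < \<infinity>"
proof -
  obtain m where m: "(\<integral>\<^sup>+t. ennreal (1 / (1 + \<bar>t\<bar>) ^ m) \<partial>M) < \<infinity>"
    using assms(1) unfolding tempered_def by blast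
  have [measurable_cong]: "sets M = sets borel" by (rule tempered_sets[OF assms(1)])
  define r where "r = (1 + \<bar>a\<bar> + \<bar>b\<bar>) ^ m"
  have r: "r > 0" by (simp add: r_def add_pos_nonneg)
  have "emeasure M {a<..b} = (\<integral>\<^sup>+t. indicator {a<..b} t \<partial>M)" by simp
  also have "\<dots> \<le> (\<integral>\<^sup>+t. ennreal r * ennreal (1 / (1 + \<bar>t\<bar>) ^ m) \<partial>M)"
  proof (rule nn_integral_mono)
    fix t
    show "indicator {a<..b} t \<le> ennreal r * ennreal (1 / (1 + \<bar>t\<bar>) ^ m)"
    proof (cases "t \<in> {a<..b}")
      case True
      then have "(1 + \<bar>t\<bar>) ^ m \<le> r" unfolding r_def by (intro power_mono) auto
      then have "1 \<le> r * (1 / (1 + \<bar>t\<bar>) ^ m)" by (simp add: add_pos_nonneg)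
      then have "ennreal 1 \<le> ennreal (r * (1 / (1 + \<bar>t\<bar>) ^ m))" by (rule ennreal_leI)
      moreover have "ennreal r * ennreal (1 / (1 + \<bar>t\<bar>) ^ m) = ennreal (r * (1 / (1 + \<bar>t\<bar>) ^ m))"
        by (rule ennreal_mult[symmetric]) (use r in auto)
      ultimately show ?thesis using True by (simp only: indicator_simps ennreal_1)
    qed simp
  qed
  also have "\<dots> = ennreal r * (\<integral>\<^sup>+t. ennreal (1 / (1 + \<bar>t\<bar>) ^ m) \<partial>M)" by (rule nn_integral_cmult) measurable
  also have "\<dots> < \<infinity>" using m by (simp add: ennreal_mult_less_top)
  finally show ?thesis .
qed

lemma arctan_lipschitz: "\<bar>arctan a - arctan b\<bar> \<le> \<bar>a - b\<bar>"
proof -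
  have "norm (arctan a - arctan b) \<le> 1 * norm (a - b)"
  proof (rule field_differentiable_bound[of UNIV arctan "\<lambda>x. inverse (1 + x\<^sup>2)"])
    show "norm (inverse (1 + x\<^sup>2)) \<le> 1" for x :: real
      by (simp add: inverse_le_1_iff)
  qed (auto intro!: derivative_eq_intros)
  then show ?thesis by simp
qed

text \<open>
  A primitive of the Poisson kernel tends to a step function. Moving the centre by \<open>1 / n\<close>
  while the width shrinks like \<open>1 / n\<^sup>2\<close> makes the limit right at the jump as well, so
  that half-open intervals arise.
\<close>

lemma arctan_step_limit:
  "(\<lambda>n. arctan ((t - (a + 1 / real (Suc n))) / (1 / (real (Suc n))\<^sup>2))) \<longlonglongrightarrow> (if t > a then pi / 2 else - (pi / 2))"
proof -
  define c where "c = t - a"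
  have e: "(t - (a + 1 / real (Suc n))) / (1 / (real (Suc n))\<^sup>2) = c * (real n + 1)\<^sup>2 - (real n + 1)" for n
    by (simp add: c_def power2_eq_square field_simps)
  consider "c > 0" | "c = 0" | "c < 0" by linarith
  then show ?thesis
  proof cases
    case 1
    then have "filterlim (\<lambda>n. c * (real n + 1)\<^sup>2 - (real n + 1)) at_top sequentially" by real_asymp
    then show ?thesis unfolding e using 1 filterlim_compose[OF tendsto_arctan_at_top] by (simp add: c_def)
  next
    case 2
    have "filterlim (\<lambda>n. 0 * (real n + 1)\<^sup>2 - (real n + 1)) at_bot sequentially" by real_asymp
    then show ?thesis unfolding e using 2 filterlim_compose[OF tendsto_arctan_at_bot] by (simp add: c_def)
  next
    case 3
    then have "filterlim (\<lambda>n. c * (real n + 1)\<^sup>2 - (real n + 1)) at_bot sequentially" by real_asymp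
    then show ?thesis unfolding e using 3 filterlim_compose[OF tendsto_arctan_at_bot] by (simp add: c_def)
  qed
qed

context bounded_functional
begin

lemma L2_zero: "(\<lambda>t. 0) \<in> L2 M"
  unfolding L2_def by simp

lemma zero: "l (\<lambda>t. 0) = 0"
  using lin[OF L2_zero L2_zero, of 0 0] by simp

lemma scale: "F \<in> L2 M \<Longrightarrow> l (\<lambda>t. c * F t) = c * l F"
  using lin[of F F c 0] by simp

lemma diff: "F \<in> L2 M \<Longrightarrow> G \<in> L2 M \<Longrightarrow> l (\<lambda>t. F t - G t) = l F - l G"
  using lin[of F G 1 "-1"] by simp

text \<open>
  Dominated convergence holds in \<open>L2 M\<close>, and the functional is continuous.
\<close>

lemma dominated_limit:
  assumes W: "W \<in> L2 M" and meas: "\<And>n. G n \<in> L2 M"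
    and dom: "\<forall>\<^sub>F n in sequentially. \<forall>t. cmod (G n t) \<le> cmod (W t)"
    and lim: "\<And>t. (\<lambda>n. G n t) \<longlonglongrightarrow> H t"
  shows "H \<in> L2 M" "(\<lambda>n. l (G n)) \<longlonglongrightarrow> l H"
proof -
  have Hm: "H \<in> borel_measurable M"
    by (rule borel_measurable_LIMSEQ_metric[OF L2_D(1)[OF meas] lim])
  have HW: "cmod (H t) \<le> cmod (W t)" for t
    by (rule tendsto_upperbound[OF tendsto_norm[OF lim]]) (use dom in \<open>auto elim: eventually_mono\<close>)
  show HL: "H \<in> L2 M" by (rule L2_dominated[OF W Hm, of 1]) (use HW in simp)
  obtain n0 where n0: "\<And>n t. n \<ge> n0 \<Longrightarrow> cmod (G n t) \<le> cmod (W t)"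
    using dom unfolding eventually_sequentially by blast
  have "(\<lambda>n. LINT t|M. (cmod (G (n + n0) t - H t))\<^sup>2) \<longlonglongrightarrow> (LINT t|M. 0)"
  proof (rule integral_dominated_convergence[where w = "\<lambda>t. 4 * (cmod (W t))\<^sup>2"])
    show "(\<lambda>t. (cmod (G (n + n0) t - H t))\<^sup>2) \<in> borel_measurable M" for n
      by (rule borel_measurable_integrable[OF L2_D(2)[OF L2_diff[OF meas HL]]])
    show "integrable M (\<lambda>t. 4 * (cmod (W t))\<^sup>2)" by (intro integrable_mult_right L2_D(2) W)
    show "AE t in M. (\<lambda>n. (cmod (G (n + n0) t - H t))\<^sup>2) \<longlonglongrightarrow> 0"
    proof (rule AE_I2)
      fix t
      have "(\<lambda>n. (cmod (G (n + n0) t - H t))\<^sup>2) \<longlonglongrightarrow> (cmod (H t - H t))\<^sup>2"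
        by (intro tendsto_intros LIMSEQ_ignore_initial_segment lim)
      then show "(\<lambda>n. (cmod (G (n + n0) t - H t))\<^sup>2) \<longlonglongrightarrow> 0" by simp
    qed
    show "AE t in M. norm ((cmod (G (n + n0) t - H t))\<^sup>2) \<le> 4 * (cmod (W t))\<^sup>2" for n
    proof (rule AE_I2)
      fix t
      have "cmod (G (n + n0) t - H t) \<le> 2 * cmod (W t)"
        using norm_triangle_ineq4[of "G (n + n0) t" "H t"] n0[of "n + n0" t] HW[of t] by simp
      then have "(cmod (G (n + n0) t - H t))\<^sup>2 \<le> (2 * cmod (W t))\<^sup>2" by (intro power_mono) auto
      then show "norm ((cmod (G (n + n0) t - H t))\<^sup>2) \<le> 4 * (cmod (W t))\<^sup>2"
        by (simp add: power_mult_distrib)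
    qed
  qed simp
  then have "(\<lambda>n. sqrt (LINT t|M. (cmod (G (n + n0) t - H t))\<^sup>2)) \<longlonglongrightarrow> sqrt 0"
    by (intro tendsto_intros) simp
  then have "(\<lambda>n. L2_norm M (\<lambda>t. G (n + n0) t - H t)) \<longlonglongrightarrow> 0" unfolding L2_norm_def by simp
  then have *: "(\<lambda>n. C * L2_norm M (\<lambda>t. G (n + n0) t - H t)) \<longlonglongrightarrow> 0"
    using tendsto_mult_right_zero by blast
  have "(\<lambda>n. l (G (n + n0)) - l H) \<longlonglongrightarrow> 0"
  proof (rule Lim_null_comparison[OF _ *])
    show "\<forall>\<^sub>F n in sequentially. norm (l (G (n + n0)) - l H) \<le> C * L2_norm M (\<lambda>t. G (n + n0) t - H t)"
      using bound[OF L2_diff[OF meas HL]] unfolding diff[OF meas HL] by (intro always_eventually) simp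
  qed
  then have "(\<lambda>n. l (G (n + n0))) \<longlonglongrightarrow> l H" by (rule LIM_zero_cancel)
  then show "(\<lambda>n. l (G n)) \<longlonglongrightarrow> l H" by (rule LIMSEQ_offset)
qed

lemma cauchy_kernel_L2:
  assumes "G \<in> L2 M" "Im z \<noteq> 0"
  shows "(\<lambda>t. G t / (of_real t - z)) \<in> L2 M"
    "L2_norm M (\<lambda>t. G t / (of_real t - z)) \<le> 1 / \<bar>Im z\<bar> * L2_norm M G"
proof -
  have m: "(\<lambda>t. G t / (of_real t - z)) \<in> borel_measurable M"
    using L2_D(1)[OF assms(1)] by measurable
  have b: "cmod (G t / (of_real t - z)) \<le> 1 / \<bar>Im z\<bar> * cmod (G t)" for t
  proof -
    have "\<bar>Im z\<bar> \<le> cmod (of_real t - z)" using abs_Im_le_cmod[of "of_real t - z"] by simp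
    then have "cmod (G t) / cmod (of_real t - z) \<le> cmod (G t) / \<bar>Im z\<bar>"
      using assms(2) by (intro frac_le) auto
    then show ?thesis by (simp add: norm_divide)
  qed
  show "(\<lambda>t. G t / (of_real t - z)) \<in> L2 M" by (rule L2_dominated[OF assms(1) m b])
  show "L2_norm M (\<lambda>t. G t / (of_real t - z)) \<le> 1 / \<bar>Im z\<bar> * L2_norm M G"
    by (rule L2_norm_mono[OF assms(1) m b]) simp
qed

definition cauchy :: "(real \<Rightarrow> complex) \<Rightarrow> complex \<Rightarrow> complex" where
  "cauchy G z = l (\<lambda>t. G t / (of_real t - z))"

lemma cauchy_bound:
  assumes "G \<in> L2 M" "Im z \<noteq> 0"
  shows "cmod (cauchy G z) \<le> C * L2_norm M G / \<bar>Im z\<bar>"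
proof -
  have "cmod (cauchy G z) \<le> C * L2_norm M (\<lambda>t. G t / (of_real t - z))"
    unfolding cauchy_def by (rule bound[OF cauchy_kernel_L2(1)[OF assms]])
  also have "\<dots> \<le> C * (1 / \<bar>Im z\<bar> * L2_norm M G)"
    by (rule mult_left_mono[OF cauchy_kernel_L2(2)[OF assms] C_nonneg])
  finally show ?thesis by simp
qed

text \<open>
  The difference quotients of the Cauchy kernel are dominated by a multiple of the kernel itself.
\<close>

lemma cauchy_derivative:
  assumes G: "G \<in> L2 M" and z: "Im z \<noteq> 0"
  shows "(cauchy G has_field_derivative l (\<lambda>t. G t / (of_real t - z) / (of_real t - z))) (at z)"
  unfolding DERIV_def tendsto_at_iff_sequentially
proof (intro allI impI)
  fix X :: "nat \<Rightarrow> complex"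
  assume X0: "\<forall>i. X i \<in> UNIV - {0}" and X: "X \<longlonglongrightarrow> 0"
  define y where "y = \<bar>Im z\<bar> / 2"
  have y: "y > 0" using z by (simp add: y_def)
  have ev: "\<forall>\<^sub>F i in sequentially. cmod (X i) < y"
    using tendstoD[OF X y] by simp
  then obtain n0 where n0: "\<And>i. i \<ge> n0 \<Longrightarrow> cmod (X i) < y" unfolding eventually_sequentially by blast
  define Y where "Y i = X (i + n0)" for i
  have Y: "Y \<longlonglongrightarrow> 0" unfolding Y_def by (rule LIMSEQ_ignore_initial_segment[OF X])
  have Y0: "Y i \<noteq> 0" "cmod (Y i) < y" for i using X0 n0 by (auto simp: Y_def)
  have ImY: "\<bar>Im (z + Y i)\<bar> > y" for i
    using Y0(2)[of i] abs_Im_le_cmod[of "Y i"] by (simp add: y_def abs_if split: if_splits)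
  have tz: "cmod (of_real t - w) \<ge> \<bar>Im w\<bar>" for t w using abs_Im_le_cmod[of "of_real t - w"] by simp
  have ne: "of_real t - z \<noteq> 0" "of_real t - (z + Y i) \<noteq> 0" for t i
    using tz[where w = z and t = t] tz[where w = "z + Y i" and t = t] z ImY[of i] y by auto
  define K where "K i t = G t / (of_real t - z) / (of_real t - (z + Y i))" for i t
  have KL: "K i \<in> L2 M" for i
    unfolding K_def[abs_def] by (intro cauchy_kernel_L2(1) G z) (use ImY[of i] y in auto)
  have q: "(cauchy G (z + Y i) - cauchy G z) / Y i = l (K i)" for i
  proof -
    have I: "Im (z + Y i) \<noteq> 0" using ImY[of i] y by auto
    have "cauchy G (z + Y i) - cauchy G z = l (\<lambda>t. G t / (of_real t - (z + Y i)) - G t / (of_real t - z))"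
      unfolding cauchy_def by (rule diff[symmetric]) (intro cauchy_kernel_L2(1) G z I)+
    also have "(\<lambda>t. G t / (of_real t - (z + Y i)) - G t / (of_real t - z)) = (\<lambda>t. Y i * K i t)"
    proof
      fix t
      have "g / (s - w) - g / s = w * (g / s / (s - w))" if "s \<noteq> 0" "s - w \<noteq> 0" for g s w :: complex
        using that by (simp add: field_simps)
      from this[OF ne(1)[of t], of "Y i" "G t"] ne(2)[of t i]
      show "G t / (of_real t - (z + Y i)) - G t / (of_real t - z) = Y i * K i t"
        by (simp add: K_def diff_diff_eq)
    qed
    also have "l (\<lambda>t. Y i * K i t) = Y i * l (K i)" by (rule scale[OF KL])
    finally show ?thesis using Y0 by simp
  qed
  have "(\<lambda>i. l (K i)) \<longlonglongrightarrow> l (\<lambda>t. G t / (of_real t - z) / (of_real t - z))"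
  proof (rule dominated_limit(2))
    show "(\<lambda>t. of_real (1 / y) * (G t / (of_real t - z))) \<in> L2 M"
      by (intro L2_scale cauchy_kernel_L2(1) G z)
    show "K i \<in> L2 M" for i by (rule KL)
    have "cmod (K i t) \<le> cmod (of_real (1 / y) * (G t / (of_real t - z)))" for i t
    proof -
      have "cmod (K i t) = cmod (G t / (of_real t - z)) / cmod (of_real t - (z + Y i))"
        unfolding K_def by (rule norm_divide)
      also have "\<dots> \<le> cmod (G t / (of_real t - z)) / y"
        using tz[where w = "z + Y i" and t = t] ImY[of i] y by (intro frac_le) auto
      also have "\<dots> = cmod (of_real (1 / y) * (G t / (of_real t - z)))"
        using y by (simp add: norm_mult norm_divide)
      finally show ?thesis .
    qed
    then show "\<forall>\<^sub>F i in sequentially. \<forall>t. cmod (K i t) \<le> cmod (of_real (1 / y) * (G t / (of_real t - z)))"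
      by (intro always_eventually allI)
    fix t
    have "(\<lambda>i. G t / (of_real t - z) / (of_real t - (z + Y i))) \<longlonglongrightarrow> G t / (of_real t - z) / (of_real t - (z + 0))"
      by (intro tendsto_intros Y) (use ne in simp)
    then show "(\<lambda>i. K i t) \<longlonglongrightarrow> G t / (of_real t - z) / (of_real t - z)" by (simp add: K_def)
  qed
  then have "(\<lambda>i. ((\<lambda>h. (cauchy G (z + h) - cauchy G z) / h) \<circ> X) (i + n0)) \<longlonglongrightarrow> l (\<lambda>t. G t / (of_real t - z) / (of_real t - z))"
    unfolding q[symmetric] by (simp add: Y_def)
  then show "((\<lambda>h. (cauchy G (z + h) - cauchy G z) / h) \<circ> X) \<longlonglongrightarrow> l (\<lambda>t. G t / (of_real t - z) / (of_real t - z))"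
    by (rule LIMSEQ_offset)
qed

lemma cauchy_holomorphic: "G \<in> L2 M \<Longrightarrow> cauchy G holomorphic_on {z. Im z > 0}"
  unfolding holomorphic_on_def field_differentiable_def
  by (intro ballI exI, rule has_field_derivative_at_within, rule cauchy_derivative) auto

end

section \<open>A functional is determined by its Cauchy transforms\<close>

context bounded_functional
begin

lemma poisson_zero:
  assumes G: "G \<in> L2 M" and zero: "\<And>z. Im z \<noteq> 0 \<Longrightarrow> cauchy G z = 0" and "y > 0"
  shows "(\<lambda>t. G t * of_real (poisson x y t)) \<in> L2 M" "l (\<lambda>t. G t * of_real (poisson x y t)) = 0"
proof -
  let ?w = "Complex x y"
  have I: "Im ?w \<noteq> 0" "Im (cnj ?w) \<noteq> 0" using \<open>y > 0\<close> by auto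
  have eq: "(\<lambda>t. G t * of_real (poisson x y t)) = (\<lambda>t. 1 / (2 * \<i>) * (G t / (of_real t - ?w)) + - (1 / (2 * \<i>)) * (G t / (of_real t - cnj ?w)))"
  proof
    fix t
    define u where "u = of_real t - ?w"
    have u: "u \<noteq> 0" using \<open>y > 0\<close> by (auto simp: u_def complex_eq_iff)
    have c: "of_real t - cnj ?w = cnj u" by (simp add: u_def)
    have uu: "u * cnj u = of_real ((t - x)\<^sup>2 + y\<^sup>2)"
      by (simp add: u_def complex_eq_iff power2_eq_square)
    have "cnj u - u = 2 * \<i> * of_real y" by (simp add: u_def complex_eq_iff)
    moreover have "1 / a - 1 / b = (b - a) / (a * b)" if "a \<noteq> 0" "b \<noteq> 0" for a b :: complex
      using that by (simp add: field_simps)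
    from this[of u "cnj u"] u have "1 / u - 1 / cnj u = (cnj u - u) / (u * cnj u)" by simp
    ultimately have "1 / u - 1 / cnj u = 2 * \<i> * of_real y / (u * cnj u)" by (simp only:)
    then have "1 / (2 * \<i>) * (1 / u - 1 / cnj u) = of_real (poisson x y t)"
      unfolding uu by (simp add: poisson_def)
    then have "G t * of_real (poisson x y t) = G t * (1 / (2 * \<i>) * (1 / u - 1 / cnj u))" by (simp only:)
    also have "\<dots> = 1 / (2 * \<i>) * (G t / u) + - (1 / (2 * \<i>)) * (G t / cnj u)"
      by (simp add: field_simps)
    finally show "G t * of_real (poisson x y t) = 1 / (2 * \<i>) * (G t / (of_real t - ?w)) + - (1 / (2 * \<i>)) * (G t / (of_real t - cnj ?w))"
      unfolding c u_def .
  qed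
  show "(\<lambda>t. G t * of_real (poisson x y t)) \<in> L2 M"
    unfolding eq by (rule L2_lin[OF cauchy_kernel_L2(1)[OF G I(1)] cauchy_kernel_L2(1)[OF G I(2)]])
  have "l (\<lambda>t. G t * of_real (poisson x y t)) = 1 / (2 * \<i>) * cauchy G ?w + - (1 / (2 * \<i>)) * cauchy G (cnj ?w)"
    unfolding eq cauchy_def by (rule lin[OF cauchy_kernel_L2(1)[OF G I(1)] cauchy_kernel_L2(1)[OF G I(2)]])
  then show "l (\<lambda>t. G t * of_real (poisson x y t)) = 0"
    using zero[OF I(1)] zero[OF I(2)] by simp
qed

lemma arctan_L2:
  assumes G: "G \<in> L2 M" and "y > 0"
  shows "(\<lambda>t. G t * of_real (arctan ((t - x) / y))) \<in> L2 M"
proof (rule L2_dominated[OF G, of _ "pi / 2"])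
  have [measurable]: "(\<lambda>t. arctan ((t - x) / y)) \<in> borel_measurable borel"
    using \<open>y > 0\<close> by (intro borel_measurable_continuous_onI continuous_intros) simp
  show "(\<lambda>t. G t * of_real (arctan ((t - x) / y))) \<in> borel_measurable M"
    using L2_D(1)[OF G] by measurable
  show "cmod (G t * of_real (arctan ((t - x) / y))) \<le> pi / 2 * cmod (G t)" for t
  proof -
    have "\<bar>arctan ((t - x) / y)\<bar> \<le> pi / 2" using arctan_bounded[of "(t - x) / y"] by linarith
    then have "\<bar>arctan ((t - x) / y)\<bar> * cmod (G t) \<le> pi / 2 * cmod (G t)" by (rule mult_right_mono) simp
    then show ?thesis by (simp add: norm_mult mult.commute)
  qed
qed

text \<open>
  The derivative of \<open>arctan ((t - x) / y)\<close> in \<open>x\<close> is minus the Poisson kernel, a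
  linear combination of two Cauchy kernels.
\<close>

lemma arctan_constant:
  assumes G: "G \<in> L2 M" and zero: "\<And>z. Im z \<noteq> 0 \<Longrightarrow> cauchy G z = 0" and "y > 0"
  shows "l (\<lambda>t. G t * of_real (arctan ((t - a) / y))) = l (\<lambda>t. G t * of_real (arctan ((t - b) / y)))"
proof -
  define v where "v x = l (\<lambda>t. G t * of_real (arctan ((t - x) / y)))" for x
  have "(v has_derivative (\<lambda>h. 0)) (at x)" for x
    unfolding has_derivative_at
  proof (intro conjI bounded_linear_zero, unfold tendsto_at_iff_sequentially, intro allI impI)
    fix X :: "nat \<Rightarrow> real" assume X0: "\<forall>i. X i \<in> UNIV - {0}" and X: "X \<longlonglongrightarrow> 0"
    define q where "q i t = (arctan ((t - (x + X i)) / y) - arctan ((t - x) / y)) / X i" for i t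
    have X0': "X i \<noteq> 0" for i using X0 by auto
    have qb: "\<bar>q i t\<bar> \<le> 1 / y" for i t
    proof -
      have "\<bar>arctan ((t - (x + X i)) / y) - arctan ((t - x) / y)\<bar> \<le> \<bar>(t - (x + X i)) / y - (t - x) / y\<bar>"
        by (rule arctan_lipschitz)
      also have "(t - (x + X i)) / y - (t - x) / y = - (X i / y)" using \<open>y > 0\<close> by (simp add: field_simps)
      finally have "\<bar>q i t\<bar> \<le> \<bar>X i / y\<bar> / \<bar>X i\<bar>"
        unfolding q_def abs_divide[of _ "X i"] by (intro divide_right_mono) auto
      also have "\<dots> = 1 / y" using X0'[of i] \<open>y > 0\<close> by (simp add: abs_divide)
      finally show ?thesis .
    qed
    have qL: "(\<lambda>t. G t * of_real (q i t)) = (\<lambda>t. of_real (1 / X i) * (G t * of_real (arctan ((t - (x + X i)) / y)))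
        + - of_real (1 / X i) * (G t * of_real (arctan ((t - x) / y))))" for i
      using X0'[of i] by (auto simp: q_def fun_eq_iff field_simps)
    have lq: "l (\<lambda>t. G t * of_real (q i t)) = of_real (1 / X i) * (v (x + X i) - v x)" for i
      unfolding qL v_def lin[OF arctan_L2[OF G \<open>y > 0\<close>] arctan_L2[OF G \<open>y > 0\<close>]] by (simp add: algebra_simps)
    have "(\<lambda>i. l (\<lambda>t. G t * of_real (q i t))) \<longlonglongrightarrow> l (\<lambda>t. - 1 * (G t * of_real (poisson x y t)))"
    proof (rule dominated_limit(2))
      show "(\<lambda>t. of_real (1 / y) * G t) \<in> L2 M" by (rule L2_scale[OF G])
      show "(\<lambda>t. G t * of_real (q i t)) \<in> L2 M" for i
        unfolding qL by (intro L2_lin arctan_L2 G \<open>y > 0\<close>)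
      have "cmod (G t * of_real (q i t)) \<le> cmod (of_real (1 / y) * G t)" for i t
      proof -
        have "cmod (G t) * \<bar>q i t\<bar> \<le> cmod (G t) * (1 / y)" by (intro mult_left_mono qb) simp
        then show ?thesis using \<open>y > 0\<close> by (simp add: norm_mult norm_divide)
      qed
      then show "\<forall>\<^sub>F i in sequentially. \<forall>t. cmod (G t * of_real (q i t)) \<le> cmod (of_real (1 / y) * G t)"
        by (intro always_eventually allI)
      fix t
      have eq: "- (inverse (1 + ((t - x) / y)\<^sup>2) * (1 / y)) = - poisson x y t"
      proof -
        have "1 + ((t - x) / y)\<^sup>2 = ((t - x)\<^sup>2 + y\<^sup>2) / y\<^sup>2" using \<open>y > 0\<close> by (simp add: power_divide field_simps)
        then show ?thesis using \<open>y > 0\<close> by (simp add: poisson_def field_simps power2_eq_square)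
      qed
      have "((\<lambda>s. arctan ((t - s) / y)) has_real_derivative - (inverse (1 + ((t - x) / y)\<^sup>2) * (1 / y))) (at x)"
        using \<open>y > 0\<close> by (auto intro!: derivative_eq_intros)
      then have "((\<lambda>h. (arctan ((t - (x + h)) / y) - arctan ((t - x) / y)) / h) \<longlongrightarrow> - poisson x y t) (at 0)"
        unfolding eq DERIV_def .
      then have "((\<lambda>h. (arctan ((t - (x + h)) / y) - arctan ((t - x) / y)) / h) \<circ> X) \<longlonglongrightarrow> - poisson x y t"
        using X X0 unfolding tendsto_at_iff_sequentially by blast
      then have "(\<lambda>i. q i t) \<longlonglongrightarrow> - poisson x y t" by (simp add: q_def o_def)
      then have "(\<lambda>i. G t * of_real (q i t)) \<longlonglongrightarrow> G t * of_real (- poisson x y t)"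
        by (intro tendsto_intros)
      then show "(\<lambda>i. G t * of_real (q i t)) \<longlonglongrightarrow> - 1 * (G t * of_real (poisson x y t))" by simp
    qed
    also have "l (\<lambda>t. - 1 * (G t * of_real (poisson x y t))) = 0"
      using scale[OF poisson_zero(1)[OF G zero \<open>y > 0\<close>, of x], of "- 1"] poisson_zero(2)[OF G zero \<open>y > 0\<close>, of x] by simp
    finally have "(\<lambda>i. norm (l (\<lambda>t. G t * of_real (q i t)))) \<longlonglongrightarrow> 0" by (rule tendsto_norm_zero)
    moreover have "norm (l (\<lambda>t. G t * of_real (q i t))) = ((\<lambda>h. norm (v (x + h) - v x - 0) / norm h) \<circ> X) i" for i
      unfolding lq by (simp add: norm_mult norm_divide)
    ultimately show "((\<lambda>h. norm (v (x + h) - v x - 0) / norm h) \<circ> X) \<longlonglongrightarrow> 0"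
      by (simp add: o_def)
  qed
  then have "\<exists>c. \<forall>x\<in>UNIV. v x = c"
    by (intro has_derivative_zero_constant) (auto intro: has_derivative_at_withinI)
  then show ?thesis unfolding v_def by (metis UNIV_I)
qed

lemma interval_zero:
  assumes G: "G \<in> L2 M" and zero: "\<And>z. Im z \<noteq> 0 \<Longrightarrow> cauchy G z = 0" and "a \<le> b"
  shows "(\<lambda>t. G t * indicator {a<..b} t) \<in> L2 M" "l (\<lambda>t. G t * indicator {a<..b} t) = 0"
proof -
  define k where "k c n t = arctan ((t - (c + 1 / real (Suc n))) / (1 / (real (Suc n))\<^sup>2))" for c n t
  define H where "H n t = 1 * (G t * of_real (k a n t)) + (-1) * (G t * of_real (k b n t))" for n t
  have kL: "(\<lambda>t. G t * of_real (k c n t)) \<in> L2 M" for c n unfolding k_def by (rule arctan_L2[OF G]) simp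
  have y: "1 / (real (Suc n))\<^sup>2 > 0" for n by simp
  have Hz: "l (H n) = 0" for n
  proof -
    have "l (H n) = 1 * l (\<lambda>t. G t * of_real (k a n t)) + (-1) * l (\<lambda>t. G t * of_real (k b n t))"
      unfolding H_def by (rule lin[OF kL kL])
    moreover have "l (\<lambda>t. G t * of_real (k a n t)) = l (\<lambda>t. G t * of_real (k b n t))"
      unfolding k_def by (rule arctan_constant[OF G zero y])
    ultimately show ?thesis by simp
  qed
  have 1: "(\<lambda>t. of_real pi * G t) \<in> L2 M" by (rule L2_scale[OF G])
  have 2: "H n \<in> L2 M" for n unfolding H_def by (rule L2_lin[OF kL kL])
  have "cmod (H n t) \<le> cmod (of_real pi * G t)" for n t
  proof -
    have "\<bar>k a n t - k b n t\<bar> \<le> pi" using arctan_bounded unfolding k_def by (smt (verit) field_sum_of_halves)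
    then have "cmod (G t) * \<bar>k a n t - k b n t\<bar> \<le> cmod (G t) * pi" by (rule mult_left_mono) simp
    moreover have "H n t = G t * of_real (k a n t - k b n t)" by (simp add: H_def algebra_simps)
    ultimately show ?thesis by (simp only: norm_mult norm_of_real) (simp add: mult.commute)
  qed
  then have 3: "\<forall>\<^sub>F n in sequentially. \<forall>t. cmod (H n t) \<le> cmod (of_real pi * G t)"
    by (intro always_eventually allI)
  have "(\<lambda>n. k c n t) \<longlonglongrightarrow> (if t > c then pi / 2 else - (pi / 2))" for c t
    unfolding k_def by (rule arctan_step_limit)
  then have "(\<lambda>n. H n t) \<longlonglongrightarrow> 1 * (G t * of_real (if t > a then pi / 2 else - (pi / 2))) + (-1) * (G t * of_real (if t > b then pi / 2 else - (pi / 2)))" for t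
    unfolding H_def by (intro tendsto_intros)
  moreover have "1 * (G t * of_real (if t > a then pi / 2 else - (pi / 2))) + (-1) * (G t * of_real (if t > b then pi / 2 else - (pi / 2))) = of_real pi * (G t * indicator {a<..b} t)" for t
    using \<open>a \<le> b\<close> by (auto simp: indicator_def)
  ultimately have 4: "(\<lambda>n. H n t) \<longlonglongrightarrow> of_real pi * (G t * indicator {a<..b} t)" for t by simp
  note DL = dominated_limit[OF 1 2 3 4]
  have *: "(\<lambda>t. of_real pi * (G t * indicator {a<..b} t)) \<in> L2 M" "l (\<lambda>t. of_real pi * (G t * indicator {a<..b} t)) = 0"
    using DL Hz by (simp_all add: LIMSEQ_const_iff)
  have eq: "(\<lambda>t. G t * indicator {a<..b} t) = (\<lambda>t. of_real (1 / pi) * (of_real pi * (G t * indicator {a<..b} t)))"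
    by (simp add: fun_eq_iff)
  show "(\<lambda>t. G t * indicator {a<..b} t) \<in> L2 M" by (subst eq, rule L2_scale[OF *(1)])
  show "l (\<lambda>t. G t * indicator {a<..b} t) = 0" by (subst eq, subst scale[OF *(1)], simp add: *(2))
qed

lemma indicator_L2:
  assumes "A \<in> sets borel" "A \<subseteq> {a<..b}" "emeasure M {a<..b} < \<infinity>"
  shows "(indicator A :: real \<Rightarrow> complex) \<in> L2 M"
proof -
  have [measurable]: "A \<in> sets M" using assms(1) sets_M by simp
  have "emeasure M A < \<infinity>"
    using emeasure_mono[OF assms(2), of M] sets_M assms(3) by (simp add: le_less_trans)
  then have "integrable M (indicator A :: real \<Rightarrow> real)" by simp
  moreover have "(\<lambda>t. (cmod (indicator A t))\<^sup>2) = (indicator A :: real \<Rightarrow> real)" by (auto simp: indicator_def fun_eq_iff)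
  ultimately show ?thesis unfolding L2_def by simp
qed

text \<open>
  The sets whose indicators are annihilated form a Dynkin system that contains the half-lines.
\<close>

lemma borel_sets_zero:
  assumes fin: "\<And>a b. emeasure M {a<..b} < \<infinity>" and "a \<le> b"
    and int0: "\<And>c d. c \<le> d \<Longrightarrow> l (indicator {c<..d}) = 0" and A: "A \<in> sets borel"
  shows "l (indicator (A \<inter> {a<..b})) = 0"
proof -
  have Asig: "A \<in> sigma_sets UNIV (range (\<lambda>a::real. {..a}))"
    using A unfolding borel_eq_atMost by (simp add: image_def)
  have stable: "Int_stable (range (\<lambda>a::real. {..a}))"
    by (auto simp: Int_stable_def)
  have closed: "range (\<lambda>a::real. {..a}) \<subseteq> Pow UNIV" by simp
  have bor: "B \<in> sets borel" if "B \<in> sigma_sets UNIV (range (\<lambda>a::real. {..a}))" for B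
    using that unfolding borel_eq_atMost by (simp add: image_def)
  have L: "(indicator (B \<inter> {a<..b}) :: real \<Rightarrow> complex) \<in> L2 M" if "B \<in> sets borel" for B
    by (rule indicator_L2[OF _ _ fin[of a b]]) (use that in auto)
  show ?thesis
    using stable closed Asig
  proof (induction rule: sigma_sets_induct_disjoint)
    case (basic B)
    then obtain q where B: "B = {..q}" by auto
    show ?case
    proof (cases "min q b \<ge> a")
      case True
      have "B \<inter> {a<..b} = {a<..min q b}" unfolding B by auto
      then show ?thesis using int0[OF True] by simp
    next
      case False
      then have "B \<inter> {a<..b} = {}" using \<open>a \<le> b\<close> unfolding B by auto
      then show ?thesis using zero by (simp add: indicator_def)
    qed
  next
    case empty
    show ?case using zero by (simp add: indicator_def)
  next
    case (compl B)
    have "indicator ((UNIV - B) \<inter> {a<..b}) = (\<lambda>t. indicator (UNIV \<inter> {a<..b}) t - indicator (B \<inter> {a<..b}) t :: complex)"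
      by (auto simp: indicator_def fun_eq_iff)
    then have "l (indicator ((UNIV - B) \<inter> {a<..b})) = l (indicator (UNIV \<inter> {a<..b})) - l (indicator (B \<inter> {a<..b}))"
      using diff[OF L L[OF bor[OF compl(1)]], of UNIV] by simp
    then show ?case using compl int0[OF \<open>a \<le> b\<close>] by simp
  next
    case (union B)
    have Bb: "B i \<in> sets borel" for i using union(2) bor by blast
    have 0: "l (indicator ((\<Union>i<n. B i) \<inter> {a<..b})) = 0" for n
    proof (induction n)
      case 0
      show ?case using zero by (simp add: indicator_def)
    next
      case (Suc n)
      have U: "(\<Union>i<n. B i) \<in> sets borel" using Bb by auto
      have "x \<notin> B n" if "x \<in> B i" "i < n" for x i
      proof -
        have "B i \<inter> B n = {}" by (rule disjoint_family_onD[OF union(1)]) (use that in auto)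
        then show ?thesis using that by blast
      qed
      then have "indicator ((\<Union>i<Suc n. B i) \<inter> {a<..b}) = (\<lambda>t. 1 * indicator ((\<Union>i<n. B i) \<inter> {a<..b}) t + 1 * indicator (B n \<inter> {a<..b}) t :: complex)"
        by (auto simp: indicator_def fun_eq_iff less_Suc_eq)
      then have "l (indicator ((\<Union>i<Suc n. B i) \<inter> {a<..b})) = 1 * l (indicator ((\<Union>i<n. B i) \<inter> {a<..b})) + 1 * l (indicator (B n \<inter> {a<..b}))"
        using lin[OF L[OF U] L[OF Bb], of 1 1 n] by simp
      then show ?case using Suc union(3)[of n] by simp
    qed
    have "(\<lambda>n. l (indicator ((\<Union>i<n. B i) \<inter> {a<..b}))) \<longlonglongrightarrow> l (indicator ((\<Union>i. B i) \<inter> {a<..b}))"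
    proof (rule dominated_limit(2)[where W = "indicator (UNIV \<inter> {a<..b})"])
      show "(indicator (UNIV \<inter> {a<..b}) :: real \<Rightarrow> complex) \<in> L2 M" by (rule L) simp
      show "(indicator ((\<Union>i<n. B i) \<inter> {a<..b}) :: real \<Rightarrow> complex) \<in> L2 M" for n
        by (rule L) (use Bb in auto)
      show "\<forall>\<^sub>F n in sequentially. \<forall>t. cmod (indicator ((\<Union>i<n. B i) \<inter> {a<..b}) t) \<le> cmod (indicator (UNIV \<inter> {a<..b}) t)"
        by (intro always_eventually allI) (auto simp: indicator_def)
      show "(\<lambda>n. indicator ((\<Union>i<n. B i) \<inter> {a<..b}) t) \<longlonglongrightarrow> (indicator ((\<Union>i. B i) \<inter> {a<..b}) t :: complex)" for t
      proof (cases "t \<in> (\<Union>i. B i)")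
        case True
        then obtain i where i: "t \<in> B i" by blast
        show ?thesis
          by (rule tendsto_eventually, rule eventually_sequentiallyI[of "Suc i"]) (use i in \<open>auto simp: indicator_def\<close>)
      next
        case False
        then show ?thesis by (auto simp: indicator_def)
      qed
    qed
    then show ?case unfolding 0 LIMSEQ_const_iff by (rule sym)
  qed
qed

lemma sum_zero:
  assumes "finite A" "\<And>i. i \<in> A \<Longrightarrow> f i \<in> L2 M \<and> l (f i) = 0"
  shows "(\<lambda>t. \<Sum>i\<in>A. c i * f i t) \<in> L2 M \<and> l (\<lambda>t. \<Sum>i\<in>A. c i * f i t) = 0"
  using assms
proof (induction A)
  case empty
  show ?case using zero L2_zero by simp
next
  case (insert x A)
  then have IH: "(\<lambda>t. \<Sum>i\<in>A. c i * f i t) \<in> L2 M" "l (\<lambda>t. \<Sum>i\<in>A. c i * f i t) = 0" "f x \<in> L2 M" "l (f x) = 0" by auto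
  show ?case
    using L2_lin[OF IH(3,1), of "c x" 1] lin[OF IH(3,1), of "c x" 1] IH insert(1,2) by simp
qed

text \<open>
  The functions \<open>p k\<close> stand in for the constant \<open>1\<close>, which need not be square
  integrable; letting \<open>k\<close> tend to infinity removes them. Then the functional vanishes on
  indicators of bounded intervals, of bounded Borel sets, on simple functions of bounded support, and
  finally on all of \<open>L2 M\<close>.
\<close>

lemma vanishing:
  assumes fin: "\<And>a b. emeasure M {a<..b} < \<infinity>"
    and p: "\<And>k. p k \<in> L2 M" "\<And>k t. cmod (p k t) \<le> 1" "\<And>t. (\<lambda>k. p k t) \<longlonglongrightarrow> 1"
    and zero_p: "\<And>k z. Im z \<noteq> 0 \<Longrightarrow> cauchy (p k) z = 0" and G: "G \<in> L2 M"
  shows "l G = 0"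
proof -
  have int0: "l (indicator {c<..d}) = 0" if "c \<le> d" for c d
  proof -
    have "(\<lambda>k. l (\<lambda>t. p k t * indicator {c<..d} t)) \<longlonglongrightarrow> l (indicator {c<..d})"
    proof (rule dominated_limit(2)[where W = "indicator {c<..d}"])
      show "(indicator {c<..d} :: real \<Rightarrow> complex) \<in> L2 M" by (rule indicator_L2[OF _ _ fin[of c d]]) auto
      show "(\<lambda>t. p k t * indicator {c<..d} t) \<in> L2 M" for k by (rule interval_zero(1)[OF p(1) zero_p that])
      show "\<forall>\<^sub>F k in sequentially. \<forall>t. cmod (p k t * indicator {c<..d} t) \<le> cmod (indicator {c<..d} t)"
        using p(2) by (intro always_eventually allI) (auto simp: indicator_def)
      show "(\<lambda>k. p k t * indicator {c<..d} t) \<longlonglongrightarrow> indicator {c<..d} t" for t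
        using tendsto_mult[OF p(3)[of t] tendsto_const[of "indicator {c<..d} t"]] by simp
    qed
    moreover have "l (\<lambda>t. p k t * indicator {c<..d} t) = 0" for k
      by (rule interval_zero(2)[OF p(1) zero_p that])
    ultimately show ?thesis by (simp add: LIMSEQ_const_iff)
  qed
  obtain s where s': "\<forall>i. simple_function M (s i)" "\<forall>t\<in>space M. (\<lambda>i. s i t) \<longlonglongrightarrow> G t"
    "\<forall>i. \<forall>t\<in>space M. dist (s i t) 0 \<le> 2 * dist (G t) 0"
    using borel_measurable_implies_sequence_metric[OF L2_D(1)[OF G], of 0] by blast
  note s = s'(1)[rule_format] s'(2)[rule_format] s'(3)[rule_format]
  have sp: "space M = UNIV" using sets_eq_imp_space_eq[OF sets_M] by simp
  define I where "I n = {- real n<..real n}" for n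
  define H where "H n t = (\<Sum>y\<in>range (s n). y * indicator (s n -` {y} \<inter> I n) t)" for n t
  have fr: "finite (range (s n))" for n using simple_functionD(1)[OF s(1)] sp by simp
  have Heq: "H n t = s n t * indicator (I n) t" for n t
  proof -
    have "H n t = (\<Sum>y\<in>range (s n). if y = s n t then y * indicator (I n) t else 0)"
      unfolding H_def by (rule sum.cong) (auto simp: indicator_def)
    then show ?thesis using fr by simp
  qed
  have H: "H n \<in> L2 M" "l (H n) = 0" for n
  proof -
    have b: "s n -` {y} \<in> sets borel" for y
      using simple_functionD(2)[OF s(1), of n "{y}"] sp sets_M by simp
    have "(\<lambda>t. \<Sum>y\<in>range (s n). y * indicator (s n -` {y} \<inter> I n) t) \<in> L2 M \<and> l (\<lambda>t. \<Sum>y\<in>range (s n). y * indicator (s n -` {y} \<inter> I n) t) = 0"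
    proof (rule sum_zero[OF fr])
      fix y
      have "l (indicator (s n -` {y} \<inter> I n)) = 0"
        unfolding I_def by (rule borel_sets_zero[OF fin _ int0 b]) auto
      moreover have "(indicator (s n -` {y} \<inter> I n) :: real \<Rightarrow> complex) \<in> L2 M"
        by (rule indicator_L2[OF _ _ fin[of "- real n" "real n"]]) (use b in \<open>auto simp: I_def\<close>)
      ultimately show "indicator (s n -` {y} \<inter> I n) \<in> L2 M \<and> l (indicator (s n -` {y} \<inter> I n)) = 0" by simp
    qed
    then show "H n \<in> L2 M" "l (H n) = 0" unfolding H_def[abs_def] by auto
  qed
  have "(\<lambda>n. l (H n)) \<longlonglongrightarrow> l G"
  proof (rule dominated_limit(2)[where W = "\<lambda>t. 2 * G t"])
    show "(\<lambda>t. 2 * G t) \<in> L2 M" by (rule L2_scale[OF G])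
    show "\<forall>\<^sub>F n in sequentially. \<forall>t. cmod (H n t) \<le> cmod (2 * G t)"
      using s(3) sp unfolding Heq by (intro always_eventually allI) (auto simp: indicator_def norm_mult)
    show "(\<lambda>n. H n t) \<longlonglongrightarrow> G t" for t
    proof -
      obtain n0 where "\<bar>t\<bar> < real n0" using reals_Archimedean2 by blast
      then have "\<forall>\<^sub>F n in sequentially. s n t = H n t"
        unfolding Heq by (intro eventually_sequentiallyI[of n0]) (auto simp: I_def indicator_def)
      then show ?thesis using s(2)[of t] sp by (auto intro: Lim_transform_eventually)
    qed
  qed (rule H(1))
  then show ?thesis unfolding H(2) LIMSEQ_const_iff by (rule sym)
qed

end

section \<open>Bounded point evaluations\<close>

context bounded_functional
begin

text \<open>
  The function \<open>(\<Phi> z * F w - F z * \<Phi> w) / (w - z)\<close> of \<open>w\<close> belongs to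
  \<open>PW b\<close> because the numerator vanishes at \<open>z\<close>.
\<close>

lemma cauchy_quotient:
  assumes "tempered M" "b > 0" and ann: "\<And>F. F \<in> PW b \<Longrightarrow> l (\<lambda>t. F (of_real t)) = 0"
    and F: "F \<in> PW b" and \<Phi>: "\<Phi> \<in> PW b" and z: "Im z \<noteq> 0"
  shows "F z * cauchy (\<lambda>t. \<Phi> (of_real t)) z = \<Phi> z * cauchy (\<lambda>t. F (of_real t)) z"
proof -
  have FL: "(\<lambda>t. F (of_real t)) \<in> L2 M" and \<Phi>L: "(\<lambda>t. \<Phi> (of_real t)) \<in> L2 M"
    using PW_L2[OF assms(1)] F \<Phi> \<open>b > 0\<close> by blast+
  have G: "(\<lambda>w. \<Phi> z * F w + (- F z) * \<Phi> w) \<in> PW b" by (rule PW_lin[OF F \<Phi>])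
  obtain H where H: "H \<in> PW b" "\<And>w. (w - z) * H w = \<Phi> z * F w + (- F z) * \<Phi> w"
    using PW_divide[OF G, of z] by (auto simp: mult.commute)
  have "H (of_real t) = \<Phi> z * (F (of_real t) / (of_real t - z)) + (- F z) * (\<Phi> (of_real t) / (of_real t - z))" for t
  proof -
    have ne: "of_real t - z \<noteq> 0" using z by (auto simp: complex_eq_iff)
    then have "H (of_real t) = (\<Phi> z * F (of_real t) + (- F z) * \<Phi> (of_real t)) / (of_real t - z)"
      using H(2)[of "of_real t"] by (metis nonzero_mult_div_cancel_left)
    then show ?thesis by (simp only: add_divide_distrib times_divide_eq_right)
  qed
  then have "0 = l (\<lambda>t. \<Phi> z * (F (of_real t) / (of_real t - z)) + (- F z) * (\<Phi> (of_real t) / (of_real t - z)))"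
    using ann[OF H(1)] by simp
  also have "\<dots> = \<Phi> z * cauchy (\<lambda>t. F (of_real t)) z + (- F z) * cauchy (\<lambda>t. \<Phi> (of_real t)) z"
    unfolding cauchy_def by (rule lin[OF cauchy_kernel_L2(1)[OF FL z] cauchy_kernel_L2(1)[OF \<Phi>L z]])
  finally show ?thesis by simp
qed

text \<open>
  Everything is moved to the line \<open>Im z = Y\<close>, where the Cauchy transform \<open>B\<close> of
  \<open>\<Phi>\<close> is bounded and, by the identity theorem, not identically zero above. Since
  \<open>cnj (F (cnj z))\<close> has the same norm as \<open>F\<close>, the estimate on this line gives
  one on its mirror image, although the Cauchy transform may vanish identically in the lower half-plane.
\<close>

lemma evaluation_bound_upper:
  assumes tM: "tempered M" and b: "b > 0" and ann: "\<And>F. F \<in> PW b \<Longrightarrow> l (\<lambda>t. F (of_real t)) = 0"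
    and \<Phi>: "\<Phi> \<in> PW b" and z0: "Im z0 > 0" "cauchy (\<lambda>t. \<Phi> (of_real t)) z0 \<noteq> 0" and "\<epsilon> > 0" "Y > 0"
  shows "\<exists>K>0. \<forall>F\<in>PW b. \<forall>z. \<bar>Im z\<bar> \<le> Y \<longrightarrow>
      cmod (F z) \<le> K * L2_norm M (\<lambda>t. F (of_real t)) * exp (\<epsilon> * \<bar>Re z\<bar>)"
proof -
  define B where "B = cauchy (\<lambda>t. \<Phi> (of_real t))"
  have \<Phi>L: "(\<lambda>t. \<Phi> (of_real t)) \<in> L2 M" by (rule PW_L2[OF tM \<Phi> b])
  have Bhol: "B holomorphic_on {z. Im z > 0}" unfolding B_def by (rule cauchy_holomorphic[OF \<Phi>L])
  have "\<exists>w. Im w > Y \<and> B w \<noteq> 0"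
  proof (rule ccontr)
    assume "\<not> ?thesis"
    then have "B w = 0" if "w \<in> {w. Im w > Y}" for w using that by blast
    then have B0: "B w = 0" if "w \<in> {w. Im w > Y}" for w using that .
    have "B z0 = (\<lambda>_. 0) z0"
    proof (rule analytic_continuation_open[OF _ _ _ _ _ Bhol holomorphic_on_const B0])
      show "open {w. Im w > Y}" "open {w. Im w > 0}" by (rule open_halfspace_Im_gt)+
      show "connected {w. Im w > 0}" by (intro convex_connected convex_halfspace_Im_gt)
      have "Complex 0 (Y + 1) \<in> {w. Im w > Y}" by simp
      then show "{w. Im w > Y} \<noteq> {}" by blast
      show "{w. Im w > Y} \<subseteq> {w. Im w > 0}" using \<open>Y > 0\<close> by auto
      show "z0 \<in> {w. Im w > 0}" using z0(1) by simp
    qed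
    then show False using z0(2) by (simp add: B_def)
  qed
  then obtain w where w: "Im w > Y" "B w \<noteq> 0" by blast
  define c where "c = C * L2_norm M (\<lambda>t. \<Phi> (of_real t)) / Y + 1"
  have "c \<ge> 1" using C_nonneg L2_norm_nonneg[of M "\<lambda>t. \<Phi> (of_real t)"] \<open>Y > 0\<close> by (simp add: c_def)
  define \<beta> where "\<beta> z = B (z + \<i> * of_real Y) / of_real (2 * c)" for z
  have "(B \<circ> (\<lambda>z. z + \<i> * of_real Y)) holomorphic_on {z. Im z > - Y}"
    by (rule holomorphic_on_compose_gen[OF _ Bhol]) (auto intro!: holomorphic_intros)
  then have \<beta>h: "\<beta> holomorphic_on {z. Im z > - Y}"
    unfolding \<beta>_def o_def using \<open>c \<ge> 1\<close> by (intro holomorphic_intros) auto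
  have \<beta>c: "continuous_on {z. Im z \<ge> 0} \<beta>"
    by (rule continuous_on_subset[OF holomorphic_on_imp_continuous_on[OF \<beta>h]]) (use \<open>Y > 0\<close> in auto)
  have \<beta>h': "\<beta> holomorphic_on {z. Im z > 0}"
    by (rule holomorphic_on_subset[OF \<beta>h]) (use \<open>Y > 0\<close> in auto)
  have \<beta>b: "cmod (\<beta> z) \<le> 1 / 2" if "Im z \<ge> 0" for z
  proof -
    let ?z = "z + \<i> * of_real Y"
    have "cmod (B ?z) \<le> C * L2_norm M (\<lambda>t. \<Phi> (of_real t)) / \<bar>Im ?z\<bar>"
      unfolding B_def by (rule cauchy_bound[OF \<Phi>L]) (use that \<open>Y > 0\<close> in simp)
    also have "\<dots> \<le> C * L2_norm M (\<lambda>t. \<Phi> (of_real t)) / Y"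
      using that \<open>Y > 0\<close> C_nonneg L2_norm_nonneg by (intro frac_le mult_nonneg_nonneg) auto
    also have "\<dots> \<le> c" by (simp add: c_def)
    finally show ?thesis using \<open>c \<ge> 1\<close> by (simp add: \<beta>_def norm_divide norm_mult divide_le_eq)
  qed
  have \<beta>0: "\<beta> (w - \<i> * of_real Y) \<noteq> 0" "Im (w - \<i> * of_real Y) > 0"
    using w \<open>c \<ge> 1\<close> by (auto simp: \<beta>_def)
  obtain C\<Phi> where C\<Phi>: "C\<Phi> > 0" "\<And>z. cmod (\<Phi> z) \<le> C\<Phi> * exp (b * \<bar>Im z\<bar>)"
    using PW_growth[OF \<Phi> b] by blast
  define k where "k = C\<Phi> * exp (b * Y) * C / Y / (2 * c)"
  have k: "k \<ge> 0" using C\<Phi> C_nonneg \<open>Y > 0\<close> \<open>c \<ge> 1\<close> by (simp add: k_def)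
  have up: "cmod (F (Complex t Y)) * cmod (\<beta> (of_real t)) \<le> k * L2_norm M (\<lambda>t. F (of_real t))" if F: "F \<in> PW b" for F t
  proof -
    let ?z = "Complex t Y"
    have FL: "(\<lambda>t. F (of_real t)) \<in> L2 M" by (rule PW_L2[OF tM F b])
    have I: "Im ?z \<noteq> 0" using \<open>Y > 0\<close> by simp
    have "\<beta> (of_real t) = B ?z / of_real (2 * c)"
    proof -
      have "of_real t + \<i> * of_real Y = ?z" by (simp add: complex_eq_iff)
      then show ?thesis by (simp only: \<beta>_def)
    qed
    then have "cmod (F ?z) * cmod (\<beta> (of_real t)) = cmod (F ?z * B ?z) / (2 * c)"
      using \<open>c \<ge> 1\<close> by (simp add: norm_mult norm_divide)
    also have "F ?z * B ?z = \<Phi> ?z * cauchy (\<lambda>t. F (of_real t)) ?z"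
      unfolding B_def by (rule cauchy_quotient[OF tM b ann F \<Phi> I])
    also have "cmod \<dots> \<le> (C\<Phi> * exp (b * Y)) * (C * L2_norm M (\<lambda>t. F (of_real t)) / Y)"
      unfolding norm_mult
      using C\<Phi>(2)[of ?z] cauchy_bound[OF FL I] \<open>Y > 0\<close> C\<Phi>(1) by (intro mult_mono) auto
    finally show ?thesis
      using \<open>c \<ge> 1\<close> by (simp add: k_def divide_right_mono mult_ac)
  qed
  have down: "cmod (F (Complex t (- Y))) * cmod (\<beta> (of_real t)) \<le> k * L2_norm M (\<lambda>t. F (of_real t))" if F: "F \<in> PW b" for F t
  proof -
    have "cnj (Complex t Y) = Complex t (- Y)" by (simp add: complex_eq_iff)
    then have "cmod (F (Complex t (- Y))) = cmod (cnj (F (cnj (Complex t Y))))" by simp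
    moreover have "L2_norm M (\<lambda>t. cnj (F (cnj (of_real t)))) = L2_norm M (\<lambda>t. F (of_real t))"
      by (simp add: L2_norm_def)
    ultimately show ?thesis using up[OF PW_cnj[OF F], of t] by simp
  qed
  show ?thesis
  proof (rule strip_bound[OF \<beta>c \<beta>h' \<beta>b \<beta>0(2,1) \<open>Y > 0\<close> b \<open>\<epsilon> > 0\<close>])
    fix K :: real assume "K > 0" and
      S: "\<And>F C D z. F holomorphic_on UNIV \<Longrightarrow> (\<And>z. cmod (F z) \<le> C * exp (b * \<bar>Im z\<bar>)) \<Longrightarrow> D > 0 \<Longrightarrow>
      (\<And>t. cmod (F (Complex t Y)) * cmod (\<beta> (of_real t)) \<le> D) \<Longrightarrow>
      (\<And>t. cmod (F (Complex t (- Y))) * cmod (\<beta> (of_real t)) \<le> D) \<Longrightarrow>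
      \<bar>Im z\<bar> \<le> Y \<Longrightarrow> cmod (F z) \<le> K * D * exp (\<epsilon> * \<bar>Re z\<bar>)"
    have main: "cmod (F z) \<le> (K * k) * L2_norm M (\<lambda>t. F (of_real t)) * exp (\<epsilon> * \<bar>Re z\<bar>)"
      if F: "F \<in> PW b" and z: "\<bar>Im z\<bar> \<le> Y" for F z
    proof -
      define N where "N = L2_norm M (\<lambda>t. F (of_real t))"
      obtain CF where CF: "\<And>z. cmod (F z) \<le> CF * exp (b * \<bar>Im z\<bar>)" using PW_growth[OF F b] by blast
      have "cmod (F z) / (K * exp (\<epsilon> * \<bar>Re z\<bar>)) \<le> k * N"
      proof (rule field_le_epsilon)
        fix e :: real assume "e > 0"
        have N: "k * N \<ge> 0" using k L2_norm_nonneg by (simp add: N_def)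
        have "cmod (F z) \<le> K * (k * N + e) * exp (\<epsilon> * \<bar>Re z\<bar>)"
        proof (rule S[OF PW_holomorphic[OF F] CF _ _ _ z])
          show "k * N + e > 0" using N \<open>e > 0\<close> by simp
          show "cmod (F (Complex t Y)) * cmod (\<beta> (of_real t)) \<le> k * N + e" for t
            using up[OF F, of t] \<open>e > 0\<close> unfolding N_def by linarith
          show "cmod (F (Complex t (- Y))) * cmod (\<beta> (of_real t)) \<le> k * N + e" for t
            using down[OF F, of t] \<open>e > 0\<close> unfolding N_def by linarith
        qed
        then show "cmod (F z) / (K * exp (\<epsilon> * \<bar>Re z\<bar>)) \<le> k * N + e"
          using \<open>K > 0\<close> by (simp add: divide_le_eq mult_ac)
      qed
      then show ?thesis using \<open>K > 0\<close> by (simp add: divide_le_eq mult_ac N_def)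
    qed
    have "cmod (F z) \<le> (K * k + 1) * L2_norm M (\<lambda>t. F (of_real t)) * exp (\<epsilon> * \<bar>Re z\<bar>)"
      if "F \<in> PW b" "\<bar>Im z\<bar> \<le> Y" for F z
    proof -
      have "(K * k) * L2_norm M (\<lambda>t. F (of_real t)) * exp (\<epsilon> * \<bar>Re z\<bar>)
          \<le> (K * k + 1) * L2_norm M (\<lambda>t. F (of_real t)) * exp (\<epsilon> * \<bar>Re z\<bar>)"
        by (intro mult_right_mono L2_norm_nonneg) auto
      then show ?thesis using main[OF that] by linarith
    qed
    then show ?thesis using \<open>K > 0\<close> k by (intro exI[of _ "K * k + 1"] conjI ballI allI impI) (auto simp: add_nonneg_pos)
  qed
qed

end

lemma L2_cnj: "G \<in> L2 M \<Longrightarrow> (\<lambda>t. cnj (G t)) \<in> L2 M"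
proof -
  assume G: "G \<in> L2 M"
  have "(\<lambda>t. cnj (G t)) \<in> borel_measurable M"
    by (rule measurable_compose[OF L2_D(1)[OF G]]) (intro borel_measurable_continuous_onI continuous_intros)
  then show ?thesis by (rule L2_dominated[OF G, of _ 1]) simp
qed

text \<open>
  Conjugation exchanges the Cauchy transforms in the two half-planes.
\<close>

lemma (in bounded_functional) conjugate_functional:
  "bounded_functional M (\<lambda>G. cnj (l (\<lambda>t. cnj (G t)))) C"
proof
  fix F G c d assume FG: "F \<in> L2 M" "G \<in> L2 M"
  have "l (\<lambda>t. cnj (c * F t + d * G t)) = cnj c * l (\<lambda>t. cnj (F t)) + cnj d * l (\<lambda>t. cnj (G t))"
    using lin[OF L2_cnj[OF FG(1)] L2_cnj[OF FG(2)], of "cnj c" "cnj d"] by simp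
  then show "cnj (l (\<lambda>t. cnj (c * F t + d * G t))) = c * cnj (l (\<lambda>t. cnj (F t))) + d * cnj (l (\<lambda>t. cnj (G t)))"
    by simp
next
  fix F assume F: "F \<in> L2 M"
  have "cmod (l (\<lambda>t. cnj (F t))) \<le> C * L2_norm M (\<lambda>t. cnj (F t))" by (rule bound[OF L2_cnj[OF F]])
  then show "cmod (cnj (l (\<lambda>t. cnj (F t)))) \<le> C * L2_norm M F" by (simp add: L2_norm_def)
qed (rule sets_M C_nonneg)+

text \<open>
  A functional that annihilates \<open>\<E> b\<close> but not all of \<open>L2 M\<close> has some Cauchy
  transform that is nonzero somewhere off the real axis; conjugating the functional if necessary, that
  point lies in the upper half-plane.
\<close>

lemma evaluation_bound:
  assumes tM: "tempered M" and b: "b > 0" and nd: "\<not> dense_in_L2 M (\<E> b)" and "\<epsilon> > 0" "Y > 0"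
  shows "\<exists>K>0. \<forall>F\<in>PW b. \<forall>z. \<bar>Im z\<bar> \<le> Y \<longrightarrow>
      cmod (F z) \<le> K * L2_norm M (\<lambda>t. F (of_real t)) * exp (\<epsilon> * \<bar>Re z\<bar>)"
proof -
  have sub: "\<E> b \<subseteq> L2 M" unfolding E_eq_PW using PW_L2[OF tM _ b] by auto
  have ne: "\<E> b \<noteq> {}" unfolding E_eq_PW using PW_zero[OF b] by auto
  have lin: "(\<lambda>t. c * F t + d * G t) \<in> \<E> b" if FG: "F \<in> \<E> b" "G \<in> \<E> b" for F G c d
  proof -
    obtain F' G' where "F' \<in> PW b" "F = (\<lambda>t. F' (of_real t))" "G' \<in> PW b" "G = (\<lambda>t. G' (of_real t))"
      using FG unfolding E_eq_PW by blast
    then show ?thesis unfolding E_eq_PW using PW_lin[of F' b G' c d]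
      by (intro image_eqI[where x = "\<lambda>z. c * F' z + d * G' z"]) simp_all
  qed
  obtain g e where g: "g \<in> L2 M" and e: "e > 0" "\<And>F. F \<in> \<E> b \<Longrightarrow> \<not> L2_norm M (\<lambda>t. g t - F t) < e"
    using nd sub unfolding dense_in_L2_def by blast
  have e': "e \<le> L2_norm M (\<lambda>t. g t - F t)" if "F \<in> \<E> b" for F using e(2)[OF that] by simp
  obtain l C where "bounded_functional M l C" and ann: "\<forall>F\<in>\<E> b. l F = 0" and lg: "l g \<noteq> 0"
    using annihilating_functional[OF sub ne lin g e(1) e' tempered_sets[OF tM]] by blast
  then interpret bounded_functional M l C by simp
  have annPW: "l (\<lambda>t. F (of_real t)) = 0" if "F \<in> PW b" for F
  proof -
    have "(\<lambda>t. F (of_real t)) \<in> \<E> b" unfolding E_eq_PW by (rule imageI[OF that])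
    with ann show ?thesis by (rule bspec)
  qed
  obtain \<Psi> where \<Psi>: "\<Psi> \<in> PW b" "\<Psi> 0 = 1" "\<forall>t. cmod (\<Psi> (of_real t)) \<le> 1"
    "\<forall>k::nat. (\<lambda>z. \<Psi> (z / of_nat (Suc k))) \<in> PW b"
    using PW_bump[OF b] by (elim exE conjE)
  define p where "p k z = \<Psi> (z / of_nat (Suc k))" for k :: nat and z
  have pPW: "p k \<in> PW b" for k using \<Psi>(4)[rule_format, of k] by (simp only: p_def[abs_def])
  have "\<exists>k z. Im z \<noteq> 0 \<and> cauchy (\<lambda>t. p k (of_real t)) z \<noteq> 0"
  proof (rule ccontr)
    assume "\<not> ?thesis"
    then have z: "cauchy (\<lambda>t. p k (of_real t)) z = 0" if "Im z \<noteq> 0" for k z using that by blast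
    have "l g = 0"
    proof (rule vanishing[of "\<lambda>k t. p k (of_real t)"])
      show "emeasure M {a<..c} < \<infinity>" for a c by (rule tempered_finite_interval[OF tM])
      show "(\<lambda>t. p k (of_real t)) \<in> L2 M" for k by (rule PW_L2[OF tM pPW b])
      show "cmod (p k (of_real t)) \<le> 1" for k t
        using \<Psi>(3)[rule_format, of "t / real (Suc k)"] by (simp add: p_def)
      show "(\<lambda>k. p k (of_real t)) \<longlonglongrightarrow> 1" for t
      proof -
        have c: "isCont \<Psi> 0"
          using holomorphic_on_imp_continuous_on[OF PW_holomorphic[OF \<Psi>(1), of UNIV]]
          by (simp add: continuous_on_eq_continuous_at)
        have "(\<lambda>k. of_real (t / real (Suc k)) :: complex) \<longlonglongrightarrow> of_real 0"
          by (intro tendsto_of_real LIMSEQ_Suc[OF lim_const_over_n])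
        then have "(\<lambda>k. \<Psi> (of_real (t / real (Suc k)))) \<longlonglongrightarrow> \<Psi> 0"
          using isCont_tendsto_compose[OF c] by simp
        then show ?thesis using \<Psi>(2) by (simp add: p_def)
      qed
    qed (use z g in auto)
    then show False using lg by simp
  qed
  then obtain k z0 where z0: "Im z0 \<noteq> 0" "cauchy (\<lambda>t. p k (of_real t)) z0 \<noteq> 0" by blast
  show ?thesis
  proof (cases "Im z0 > 0")
    case True
    show ?thesis by (rule evaluation_bound_upper[OF tM b annPW pPW True z0(2) \<open>\<epsilon> > 0\<close> \<open>Y > 0\<close>])
  next
    case False
    define l' where "l' G = cnj (l (\<lambda>t. cnj (G t)))" for G
    interpret c: bounded_functional M l' C
      unfolding l'_def[abs_def] by (rule conjugate_functional)
    define \<Phi> where "\<Phi> z = cnj (p k (cnj z))" for z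
    have \<Phi>: "\<Phi> \<in> PW b" unfolding \<Phi>_def[abs_def] by (rule PW_cnj[OF pPW])
    have an: "l' (\<lambda>t. F (of_real t)) = 0" if "F \<in> PW b" for F
      using annPW[OF PW_cnj[OF that]] by (simp add: l'_def)
    have "c.cauchy (\<lambda>t. \<Phi> (of_real t)) (cnj z0) = cnj (cauchy (\<lambda>t. p k (of_real t)) z0)"
      unfolding c.cauchy_def cauchy_def l'_def \<Phi>_def by simp
    then have "c.cauchy (\<lambda>t. \<Phi> (of_real t)) (cnj z0) \<noteq> 0" using z0(2) by simp
    moreover have "Im (cnj z0) > 0" using False z0(1) by simp
    ultimately show ?thesis using c.evaluation_bound_upper[OF tM b an \<Phi> _ _ \<open>\<epsilon> > 0\<close> \<open>Y > 0\<close>] by blast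
  qed
qed

section \<open>Averaging the comparison of measures\<close>

lemma polynomial_growth_tempered:
  assumes "sets N = sets borel" "polynomial_growth N" shows "tempered N"
proof -
  have [measurable_cong]: "sets N = sets borel" by fact
  obtain s where s: "s \<ge> 0" "(\<integral>\<^sup>+t. ennreal (1 / (1 + \<bar>t\<bar> powr (2 * s))) \<partial>N) < \<infinity>"
    using assms(2) unfolding polynomial_growth_def by blast
  define m where "m = nat \<lceil>2 * s\<rceil>"
  have m: "2 * s \<le> real m" unfolding m_def by (rule real_nat_ceiling_ge)
  have le: "1 / (1 + \<bar>t\<bar>) ^ m \<le> 2 * (1 / (1 + \<bar>t\<bar> powr (2 * s)))" for t
  proof -
    have "\<bar>t\<bar> powr (2 * s) \<le> (1 + \<bar>t\<bar>) powr (2 * s)" by (rule powr_mono2) (use s in auto)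
    also have "\<dots> \<le> (1 + \<bar>t\<bar>) powr real m" by (rule powr_mono[OF m]) simp
    also have "\<dots> = (1 + \<bar>t\<bar>) ^ m" by (rule powr_realpow) simp
    finally have "\<bar>t\<bar> powr (2 * s) \<le> (1 + \<bar>t\<bar>) ^ m" .
    moreover have "1 \<le> (1 + \<bar>t\<bar>) ^ m" by (rule one_le_power) simp
    ultimately have "1 + \<bar>t\<bar> powr (2 * s) \<le> 2 * (1 + \<bar>t\<bar>) ^ m" by linarith
    moreover have "1 + \<bar>t\<bar> powr (2 * s) > 0" by (simp add: add_pos_nonneg)
    moreover have "(1 + \<bar>t\<bar>) ^ m > 0" by simp
    ultimately show ?thesis by (simp add: field_simps)
  qed
  have "(\<integral>\<^sup>+t. ennreal (1 / (1 + \<bar>t\<bar>) ^ m) \<partial>N) \<le> (\<integral>\<^sup>+t. 2 * ennreal (1 / (1 + \<bar>t\<bar> powr (2 * s))) \<partial>N)"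
  proof (rule nn_integral_mono)
    fix t
    have "ennreal (1 / (1 + \<bar>t\<bar>) ^ m) \<le> ennreal (2 * (1 / (1 + \<bar>t\<bar> powr (2 * s))))" by (rule ennreal_leI[OF le])
    also have "\<dots> = ennreal 2 * ennreal (1 / (1 + \<bar>t\<bar> powr (2 * s)))"
      by (rule ennreal_mult) (auto simp: add_nonneg_nonneg)
    finally show "ennreal (1 / (1 + \<bar>t\<bar>) ^ m) \<le> 2 * ennreal (1 / (1 + \<bar>t\<bar> powr (2 * s)))" by simp
  qed
  also have "\<dots> = 2 * (\<integral>\<^sup>+t. ennreal (1 / (1 + \<bar>t\<bar> powr (2 * s))) \<partial>N)"
    by (rule nn_integral_cmult) measurable
  also have "\<dots> < \<infinity>" using s(2) by (simp add: ennreal_mult_less_top)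
  finally show ?thesis using assms(1) unfolding tempered_def by blast
qed

lemma power_le_exp:
  assumes "\<kappa> > 0"
  obtains D :: real where "D > 0" "\<And>x. x \<ge> 0 \<Longrightarrow> (1 + x) ^ k \<le> D * exp (\<kappa> * x)"
proof (cases "k = 0")
  case True
  then show ?thesis using that[of 1] assms by simp
next
  case False
  define c where "c = max 1 (real k / \<kappa>)"
  have c: "c \<ge> 1" "c * (\<kappa> / real k) \<ge> 1"
  proof -
    show "c \<ge> 1" by (simp add: c_def)
    have "(real k / \<kappa>) * (\<kappa> / real k) \<le> c * (\<kappa> / real k)"
      using assms by (intro mult_right_mono) (auto simp: c_def)
    then show "c * (\<kappa> / real k) \<ge> 1" using assms False by simp
  qed
  have "(1 + x) ^ k \<le> c ^ k * exp (\<kappa> * x)" if "x \<ge> 0" for x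
  proof -
    have "1 * x \<le> (c * (\<kappa> / real k)) * x" by (rule mult_right_mono[OF c(2) that])
    then have "1 + x \<le> c * (1 + \<kappa> / real k * x)" using c(1) by (simp add: algebra_simps)
    also have "\<dots> \<le> c * exp (\<kappa> / real k * x)"
      using exp_ge_add_one_self[of "\<kappa> / real k * x"] c(1) by (intro mult_left_mono) auto
    finally have "(1 + x) ^ k \<le> (c * exp (\<kappa> / real k * x)) ^ k" using that by (intro power_mono) auto
    also have "\<dots> = c ^ k * exp (\<kappa> * x)"
      using False by (simp add: power_mult_distrib exp_of_nat_mult[symmetric])
    finally show ?thesis .
  qed
  moreover have "c ^ k > 0" using c(1) by simp
  ultimately show ?thesis using that by blast
qed

lemma poisson_integrable: "integrable lborel (poisson 0 1)"
proof -
  have c: "continuous_on {z. Im z \<ge> 0} (\<lambda>z. of_real (exp 1 - 1 :: real) :: complex)" by (rule continuous_on_const)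
  have h: "(\<lambda>z. of_real (exp 1 - 1) :: complex) holomorphic_on {z. Im z > 0}" by (rule holomorphic_on_const)
  have n: "cmod (of_real (exp 1 - 1)) = exp 1 - 1" using exp_ge_add_one_self[of 1] by (simp only: norm_of_real)
  have "integrable lborel (\<lambda>t. ln (cmod (of_real (exp 1 - 1)) + 1) * poisson 0 1 t)"
    by (rule half_plane_mean(1)[OF c h, of "exp 1 - 1"]) (use n in auto)
  then show ?thesis unfolding n by simp
qed

lemma exp_decay_integral:
  assumes "\<kappa> > 0"
  shows "(\<integral>\<^sup>+x. ennreal (exp (- \<kappa> * \<bar>x\<bar>) * (1 + \<bar>x\<bar>) ^ k) \<partial>lborel) < \<infinity>"
proof -
  obtain D where D: "D > 0" "\<And>x. x \<ge> 0 \<Longrightarrow> (1 + x) ^ (k + 2) \<le> D * exp (\<kappa> * x)"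
    using power_le_exp[OF assms] by blast
  have le: "exp (- \<kappa> * \<bar>x\<bar>) * (1 + \<bar>x\<bar>) ^ k \<le> D * poisson 0 1 x" for x
  proof -
    have "(1 + \<bar>x\<bar>) ^ k * (1 + x\<^sup>2) \<le> (1 + \<bar>x\<bar>) ^ k * (1 + \<bar>x\<bar>)\<^sup>2"
      by (intro mult_left_mono) (auto simp: power2_sum)
    also have "\<dots> = (1 + \<bar>x\<bar>) ^ (k + 2)" by (rule power_add[symmetric])
    also have "\<dots> \<le> D * exp (\<kappa> * \<bar>x\<bar>)" by (rule D(2)) simp
    finally have *: "(1 + \<bar>x\<bar>) ^ k * (1 + x\<^sup>2) \<le> D * exp (\<kappa> * \<bar>x\<bar>)" .
    have "exp (- \<kappa> * \<bar>x\<bar>) * ((1 + \<bar>x\<bar>) ^ k * (1 + x\<^sup>2)) \<le> exp (- \<kappa> * \<bar>x\<bar>) * (D * exp (\<kappa> * \<bar>x\<bar>))"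
      by (rule mult_left_mono[OF *]) simp
    also have "\<dots> = D" by (simp add: exp_minus)
    finally have "exp (- \<kappa> * \<bar>x\<bar>) * (1 + \<bar>x\<bar>) ^ k * (1 + x\<^sup>2) \<le> D" by (simp only: mult.assoc)
    moreover have "1 + x\<^sup>2 > 0" by (simp add: add_pos_nonneg)
    ultimately have "exp (- \<kappa> * \<bar>x\<bar>) * (1 + \<bar>x\<bar>) ^ k \<le> D / (1 + x\<^sup>2)" by (simp add: pos_le_divide_eq)
    then show ?thesis by (simp add: poisson_def add.commute)
  qed
  have "(\<integral>\<^sup>+x. ennreal (exp (- \<kappa> * \<bar>x\<bar>) * (1 + \<bar>x\<bar>) ^ k) \<partial>lborel) \<le> (\<integral>\<^sup>+x. ennreal (D * poisson 0 1 x) \<partial>lborel)"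
    by (intro nn_integral_mono ennreal_leI le)
  also have "\<dots> = ennreal (LINT x|lborel. D * poisson 0 1 x)"
    by (rule nn_integral_eq_integral[OF integrable_mult_right[OF poisson_integrable]])
      (use D(1) poisson_nonneg in \<open>intro AE_I2 mult_nonneg_nonneg, auto\<close>)
  also have "\<dots> < \<infinity>" by simp
  finally show ?thesis .
qed

text \<open>
  The indicator of \<open>centred_interval c x \<delta>\<close> at \<open>t\<close>, written so that joint
  measurability in \<open>x\<close> and \<open>t\<close> is apparent.
\<close>

definition near :: "real \<Rightarrow> real \<Rightarrow> real \<Rightarrow> real \<Rightarrow> ennreal" where
  "near \<delta> c x t = (if \<bar>t - x\<bar> \<le> c * exp (- \<delta> * \<bar>x\<bar>) then 1 else 0)"

lemma near_indicator: "indicator (centred_interval c x \<delta>) t = near \<delta> c x t"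
  by (auto simp: near_def centred_interval_def indicator_def)

lemma near_measurable [measurable]:
  assumes [measurable]: "f \<in> borel_measurable M" "g \<in> borel_measurable M"
  shows "(\<lambda>p. near \<delta> c (f p) (g p)) \<in> borel_measurable M"
  unfolding near_def by measurable

lemma near_dist:
  fixes t x c \<delta> :: real
  assumes "\<bar>t - x\<bar> \<le> c * exp (- \<delta> * \<bar>x\<bar>)" "\<delta> > 0" "c \<ge> 0"
  shows "\<bar>t - x\<bar> \<le> c"
proof -
  have "c * exp (- \<delta> * \<bar>x\<bar>) \<le> c * 1" by (rule mult_left_mono) (use assms in auto)
  then show ?thesis using assms(1) by simp
qed

lemma interval_lebesgue: "r \<ge> 0 \<Longrightarrow> (\<integral>\<^sup>+x. (if \<bar>t - x\<bar> \<le> r then 1 else 0) \<partial>lborel) = ennreal (2 * r)" for t r :: real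
proof -
  assume "r \<ge> 0"
  have "(\<integral>\<^sup>+x. (if \<bar>t - x\<bar> \<le> r then 1 else 0) \<partial>lborel) = (\<integral>\<^sup>+x. indicator {t - r..t + r} x \<partial>lborel)"
    by (rule nn_integral_cong) (auto simp: indicator_def)
  also have "\<dots> = ennreal (2 * r)" using \<open>r \<ge> 0\<close> by simp
  finally show ?thesis .
qed

text \<open>
  Weighted by the inverse of their length, the intervals around all \<open>x\<close> cover every point
  \<open>t\<close> about equally often; this replaces the choice of a covering by intervals of bounded
  overlap.
\<close>

lemma near_integral_lower:
  assumes "\<delta> > 0"
  shows "ennreal (2 * exp (- 2 * \<delta>)) \<le> (\<integral>\<^sup>+x. ennreal (exp (\<delta> * \<bar>x\<bar>)) * near \<delta> 1 x t \<partial>lborel)"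
proof -
  define r where "r = exp (- \<delta> * (\<bar>t\<bar> + 1))"
  have r: "r > 0" "r \<le> 1" using assms by (auto simp: r_def)
  define e where "e = exp (\<delta> * (\<bar>t\<bar> - 1))"
  have "ennreal (2 * exp (- 2 * \<delta>)) = ennreal (e * (2 * r))"
    by (simp add: e_def r_def exp_add[symmetric] algebra_simps)
  also have "\<dots> = ennreal e * ennreal (2 * r)" using r by (simp add: e_def ennreal_mult)
  also have "\<dots> = ennreal e * (\<integral>\<^sup>+x. (if \<bar>t - x\<bar> \<le> r then 1 else 0) \<partial>lborel)"
    using interval_lebesgue[of r t] r by simp
  also have "\<dots> = (\<integral>\<^sup>+x. ennreal e * (if \<bar>t - x\<bar> \<le> r then 1 else 0) \<partial>lborel)"
    by (rule nn_integral_cmult[symmetric]) measurable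
  also have "\<dots> \<le> (\<integral>\<^sup>+x. ennreal (exp (\<delta> * \<bar>x\<bar>)) * near \<delta> 1 x t \<partial>lborel)"
  proof (rule nn_integral_mono)
    fix x :: real
    show "ennreal e * (if \<bar>t - x\<bar> \<le> r then 1 else 0) \<le> ennreal (exp (\<delta> * \<bar>x\<bar>)) * near \<delta> 1 x t"
    proof (cases "\<bar>t - x\<bar> \<le> r")
      case True
      have "\<bar>x\<bar> \<le> \<bar>t\<bar> + 1" "\<bar>t\<bar> - 1 \<le> \<bar>x\<bar>" using True r by auto
      then have "r \<le> exp (- \<delta> * \<bar>x\<bar>)" "e \<le> exp (\<delta> * \<bar>x\<bar>)" using assms by (auto simp: r_def e_def)
      then show ?thesis using True by (simp add: near_def ennreal_leI)
    qed simp
  qed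
  finally show ?thesis .
qed

lemma near_integral_upper:
  assumes "\<delta> > 0"
  shows "(\<integral>\<^sup>+x. ennreal (exp (\<delta> * \<bar>x\<bar>) * (1 + \<bar>x\<bar>) ^ k) * near \<delta> 2 x s \<partial>lborel)
     \<le> ennreal (4 * exp (4 * \<delta>) * 3 ^ k) * ennreal ((1 + \<bar>s\<bar>) ^ k)"
proof -
  define r where "r = 2 * exp (2 * \<delta>) * exp (- \<delta> * \<bar>s\<bar>)"
  have r: "r > 0" by (simp add: r_def)
  define e where "e = exp (2 * \<delta>) * exp (\<delta> * \<bar>s\<bar>) * (3 ^ k * (1 + \<bar>s\<bar>) ^ k)"
  have e: "e \<ge> 0" by (simp add: e_def)
  have "(\<integral>\<^sup>+x. ennreal (exp (\<delta> * \<bar>x\<bar>) * (1 + \<bar>x\<bar>) ^ k) * near \<delta> 2 x s \<partial>lborel)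
      \<le> (\<integral>\<^sup>+x. ennreal e * (if \<bar>s - x\<bar> \<le> r then 1 else 0) \<partial>lborel)"
  proof (rule nn_integral_mono)
    fix x :: real
    show "ennreal (exp (\<delta> * \<bar>x\<bar>) * (1 + \<bar>x\<bar>) ^ k) * near \<delta> 2 x s \<le> ennreal e * (if \<bar>s - x\<bar> \<le> r then 1 else 0)"
    proof (cases "\<bar>s - x\<bar> \<le> 2 * exp (- \<delta> * \<bar>x\<bar>)")
      case True
      have "\<bar>s - x\<bar> \<le> 2" by (rule near_dist[OF True assms]) simp
      then have b: "\<bar>x\<bar> \<le> \<bar>s\<bar> + 2" "\<bar>s\<bar> \<le> \<bar>x\<bar> + 2" by auto
      have "exp (- \<delta> * \<bar>x\<bar>) \<le> exp (2 * \<delta>) * exp (- \<delta> * \<bar>s\<bar>)"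
        using mult_left_mono[OF b(2), of \<delta>] assms by (simp add: exp_add[symmetric] algebra_simps)
      then have 1: "\<bar>s - x\<bar> \<le> r" using True by (simp add: r_def)
      have "exp (\<delta> * \<bar>x\<bar>) \<le> exp (2 * \<delta>) * exp (\<delta> * \<bar>s\<bar>)"
        using mult_left_mono[OF b(1), of \<delta>] assms by (simp add: exp_add[symmetric] algebra_simps)
      moreover have "(1 + \<bar>x\<bar>) ^ k \<le> 3 ^ k * (1 + \<bar>s\<bar>) ^ k"
        unfolding power_mult_distrib[symmetric] using b by (intro power_mono) auto
      ultimately have "exp (\<delta> * \<bar>x\<bar>) * (1 + \<bar>x\<bar>) ^ k \<le> e" unfolding e_def by (intro mult_mono) auto
      then show ?thesis using True 1 by (simp add: near_def ennreal_leI)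
    qed (simp add: near_def)
  qed
  also have "\<dots> = ennreal e * ennreal (2 * r)"
    using interval_lebesgue[of r s] r by (subst nn_integral_cmult) auto
  also have "\<dots> = ennreal (e * (2 * r))" using e r by (simp add: ennreal_mult)
  also have "e * (2 * r) = (4 * exp (4 * \<delta>) * 3 ^ k) * (1 + \<bar>s\<bar>) ^ k"
    by (simp add: e_def r_def power_mult_distrib mult_exp_exp mult.assoc mult.left_commute[of "exp _"] exp_add[symmetric])
  also have "ennreal \<dots> = ennreal (4 * exp (4 * \<delta>) * 3 ^ k) * ennreal ((1 + \<bar>s\<bar>) ^ k)"
    by (rule ennreal_mult) auto
  finally show ?thesis .
qed

text \<open>
  The relation \<open>\<preceq>\<close> with its constants fixed and its exponent replaced by a natural
  number.
\<close>

locale comparison =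
  fixes M N :: "real measure" and \<delta> C :: real and k :: nat
  assumes sets_M [measurable_cong]: "sets M = sets borel"
    and N: "tempered N" and \<delta>: "\<delta> > 0" and C: "C > 0"
    and compare: "\<And>x. emeasure M (centred_interval 1 x \<delta>) \<le> ennreal (C * (1 + \<bar>x\<bar>) ^ k) *
       (emeasure N (centred_interval 2 x \<delta>) + ennreal (exp (- 2 * \<delta> * \<bar>x\<bar>)))"

lemma preccurly_comparison:
  assumes "sets M = sets borel" "tempered N" "M \<preceq> N"
  obtains \<delta> C k where "comparison M N \<delta> C k"
proof -
  obtain \<delta> C n where *: "\<delta> > 0" "C > 0" "n \<ge> 0" "\<And>x. emeasure M (centred_interval 1 x \<delta>) \<le>
          ennreal (C * (1 + \<bar>x\<bar>) powr n) *
            (emeasure N (centred_interval 2 x \<delta>) + ennreal (exp (- 2 * \<delta> * \<bar>x\<bar>)))"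
    using assms(3) unfolding preccurly_def by blast
  define k where "k = nat \<lceil>n\<rceil>"
  have k: "n \<le> real k" unfolding k_def by (rule real_nat_ceiling_ge)
  have "comparison M N \<delta> C k"
  proof
    fix x :: real
    have "(1 + \<bar>x\<bar>) powr n \<le> (1 + \<bar>x\<bar>) powr real k" by (rule powr_mono[OF k]) simp
    also have "\<dots> = (1 + \<bar>x\<bar>) ^ k" by (rule powr_realpow) simp
    finally have "C * (1 + \<bar>x\<bar>) powr n \<le> C * (1 + \<bar>x\<bar>) ^ k" using *(2) by (intro mult_left_mono) auto
    then have "ennreal (C * (1 + \<bar>x\<bar>) powr n) \<le> ennreal (C * (1 + \<bar>x\<bar>) ^ k)" by (rule ennreal_leI)
    then show "emeasure M (centred_interval 1 x \<delta>) \<le> ennreal (C * (1 + \<bar>x\<bar>) ^ k) *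
       (emeasure N (centred_interval 2 x \<delta>) + ennreal (exp (- 2 * \<delta> * \<bar>x\<bar>)))"
      using *(4)[of x] by (meson mult_right_mono order_trans zero_le)
  qed (use assms * in auto)
  then show ?thesis by (rule that)
qed

context comparison
begin

lemma sets_N [measurable_cong]: "sets N = sets borel"
  by (rule tempered_sets[OF N])

lemma interval_finite_N: "emeasure N (centred_interval 2 x \<delta>) < \<infinity>"
proof -
  let ?a = "x - 2 * exp (- \<delta> * \<bar>x\<bar>) - 1" and ?b = "x + 2 * exp (- \<delta> * \<bar>x\<bar>)"
  have "emeasure N (centred_interval 2 x \<delta>) \<le> emeasure N {?a<..?b}"
    by (rule emeasure_mono) (auto simp: centred_interval_def sets_N)
  then show ?thesis using tempered_finite_interval[OF N, of ?a ?b] by (rule le_less_trans)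
qed

lemma interval_finite_M: "emeasure M (centred_interval 1 x \<delta>) < \<infinity>"
proof -
  have "ennreal (C * (1 + \<bar>x\<bar>) ^ k) * (emeasure N (centred_interval 2 x \<delta>) + ennreal (exp (- 2 * \<delta> * \<bar>x\<bar>))) < \<infinity>"
    using interval_finite_N[of x] by (auto simp: ennreal_mult_less_top)
  then show ?thesis using compare[of x] by (rule le_less_trans[rotated])
qed

lemma sigma_finite_N: "sigma_finite_measure N"
proof
  show "\<exists>A. countable A \<and> A \<subseteq> sets N \<and> \<Union> A = space N \<and> (\<forall>a\<in>A. emeasure N a \<noteq> \<infinity>)"
  proof (intro exI[of _ "range (\<lambda>n::nat. {- real n<..real n})"] conjI)
    have "\<exists>n. x \<in> {- real n<..real n}" for x
    proof -
      obtain n where "\<bar>x\<bar> < real n" using reals_Archimedean2 by blast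
      then have "x \<in> {- real n<..real n}" by auto
      then show ?thesis by blast
    qed
    then show "\<Union> (range (\<lambda>n. {- real n<..real n})) = space N"
      using sets_eq_imp_space_eq[OF sets_N] by auto
  qed (use tempered_finite_interval[OF N] in \<open>auto simp: sets_N less_top[symmetric]\<close>)
qed

lemma sigma_finite_M: "sigma_finite_measure M"
proof
  show "\<exists>A. countable A \<and> A \<subseteq> sets M \<and> \<Union> A = space M \<and> (\<forall>a\<in>A. emeasure M a \<noteq> \<infinity>)"
  proof (intro exI[of _ "(\<lambda>q. centred_interval 1 q \<delta>) ` \<rat>"] conjI)
    have "\<exists>q\<in>\<rat>. t \<in> centred_interval 1 q \<delta>" for t
    proof -
      define r where "r = exp (- \<delta> * (\<bar>t\<bar> + 1))"
      have r: "r > 0" "r \<le> 1" using \<delta> by (auto simp: r_def)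
      obtain q where q: "q \<in> \<rat>" "t < q" "q < t + r" using Rats_dense_in_real[of t "t + r"] r by auto
      then have "\<bar>q\<bar> \<le> \<bar>t\<bar> + 1" using r by linarith
      then have "r \<le> exp (- \<delta> * \<bar>q\<bar>)" using \<delta> by (simp add: r_def)
      then show ?thesis using q by (intro bexI[of _ q]) (auto simp: centred_interval_def)
    qed
    then show "\<Union> ((\<lambda>q. centred_interval 1 q \<delta>) ` \<rat>) = space M"
      using sets_eq_imp_space_eq[OF sets_M] by auto
  qed (use interval_finite_M in \<open>auto simp: sets_M countable_rat centred_interval_def less_top[symmetric]\<close>)
qed

text \<open>
  By Tonelli's theorem both integrals become integrals over \<open>x\<close> of contributions of the
  intervals around \<open>x\<close>. On one such interval the supremum \<open>U\<close> of
  \<open>v\<close> is at most \<open>w + r x\<close> on the doubled interval and at most \<open>q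
  x\<close>; the former bound is used against the measure \<open>N\<close>, the latter against the
  exponentially small term.
\<close>

lemma transfer_inequality:
  fixes v w r q :: "real \<Rightarrow> ennreal"
  assumes [measurable]: "v \<in> borel_measurable borel" "w \<in> borel_measurable borel" "r \<in> borel_measurable borel" "q \<in> borel_measurable borel"
    and vq: "\<And>x t. \<bar>t - x\<bar> \<le> exp (- \<delta> * \<bar>x\<bar>) \<Longrightarrow> v t \<le> q x"
    and vw: "\<And>x t s. \<bar>t - x\<bar> \<le> exp (- \<delta> * \<bar>x\<bar>) \<Longrightarrow> \<bar>s - x\<bar> \<le> 2 * exp (- \<delta> * \<bar>x\<bar>) \<Longrightarrow> v t \<le> w s + r x"
    and B: "\<And>x. emeasure N (centred_interval 2 x \<delta>) \<le> ennreal (B x)" and [measurable]: "B \<in> borel_measurable borel"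
  shows "ennreal (2 * exp (- 2 * \<delta>)) * (\<integral>\<^sup>+t. v t \<partial>M) \<le>
     ennreal C * (ennreal (4 * exp (4 * \<delta>) * 3 ^ k) * (\<integral>\<^sup>+s. ennreal ((1 + \<bar>s\<bar>) ^ k) * w s \<partial>N)
      + (\<integral>\<^sup>+x. ennreal (exp (\<delta> * \<bar>x\<bar>) * (1 + \<bar>x\<bar>) ^ k) * (r x * ennreal (B x) + q x * ennreal (exp (- 2 * \<delta> * \<bar>x\<bar>))) \<partial>lborel))"
proof -
  interpret M: sigma_finite_measure M by (rule sigma_finite_M)
  interpret N: sigma_finite_measure N by (rule sigma_finite_N)
  interpret pairM: pair_sigma_finite M lborel ..
  interpret pairN: pair_sigma_finite N lborel ..
  define E where "E x = ennreal (exp (\<delta> * \<bar>x\<bar>))" for x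
  define P where "P x = ennreal ((1 + \<bar>x\<bar>) ^ k)" for x :: real
  have [measurable]: "E \<in> borel_measurable borel" "P \<in> borel_measurable borel" by (auto simp: E_def[abs_def] P_def[abs_def])
  have EP: "ennreal (exp (\<delta> * \<bar>x\<bar>) * (1 + \<bar>x\<bar>) ^ k) = E x * P x" for x
    unfolding E_def P_def by (rule ennreal_mult) auto
  define I where "I x = r x * ennreal (B x) + q x * ennreal (exp (- 2 * \<delta> * \<bar>x\<bar>))" for x
  have [measurable]: "I \<in> borel_measurable borel" unfolding I_def[abs_def] by measurable
  have loc: "(\<integral>\<^sup>+t. v t * near \<delta> 1 x t \<partial>M) \<le> ennreal C * (P x * ((\<integral>\<^sup>+s. w s * near \<delta> 2 x s \<partial>N) + I x))" for x
  proof -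
    define U where "U = (SUP t\<in>centred_interval 1 x \<delta>. v t)"
    have mem: "t \<in> centred_interval c x \<delta> \<longleftrightarrow> \<bar>t - x\<bar> \<le> c * exp (- \<delta> * \<bar>x\<bar>)" for t c
      by (auto simp: centred_interval_def)
    have vU: "v t * near \<delta> 1 x t \<le> U * indicator (centred_interval 1 x \<delta>) t" for t
      unfolding near_indicator[symmetric] U_def by (auto simp: indicator_def intro: SUP_upper)
    have Uq: "U \<le> q x" unfolding U_def by (rule SUP_least) (use vq in \<open>auto simp: mem\<close>)
    have Uw: "U \<le> w s + r x" if "s \<in> centred_interval 2 x \<delta>" for s
      unfolding U_def by (rule SUP_least) (use vw that in \<open>auto simp: mem\<close>)
    have cs: "centred_interval c x \<delta> \<in> sets borel" for c unfolding centred_interval_def by simp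
    have "(\<integral>\<^sup>+t. v t * near \<delta> 1 x t \<partial>M) \<le> (\<integral>\<^sup>+t. U * indicator (centred_interval 1 x \<delta>) t \<partial>M)"
      by (rule nn_integral_mono) (rule vU)
    also have "\<dots> = U * emeasure M (centred_interval 1 x \<delta>)"
      by (rule nn_integral_cmult_indicator) (use cs sets_M in simp)
    also have "\<dots> \<le> U * (ennreal (C * (1 + \<bar>x\<bar>) ^ k) * (emeasure N (centred_interval 2 x \<delta>) + ennreal (exp (- 2 * \<delta> * \<bar>x\<bar>))))"
      by (rule mult_left_mono[OF compare]) simp
    also have "ennreal (C * (1 + \<bar>x\<bar>) ^ k) = ennreal C * P x"
      unfolding P_def by (rule ennreal_mult) (use C in auto)
    also have "U * (ennreal C * P x * (emeasure N (centred_interval 2 x \<delta>) + ennreal (exp (- 2 * \<delta> * \<bar>x\<bar>))))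
        = ennreal C * (P x * (U * emeasure N (centred_interval 2 x \<delta>) + U * ennreal (exp (- 2 * \<delta> * \<bar>x\<bar>))))"
      by (simp add: distrib_left mult_ac)
    also have "U * emeasure N (centred_interval 2 x \<delta>) = (\<integral>\<^sup>+s. U * indicator (centred_interval 2 x \<delta>) s \<partial>N)"
      by (rule nn_integral_cmult_indicator[symmetric]) (use cs sets_N in simp)
    also have "\<dots> \<le> (\<integral>\<^sup>+s. w s * near \<delta> 2 x s + r x * indicator (centred_interval 2 x \<delta>) s \<partial>N)"
    proof (rule nn_integral_mono)
      fix s
      show "U * indicator (centred_interval 2 x \<delta>) s \<le> w s * near \<delta> 2 x s + r x * indicator (centred_interval 2 x \<delta>) s"
        unfolding near_indicator[symmetric] using Uw[of s] by (auto simp: indicator_def)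
    qed
    also have "\<dots> = (\<integral>\<^sup>+s. w s * near \<delta> 2 x s \<partial>N) + (\<integral>\<^sup>+s. r x * indicator (centred_interval 2 x \<delta>) s \<partial>N)"
      by (rule nn_integral_add) (use cs sets_N in measurable)
    also have "(\<integral>\<^sup>+s. r x * indicator (centred_interval 2 x \<delta>) s \<partial>N) = r x * emeasure N (centred_interval 2 x \<delta>)"
      by (rule nn_integral_cmult_indicator) (use cs sets_N in simp)
    also have "\<dots> \<le> r x * ennreal (B x)" by (rule mult_left_mono[OF B]) simp
    also have "U * ennreal (exp (- 2 * \<delta> * \<bar>x\<bar>)) \<le> q x * ennreal (exp (- 2 * \<delta> * \<bar>x\<bar>))"
      by (rule mult_right_mono[OF Uq]) simp
    finally show ?thesis
      by (simp add: I_def add.assoc mult_left_mono add_mono)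
  qed
  have "ennreal (2 * exp (- 2 * \<delta>)) * (\<integral>\<^sup>+t. v t \<partial>M) = (\<integral>\<^sup>+t. ennreal (2 * exp (- 2 * \<delta>)) * v t \<partial>M)"
    by (rule nn_integral_cmult[symmetric]) measurable
  also have "\<dots> \<le> (\<integral>\<^sup>+t. (\<integral>\<^sup>+x. E x * near \<delta> 1 x t \<partial>lborel) * v t \<partial>M)"
    unfolding E_def by (intro nn_integral_mono mult_right_mono near_integral_lower \<delta>) simp
  also have "\<dots> = (\<integral>\<^sup>+t. (\<integral>\<^sup>+x. E x * near \<delta> 1 x t * v t \<partial>lborel) \<partial>M)"
    by (intro nn_integral_cong nn_integral_multc[symmetric]) measurable
  also have "\<dots> = (\<integral>\<^sup>+x. (\<integral>\<^sup>+t. E x * near \<delta> 1 x t * v t \<partial>M) \<partial>lborel)"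
    by (rule pairM.Fubini'[symmetric]) measurable
  also have "\<dots> = (\<integral>\<^sup>+x. E x * (\<integral>\<^sup>+t. v t * near \<delta> 1 x t \<partial>M) \<partial>lborel)"
    by (intro nn_integral_cong, subst nn_integral_cmult[symmetric]) (measurable, simp add: mult_ac)
  also have "\<dots> \<le> (\<integral>\<^sup>+x. ennreal C * ((\<integral>\<^sup>+s. E x * P x * (w s * near \<delta> 2 x s) \<partial>N) + E x * P x * I x) \<partial>lborel)"
  proof (rule nn_integral_mono)
    fix x
    have "E x * (\<integral>\<^sup>+t. v t * near \<delta> 1 x t \<partial>M) \<le> E x * (ennreal C * (P x * ((\<integral>\<^sup>+s. w s * near \<delta> 2 x s \<partial>N) + I x)))"
      by (rule mult_left_mono[OF loc]) simp
    also have "\<dots> = ennreal C * (E x * P x * (\<integral>\<^sup>+s. w s * near \<delta> 2 x s \<partial>N) + E x * P x * I x)"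
      by (simp add: distrib_left mult_ac)
    also have "E x * P x * (\<integral>\<^sup>+s. w s * near \<delta> 2 x s \<partial>N) = (\<integral>\<^sup>+s. E x * P x * (w s * near \<delta> 2 x s) \<partial>N)"
      by (rule nn_integral_cmult[symmetric]) measurable
    finally show "E x * (\<integral>\<^sup>+t. v t * near \<delta> 1 x t \<partial>M) \<le> ennreal C * ((\<integral>\<^sup>+s. E x * P x * (w s * near \<delta> 2 x s) \<partial>N) + E x * P x * I x)" .
  qed
  also have "\<dots> = ennreal C * (\<integral>\<^sup>+x. (\<integral>\<^sup>+s. E x * P x * (w s * near \<delta> 2 x s) \<partial>N) + E x * P x * I x \<partial>lborel)"
    by (rule nn_integral_cmult) measurable
  also have "(\<integral>\<^sup>+x. (\<integral>\<^sup>+s. E x * P x * (w s * near \<delta> 2 x s) \<partial>N) + E x * P x * I x \<partial>lborel)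
     = (\<integral>\<^sup>+x. (\<integral>\<^sup>+s. E x * P x * (w s * near \<delta> 2 x s) \<partial>N) \<partial>lborel) + (\<integral>\<^sup>+x. E x * P x * I x \<partial>lborel)"
    by (rule nn_integral_add) measurable
  also have "(\<integral>\<^sup>+x. (\<integral>\<^sup>+s. E x * P x * (w s * near \<delta> 2 x s) \<partial>N) \<partial>lborel) = (\<integral>\<^sup>+s. (\<integral>\<^sup>+x. E x * P x * (w s * near \<delta> 2 x s) \<partial>lborel) \<partial>N)"
    by (rule pairN.Fubini') measurable
  also have "\<dots> = (\<integral>\<^sup>+s. (\<integral>\<^sup>+x. E x * P x * near \<delta> 2 x s \<partial>lborel) * w s \<partial>N)"
    by (intro nn_integral_cong, subst nn_integral_multc[symmetric]) (measurable, simp add: mult_ac)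
  also have "\<dots> \<le> (\<integral>\<^sup>+s. ennreal (4 * exp (4 * \<delta>) * 3 ^ k) * P s * w s \<partial>N)"
    unfolding P_def EP[symmetric, unfolded P_def] by (intro nn_integral_mono mult_right_mono near_integral_upper \<delta>) simp
  also have "\<dots> = ennreal (4 * exp (4 * \<delta>) * 3 ^ k) * (\<integral>\<^sup>+s. P s * w s \<partial>N)"
    by (subst nn_integral_cmult[symmetric]) (measurable, simp add: mult_ac)
  finally show ?thesis
    unfolding EP P_def[symmetric] I_def[symmetric] by (simp add: mult_left_mono add_right_mono)
qed

end

section \<open>Comparison of norms\<close>

context comparison
begin

lemma interval_bound_N:
  obtains D :: real and m :: nat where "D \<ge> 0"
    "\<And>x. emeasure N (centred_interval 2 x \<delta>) \<le> ennreal (D * (1 + \<bar>x\<bar>) ^ m)"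
    "(\<integral>\<^sup>+t. ennreal (1 / (1 + \<bar>t\<bar>) ^ m) \<partial>N) < \<infinity>"
proof -
  obtain m :: nat where m: "(\<integral>\<^sup>+t. ennreal (1 / (1 + \<bar>t\<bar>) ^ m) \<partial>N) < \<infinity>"
    using N unfolding tempered_def by blast
  define L where "L = enn2real (\<integral>\<^sup>+t. ennreal (1 / (1 + \<bar>t\<bar>) ^ m) \<partial>N)"
  have L: "(\<integral>\<^sup>+t. ennreal (1 / (1 + \<bar>t\<bar>) ^ m) \<partial>N) = ennreal L" "L \<ge> 0"
    using m by (auto simp: L_def less_top)
  show ?thesis
  proof (rule that[of "3 ^ m * L" m])
    show "3 ^ m * L \<ge> 0" using L by simp
    show "(\<integral>\<^sup>+t. ennreal (1 / (1 + \<bar>t\<bar>) ^ m) \<partial>N) < \<infinity>" by (rule m)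
    fix x :: real
    define c where "c = 3 ^ m * (1 + \<bar>x\<bar>) ^ m"
    have c: "c \<ge> 0" by (simp add: c_def)
    have cs: "centred_interval 2 x \<delta> \<in> sets N" by (simp add: centred_interval_def sets_N)
    have "emeasure N (centred_interval 2 x \<delta>) = (\<integral>\<^sup>+s. indicator (centred_interval 2 x \<delta>) s \<partial>N)" using cs by simp
    also have "\<dots> \<le> (\<integral>\<^sup>+s. ennreal c * ennreal (1 / (1 + \<bar>s\<bar>) ^ m) \<partial>N)"
    proof (rule nn_integral_mono)
      fix s
      show "indicator (centred_interval 2 x \<delta>) s \<le> ennreal c * ennreal (1 / (1 + \<bar>s\<bar>) ^ m)"
      proof (cases "s \<in> centred_interval 2 x \<delta>")
        case True
        then have "\<bar>s - x\<bar> \<le> 2 * exp (- \<delta> * \<bar>x\<bar>)" by (auto simp: centred_interval_def)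
        then have "\<bar>s - x\<bar> \<le> 2" by (rule near_dist[OF _ \<delta>]) simp
        then have "(1 + \<bar>s\<bar>) ^ m \<le> (3 * (1 + \<bar>x\<bar>)) ^ m" by (intro power_mono) auto
        then have "(1 + \<bar>s\<bar>) ^ m \<le> c" by (simp only: power_mult_distrib c_def)
        then have "1 \<le> c * (1 / (1 + \<bar>s\<bar>) ^ m)" by (simp add: add_pos_nonneg)
        then have "ennreal 1 \<le> ennreal (c * (1 / (1 + \<bar>s\<bar>) ^ m))" by (rule ennreal_leI)
        moreover have "ennreal c * ennreal (1 / (1 + \<bar>s\<bar>) ^ m) = ennreal (c * (1 / (1 + \<bar>s\<bar>) ^ m))"
          by (rule ennreal_mult[symmetric]) (use c in auto)
        ultimately show ?thesis using True by (simp only: indicator_simps ennreal_1)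
      qed simp
    qed
    also have "\<dots> = ennreal c * ennreal L" unfolding L(1)[symmetric] by (rule nn_integral_cmult) measurable
    also have "\<dots> = ennreal (3 ^ m * L * (1 + \<bar>x\<bar>) ^ m)"
      using c L by (simp add: c_def ennreal_mult[symmetric] mult_ac)
    finally show "emeasure N (centred_interval 2 x \<delta>) \<le> ennreal (3 ^ m * L * (1 + \<bar>x\<bar>) ^ m)" .
  qed
qed

text \<open>
  Apply the inequality to \<open>v t = 1 / (1 + \<bar>t\<bar>) ^ j\<close>, which varies by a bounded
  factor on each interval.
\<close>

lemma tempered_M: "tempered M"
proof (rule interval_bound_N)
  fix D :: real and m :: nat
  assume D: "D \<ge> 0" "\<And>x. emeasure N (centred_interval 2 x \<delta>) \<le> ennreal (D * (1 + \<bar>x\<bar>) ^ m)"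
    and m: "(\<integral>\<^sup>+t. ennreal (1 / (1 + \<bar>t\<bar>) ^ m) \<partial>N) < \<infinity>"
  define j where "j = k + m"
  have "ennreal (2 * exp (- 2 * \<delta>)) * (\<integral>\<^sup>+t. ennreal (1 / (1 + \<bar>t\<bar>) ^ j) \<partial>M) \<le>
     ennreal C * (ennreal (4 * exp (4 * \<delta>) * 3 ^ k) * (\<integral>\<^sup>+s. ennreal ((1 + \<bar>s\<bar>) ^ k) * ennreal (4 ^ j / (1 + \<bar>s\<bar>) ^ j) \<partial>N)
      + (\<integral>\<^sup>+x. ennreal (exp (\<delta> * \<bar>x\<bar>) * (1 + \<bar>x\<bar>) ^ k) * (0 * ennreal (D * (1 + \<bar>x\<bar>) ^ m) + 1 * ennreal (exp (- 2 * \<delta> * \<bar>x\<bar>))) \<partial>lborel))"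
  proof (rule transfer_inequality[OF _ _ _ _ _ _ D(2)])
    show "ennreal (1 / (1 + \<bar>t\<bar>) ^ j) \<le> 1" for t :: real
    proof -
      have "ennreal (1 / (1 + \<bar>t\<bar>) ^ j) \<le> ennreal 1" by (rule ennreal_leI) (simp add: one_le_power)
      then show ?thesis by (simp only: ennreal_1)
    qed
    fix x t s :: real
    assume t: "\<bar>t - x\<bar> \<le> exp (- \<delta> * \<bar>x\<bar>)" and s: "\<bar>s - x\<bar> \<le> 2 * exp (- \<delta> * \<bar>x\<bar>)"
    have "\<bar>t - x\<bar> \<le> 1" by (rule near_dist[of _ _ _ \<delta>]) (use t \<delta> in auto)
    moreover have "\<bar>s - x\<bar> \<le> 2" by (rule near_dist[OF s \<delta>]) simp
    ultimately have "(1 + \<bar>s\<bar>) ^ j \<le> (4 * (1 + \<bar>t\<bar>)) ^ j" by (intro power_mono) auto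
    then have "(1 + \<bar>s\<bar>) ^ j \<le> 4 ^ j * (1 + \<bar>t\<bar>) ^ j" by (simp only: power_mult_distrib)
    moreover have "(1 + \<bar>s\<bar>) ^ j > 0" "(1 + \<bar>t\<bar>) ^ j > 0" by simp_all
    ultimately have "1 / (1 + \<bar>t\<bar>) ^ j \<le> 4 ^ j / (1 + \<bar>s\<bar>) ^ j" by (simp add: field_simps)
    then show "ennreal (1 / (1 + \<bar>t\<bar>) ^ j) \<le> ennreal (4 ^ j / (1 + \<bar>s\<bar>) ^ j) + 0"
      by (simp add: ennreal_leI)
  qed auto
  also have "\<dots> < \<infinity>"
  proof -
    have 1: "ennreal ((1 + \<bar>s\<bar>) ^ k) * ennreal (4 ^ j / (1 + \<bar>s\<bar>) ^ j) = ennreal (4 ^ j) * ennreal (1 / (1 + \<bar>s\<bar>) ^ m)" for s :: real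
    proof -
      have "(1 + \<bar>s\<bar>) ^ k * (4 ^ j / (1 + \<bar>s\<bar>) ^ j) = 4 ^ j * (1 / (1 + \<bar>s\<bar>) ^ m)"
        using one_plus_abs_pos[of s] by (simp add: j_def power_add)
      then show ?thesis by (simp add: ennreal_mult[symmetric])
    qed
    have "(\<integral>\<^sup>+s. ennreal ((1 + \<bar>s\<bar>) ^ k) * ennreal (4 ^ j / (1 + \<bar>s\<bar>) ^ j) \<partial>N) = ennreal (4 ^ j) * (\<integral>\<^sup>+s. ennreal (1 / (1 + \<bar>s\<bar>) ^ m) \<partial>N)"
      unfolding 1 by (rule nn_integral_cmult) measurable
    also have "\<dots> < \<infinity>" using m by (simp add: ennreal_mult_less_top)
    finally have A: "(\<integral>\<^sup>+s. ennreal ((1 + \<bar>s\<bar>) ^ k) * ennreal (4 ^ j / (1 + \<bar>s\<bar>) ^ j) \<partial>N) < \<infinity>" .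
    have 2: "ennreal (exp (\<delta> * \<bar>x\<bar>) * (1 + \<bar>x\<bar>) ^ k) * (0 * ennreal (D * (1 + \<bar>x\<bar>) ^ m) + 1 * ennreal (exp (- 2 * \<delta> * \<bar>x\<bar>)))
        = ennreal (exp (- \<delta> * \<bar>x\<bar>) * (1 + \<bar>x\<bar>) ^ k)" for x :: real
    proof -
      have "exp (\<delta> * \<bar>x\<bar>) * (1 + \<bar>x\<bar>) ^ k * exp (- 2 * \<delta> * \<bar>x\<bar>) = (exp (\<delta> * \<bar>x\<bar>) * exp (- 2 * \<delta> * \<bar>x\<bar>)) * (1 + \<bar>x\<bar>) ^ k"
        by (simp only: mult_ac)
      also have "exp (\<delta> * \<bar>x\<bar>) * exp (- 2 * \<delta> * \<bar>x\<bar>) = exp (- \<delta> * \<bar>x\<bar>)" by (simp add: mult_exp_exp)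
      finally show ?thesis by (simp add: ennreal_mult[symmetric])
    qed
    have B: "(\<integral>\<^sup>+x. ennreal (exp (\<delta> * \<bar>x\<bar>) * (1 + \<bar>x\<bar>) ^ k) * (0 * ennreal (D * (1 + \<bar>x\<bar>) ^ m) + 1 * ennreal (exp (- 2 * \<delta> * \<bar>x\<bar>))) \<partial>lborel) < \<infinity>"
      unfolding 2 by (rule exp_decay_integral[OF \<delta>])
    show ?thesis using A B by (simp add: ennreal_mult_less_top)
  qed
  finally have "(\<integral>\<^sup>+t. ennreal (1 / (1 + \<bar>t\<bar>) ^ j) \<partial>M) < \<infinity>"
    by (auto simp: ennreal_mult_less_top)
  then show ?thesis using sets_M unfolding tempered_def by blast
qed

end

text \<open>
  Cauchy's estimate on discs of radius one.
\<close>

lemma lipschitz_from_strip: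
  assumes hol: "F holomorphic_on UNIV" and S: "\<And>z. \<bar>Re z - x\<bar> \<le> 3 \<Longrightarrow> \<bar>Im z\<bar> \<le> 1 \<Longrightarrow> cmod (F z) \<le> S"
    and t: "\<bar>t - x\<bar> \<le> 2" and s: "\<bar>s - x\<bar> \<le> 2"
  shows "cmod (F (of_real t) - F (of_real s)) \<le> S * \<bar>t - s\<bar>"
proof -
  let ?A = "of_real ` {x - 2..x + 2} :: complex set"
  have "norm (F (of_real t) - F (of_real s)) \<le> S * norm (of_real t - of_real s :: complex)"
  proof (rule field_differentiable_bound[of ?A F "deriv F" S])
    show "convex ?A"
      by (rule convex_linear_image) (auto intro: bounded_linear.linear bounded_linear_of_real)
    fix w assume "w \<in> ?A"
    then obtain r where r: "w = of_real r" "\<bar>r - x\<bar> \<le> 2" by auto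
    show "(F has_field_derivative deriv F w) (at w within ?A)"
      using holomorphic_derivI[OF hol open_UNIV, of w] has_field_derivative_at_within by blast
    have "norm ((deriv ^^ 1) F w) \<le> fact 1 * S / 1 ^ 1"
    proof (rule Cauchy_inequality)
      show "F holomorphic_on ball w 1" by (rule holomorphic_on_subset[OF hol]) simp
      show "continuous_on (cball w 1) F"
        by (rule continuous_on_subset[OF holomorphic_on_imp_continuous_on[OF hol]]) simp
      fix z assume z: "norm (w - z) = 1"
      have "\<bar>Re (w - z)\<bar> \<le> 1" "\<bar>Im (w - z)\<bar> \<le> 1"
        using abs_Re_le_cmod[of "w - z"] abs_Im_le_cmod[of "w - z"] z by auto
      then show "norm (F z) \<le> S" using r by (intro S) auto
    qed simp
    then show "norm (deriv F w) \<le> S" by simp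
  next
    show "of_real t \<in> ?A" by (rule imageI) (use t in \<open>auto simp: abs_le_iff\<close>)
    show "of_real s \<in> ?A" by (rule imageI) (use s in \<open>auto simp: abs_le_iff\<close>)
  qed
  also have "norm (of_real t - of_real s :: complex) = \<bar>t - s\<bar>"
    unfolding of_real_diff[symmetric] norm_of_real ..
  finally show ?thesis .
qed

definition wnorm_sq :: "real measure \<Rightarrow> nat \<Rightarrow> (complex \<Rightarrow> complex) \<Rightarrow> real" where
  "wnorm_sq N k F = (LINT s|N. (1 + \<bar>s\<bar>) ^ k * (cmod (F (of_real s)))\<^sup>2)"

lemma wnorm_sq_nonneg: "wnorm_sq N k F \<ge> 0"
  unfolding wnorm_sq_def by (intro Bochner_Integration.integral_nonneg mult_nonneg_nonneg) auto

context comparison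
begin

text \<open>
  On the interval around \<open>x\<close> the function \<open>F\<close> varies by at most \<open>3 * exp
  (- \<delta> * \<bar>x\<bar>) * \<sigma> x\<close>, where \<open>\<sigma> x\<close> bounds
  \<open>F\<close> near \<open>x\<close>. For \<open>\<bar>x\<bar> \<le> R\<close> the supremum
  \<open>S\<close> over the disc serves as \<open>\<sigma> x\<close>, for larger \<open>x\<close> a
  multiple of \<open>norm F * exp (\<delta> / 8 * \<bar>x\<bar>)\<close>. The intervals with
  \<open>\<bar>x\<bar> > R\<close> contribute at most \<open>exp (- (\<delta> / 4) * R)\<close> times a
  multiple of the square of the norm of \<open>F\<close>; for large \<open>R\<close> this is absorbed into
  the left-hand side.
\<close>

lemma norm_estimate:
  assumes b: "b > 0" and K: "K > 0"
    and eval: "\<And>F z. F \<in> PW b \<Longrightarrow> \<bar>Im z\<bar> \<le> 1 \<Longrightarrow>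
      cmod (F z) \<le> K * L2_norm M (\<lambda>t. F (of_real t)) * exp (\<delta> / 8 * \<bar>Re z\<bar>)"
  obtains A R where "A > 0" "R \<ge> 1"
    "\<And>F S. F \<in> PW b \<Longrightarrow> (\<And>z. cmod z \<le> R \<Longrightarrow> cmod (F z) \<le> S) \<Longrightarrow>
      (L2_norm M (\<lambda>t. F (of_real t)))\<^sup>2 \<le> A * (wnorm_sq N k F + S\<^sup>2)"
proof (rule interval_bound_N)
  fix D :: real and m :: nat
  assume D: "D \<ge> 0" "\<And>x. emeasure N (centred_interval 2 x \<delta>) \<le> ennreal (D * (1 + \<bar>x\<bar>) ^ m)"
  define K' where "K' = K * exp (3 * (\<delta> / 8))"
  define L where "L = enn2real (\<integral>\<^sup>+x. ennreal (exp (- (\<delta> / 2) * \<bar>x\<bar>) * (1 + \<bar>x\<bar>) ^ (k + m)) \<partial>lborel)"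
  have L: "(\<integral>\<^sup>+x. ennreal (exp (- (\<delta> / 2) * \<bar>x\<bar>) * (1 + \<bar>x\<bar>) ^ (k + m)) \<partial>lborel) = ennreal L" "L \<ge> 0"
    using exp_decay_integral[of "\<delta> / 2" "k + m"] \<delta> by (auto simp: L_def less_top)
  define c0 where "c0 = 2 * exp (- 2 * \<delta>)"
  define c1 where "c1 = 4 * exp (4 * \<delta>) * 3 ^ k"
  define c2 where "c2 = (18 * D + 1) * L"
  have c: "c0 > 0" "c1 \<ge> 0" "c2 \<ge> 0" using D L by (auto simp: c0_def c1_def c2_def)
  define a1 a2 where "a1 = C * (c1 * 2) / c0" and "a2 = C * c2 / c0"
  have a: "a1 \<ge> 0" "a2 \<ge> 0" using c C by (auto simp: a1_def a2_def)
  \<comment> \<open>large enough for the error terms far from the origin to be absorbed\<close>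
  define R where "R = 2 * a2 * K'\<^sup>2 / (\<delta> / 4)"
  have R: "R \<ge> 0" using a \<delta> by (simp add: R_def)
  have tail: "a2 * K'\<^sup>2 * exp (- (\<delta> / 4) * R) \<le> 1 / 2"
  proof -
    have "2 * (a2 * K'\<^sup>2) = \<delta> / 4 * R" using \<delta> by (simp add: R_def)
    also have "\<dots> \<le> exp (\<delta> / 4 * R)" using exp_ge_add_one_self[of "\<delta> / 4 * R"] by linarith
    finally have "2 * (a2 * K'\<^sup>2) * exp (- (\<delta> / 4) * R) \<le> exp (\<delta> / 4 * R) * exp (- (\<delta> / 4) * R)"
      by (rule mult_right_mono) simp
    then show ?thesis by (simp add: mult_exp_exp)
  qed
  have main: "(L2_norm M (\<lambda>t. F (of_real t)))\<^sup>2 \<le> 2 * a1 * wnorm_sq N k F + 2 * a2 * S\<^sup>2"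
    if F: "F \<in> PW b" and S: "\<And>z. cmod z \<le> R + 4 \<Longrightarrow> cmod (F z) \<le> S" for F S
  proof -
    define n where "n = L2_norm M (\<lambda>t. F (of_real t))"
    define T where "T = K' * n"
    have n: "n \<ge> 0" by (simp add: n_def L2_norm_nonneg)
    have S0: "S \<ge> 0" using S[of 0] R norm_ge_zero[of "F 0"] by (simp del: norm_ge_zero)
    have FM: "(\<lambda>t. F (of_real t)) \<in> borel_measurable borel" by (rule PW_borel[OF F])
    note [measurable] = FM
    define \<sigma> where "\<sigma> x = (if \<bar>x\<bar> \<le> R then S else T * exp (\<delta> / 8 * \<bar>x\<bar>))" for x :: real
    have [measurable]: "\<sigma> \<in> borel_measurable borel" unfolding \<sigma>_def[abs_def] by measurable
    have \<sigma>: "cmod (F z) \<le> \<sigma> x" if z: "\<bar>Re z - x\<bar> \<le> 3" "\<bar>Im z\<bar> \<le> 1" for x z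
    proof (cases "\<bar>x\<bar> \<le> R")
      case True
      have "cmod z \<le> \<bar>Re z\<bar> + \<bar>Im z\<bar>" by (rule cmod_le)
      also have "\<dots> \<le> R + 4" using z True by linarith
      finally show ?thesis using S True by (simp add: \<sigma>_def)
    next
      case False
      have "\<delta> / 8 * \<bar>Re z\<bar> \<le> \<delta> / 8 * (\<bar>x\<bar> + 3)" by (rule mult_left_mono) (use z \<delta> in linarith)+
      then have "exp (\<delta> / 8 * \<bar>Re z\<bar>) \<le> exp (3 * (\<delta> / 8)) * exp (\<delta> / 8 * \<bar>x\<bar>)"
        by (simp add: exp_add[symmetric] algebra_simps)
      then have "K * n * exp (\<delta> / 8 * \<bar>Re z\<bar>) \<le> K * n * (exp (3 * (\<delta> / 8)) * exp (\<delta> / 8 * \<bar>x\<bar>))"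
        by (rule mult_left_mono) (use K n in simp)
      then show ?thesis
        using eval[OF F z(2)] False by (simp add: \<sigma>_def T_def K'_def n_def mult_ac)
    qed
    have \<sigma>0: "\<sigma> x \<ge> 0" for x
      using S0 n K by (simp add: \<sigma>_def T_def K'_def)
    have dist: "\<bar>t - x\<bar> \<le> 1" if "\<bar>t - x\<bar> \<le> exp (- \<delta> * \<bar>x\<bar>)" for t x :: real
      by (rule near_dist[of _ _ _ \<delta>]) (use that \<delta> in auto)
    have "ennreal c0 * (\<integral>\<^sup>+t. ennreal ((cmod (F (of_real t)))\<^sup>2) \<partial>M) \<le>
       ennreal C * (ennreal c1 * (\<integral>\<^sup>+s. ennreal ((1 + \<bar>s\<bar>) ^ k) * ennreal (2 * (cmod (F (of_real s)))\<^sup>2) \<partial>N)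
        + (\<integral>\<^sup>+x. ennreal (exp (\<delta> * \<bar>x\<bar>) * (1 + \<bar>x\<bar>) ^ k) * (ennreal (18 * exp (- 2 * \<delta> * \<bar>x\<bar>) * (\<sigma> x)\<^sup>2) * ennreal (D * (1 + \<bar>x\<bar>) ^ m) + ennreal ((\<sigma> x)\<^sup>2) * ennreal (exp (- 2 * \<delta> * \<bar>x\<bar>))) \<partial>lborel))"
      unfolding c0_def c1_def
    proof (rule transfer_inequality[OF _ _ _ _ _ _ D(2)])
      fix x t :: real assume t: "\<bar>t - x\<bar> \<le> exp (- \<delta> * \<bar>x\<bar>)"
      have "cmod (F (of_real t)) \<le> \<sigma> x" by (rule \<sigma>) (use dist[OF t] in auto)
      then show "ennreal ((cmod (F (of_real t)))\<^sup>2) \<le> ennreal ((\<sigma> x)\<^sup>2)" by (intro ennreal_leI power_mono) auto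
      fix s :: real assume s: "\<bar>s - x\<bar> \<le> 2 * exp (- \<delta> * \<bar>x\<bar>)"
      have s2: "\<bar>s - x\<bar> \<le> 2" by (rule near_dist[OF s \<delta>]) simp
      have "cmod (F (of_real t) - F (of_real s)) \<le> \<sigma> x * \<bar>t - s\<bar>"
        by (rule lipschitz_from_strip[OF PW_holomorphic[OF F] \<sigma> _ s2]) (use dist[OF t] in auto)
      also have "\<dots> \<le> \<sigma> x * (3 * exp (- \<delta> * \<bar>x\<bar>))"
        by (rule mult_left_mono[OF _ \<sigma>0]) (use s t in linarith)
      finally have "(cmod (F (of_real t) - F (of_real s)))\<^sup>2 \<le> (\<sigma> x * (3 * exp (- \<delta> * \<bar>x\<bar>)))\<^sup>2"
        by (intro power_mono) auto
      also have "\<dots> = 9 * exp (- 2 * \<delta> * \<bar>x\<bar>) * (\<sigma> x)\<^sup>2"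
        by (simp add: power_mult_distrib exp_double[symmetric] mult_ac)
      finally have "(cmod (F (of_real t)))\<^sup>2 \<le> 2 * (cmod (F (of_real s)))\<^sup>2 + 18 * exp (- 2 * \<delta> * \<bar>x\<bar>) * (\<sigma> x)\<^sup>2"
        using norm_lin_sq[of "F (of_real s)" "F (of_real t) - F (of_real s)"] by simp
      then have "ennreal ((cmod (F (of_real t)))\<^sup>2) \<le> ennreal (2 * (cmod (F (of_real s)))\<^sup>2 + 18 * exp (- 2 * \<delta> * \<bar>x\<bar>) * (\<sigma> x)\<^sup>2)"
        by (rule ennreal_leI)
      also have "\<dots> = ennreal (2 * (cmod (F (of_real s)))\<^sup>2) + ennreal (18 * exp (- 2 * \<delta> * \<bar>x\<bar>) * (\<sigma> x)\<^sup>2)"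
        by (rule ennreal_plus) auto
      finally show "ennreal ((cmod (F (of_real t)))\<^sup>2) \<le> ennreal (2 * (cmod (F (of_real s)))\<^sup>2) + ennreal (18 * exp (- 2 * \<delta> * \<bar>x\<bar>) * (\<sigma> x)\<^sup>2)" .
    qed measurable
    also have "(\<integral>\<^sup>+t. ennreal ((cmod (F (of_real t)))\<^sup>2) \<partial>M) = ennreal (n\<^sup>2)"
      unfolding n_def L2_norm_sq
      by (rule nn_integral_eq_integral[OF L2_D(2)[OF PW_L2[OF tempered_M F b]]]) (intro AE_I2, simp)
    also have "(\<integral>\<^sup>+s. ennreal ((1 + \<bar>s\<bar>) ^ k) * ennreal (2 * (cmod (F (of_real s)))\<^sup>2) \<partial>N) = ennreal (2 * wnorm_sq N k F)"
    proof -
      have "(\<integral>\<^sup>+s. ennreal ((1 + \<bar>s\<bar>) ^ k) * ennreal (2 * (cmod (F (of_real s)))\<^sup>2) \<partial>N)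
          = (\<integral>\<^sup>+s. ennreal (2 * ((1 + \<bar>s\<bar>) ^ k * (cmod (F (of_real s)))\<^sup>2)) \<partial>N)"
        by (rule nn_integral_cong) (simp add: ennreal_mult[symmetric] mult_ac)
      also have "\<dots> = ennreal (LINT s|N. 2 * ((1 + \<bar>s\<bar>) ^ k * (cmod (F (of_real s)))\<^sup>2))"
        by (rule nn_integral_eq_integral[OF integrable_mult_right[OF tempered_PW_integrable[OF N F b]]]) (intro AE_I2, simp)
      finally show ?thesis by (simp add: wnorm_sq_def)
    qed
    also have "(\<integral>\<^sup>+x. ennreal (exp (\<delta> * \<bar>x\<bar>) * (1 + \<bar>x\<bar>) ^ k) * (ennreal (18 * exp (- 2 * \<delta> * \<bar>x\<bar>) * (\<sigma> x)\<^sup>2) * ennreal (D * (1 + \<bar>x\<bar>) ^ m) + ennreal ((\<sigma> x)\<^sup>2) * ennreal (exp (- 2 * \<delta> * \<bar>x\<bar>))) \<partial>lborel)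
       \<le> ennreal ((S\<^sup>2 + T\<^sup>2 * exp (- (\<delta> / 4) * R)) * c2)"
    proof -
      define Q where "Q = S\<^sup>2 + T\<^sup>2 * exp (- (\<delta> / 4) * R)"
      have Q: "Q \<ge> 0" by (simp add: Q_def)
      have \<sigma>Q: "exp (- \<delta> * \<bar>x\<bar>) * (\<sigma> x)\<^sup>2 \<le> Q * exp (- (\<delta> / 2) * \<bar>x\<bar>)" for x
      proof (cases "\<bar>x\<bar> \<le> R")
        case True
        have "exp (- \<delta> * \<bar>x\<bar>) * S\<^sup>2 \<le> exp (- (\<delta> / 2) * \<bar>x\<bar>) * Q"
          using \<delta> by (intro mult_mono) (auto simp: Q_def mult_right_mono)
        then show ?thesis using True by (simp add: \<sigma>_def mult.commute)
      next
        case False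
        have "exp (- \<delta> * \<bar>x\<bar>) * (\<sigma> x)\<^sup>2 = T\<^sup>2 * (exp (- \<delta> * \<bar>x\<bar>) * (exp (\<delta> / 8 * \<bar>x\<bar>))\<^sup>2)"
          using False by (simp add: \<sigma>_def power_mult_distrib mult_ac)
        also have "exp (- \<delta> * \<bar>x\<bar>) * (exp (\<delta> / 8 * \<bar>x\<bar>))\<^sup>2 = exp (- (\<delta> / 4) * \<bar>x\<bar>) * exp (- (\<delta> / 2) * \<bar>x\<bar>)"
          unfolding exp_double[symmetric] mult_exp_exp by (simp add: field_simps)
        also have "T\<^sup>2 * (exp (- (\<delta> / 4) * \<bar>x\<bar>) * exp (- (\<delta> / 2) * \<bar>x\<bar>)) \<le> T\<^sup>2 * (exp (- (\<delta> / 4) * R) * exp (- (\<delta> / 2) * \<bar>x\<bar>))"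
          using False \<delta> by (intro mult_left_mono mult_right_mono) auto
        also have "\<dots> \<le> Q * exp (- (\<delta> / 2) * \<bar>x\<bar>)"
          unfolding Q_def by (simp add: distrib_right mult.assoc)
        finally show ?thesis .
      qed
      have "ennreal (exp (\<delta> * \<bar>x\<bar>) * (1 + \<bar>x\<bar>) ^ k) * (ennreal (18 * exp (- 2 * \<delta> * \<bar>x\<bar>) * (\<sigma> x)\<^sup>2) * ennreal (D * (1 + \<bar>x\<bar>) ^ m) + ennreal ((\<sigma> x)\<^sup>2) * ennreal (exp (- 2 * \<delta> * \<bar>x\<bar>)))
         \<le> ennreal (Q * (18 * D + 1)) * ennreal (exp (- (\<delta> / 2) * \<bar>x\<bar>) * (1 + \<bar>x\<bar>) ^ (k + m))" for x
      proof -
        define X where "X = 1 + \<bar>x\<bar>"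
        have X: "X \<ge> 1" by (simp add: X_def)
        define e where "e = exp (- 2 * \<delta> * \<bar>x\<bar>)"
        have e: "e > 0" "exp (\<delta> * \<bar>x\<bar>) * e = exp (- \<delta> * \<bar>x\<bar>)" by (simp_all add: e_def mult_exp_exp)
        have "ennreal (exp (\<delta> * \<bar>x\<bar>) * X ^ k) * (ennreal (18 * e * (\<sigma> x)\<^sup>2) * ennreal (D * X ^ m) + ennreal ((\<sigma> x)\<^sup>2) * ennreal e)
            = ennreal ((exp (\<delta> * \<bar>x\<bar>) * X ^ k) * (18 * e * (\<sigma> x)\<^sup>2 * (D * X ^ m) + (\<sigma> x)\<^sup>2 * e))"
          using X e D(1) by (simp add: ennreal_mult ennreal_plus)
        also have "(exp (\<delta> * \<bar>x\<bar>) * X ^ k) * (18 * e * (\<sigma> x)\<^sup>2 * (D * X ^ m) + (\<sigma> x)\<^sup>2 * e)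
            = (exp (\<delta> * \<bar>x\<bar>) * e) * (\<sigma> x)\<^sup>2 * (X ^ k * (18 * D * X ^ m + 1))"
          by (simp add: algebra_simps)
        also have "\<dots> \<le> (Q * exp (- (\<delta> / 2) * \<bar>x\<bar>)) * (X ^ k * ((18 * D + 1) * X ^ m))"
        proof (rule mult_mono)
          show "exp (\<delta> * \<bar>x\<bar>) * e * (\<sigma> x)\<^sup>2 \<le> Q * exp (- (\<delta> / 2) * \<bar>x\<bar>)"
            unfolding e(2) by (rule \<sigma>Q)
          have "1 \<le> X ^ m" using X by (rule one_le_power)
          then show "X ^ k * (18 * D * X ^ m + 1) \<le> X ^ k * ((18 * D + 1) * X ^ m)"
            using X by (intro mult_left_mono) (auto simp: distrib_right)
        qed (use Q X D(1) in auto)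
        also have "\<dots> = (Q * (18 * D + 1)) * (exp (- (\<delta> / 2) * \<bar>x\<bar>) * X ^ (k + m))"
          by (simp add: power_add mult_ac)
        finally have "ennreal (exp (\<delta> * \<bar>x\<bar>) * X ^ k) * (ennreal (18 * e * (\<sigma> x)\<^sup>2) * ennreal (D * X ^ m) + ennreal ((\<sigma> x)\<^sup>2) * ennreal e)
            \<le> ennreal ((Q * (18 * D + 1)) * (exp (- (\<delta> / 2) * \<bar>x\<bar>) * X ^ (k + m)))"
          by (simp only: ennreal_leI)
        also have "\<dots> = ennreal (Q * (18 * D + 1)) * ennreal (exp (- (\<delta> / 2) * \<bar>x\<bar>) * X ^ (k + m))"
          by (rule ennreal_mult) (use Q D(1) X in auto)
        finally show ?thesis unfolding X_def e_def .
      qed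
      then have "(\<integral>\<^sup>+x. ennreal (exp (\<delta> * \<bar>x\<bar>) * (1 + \<bar>x\<bar>) ^ k) * (ennreal (18 * exp (- 2 * \<delta> * \<bar>x\<bar>) * (\<sigma> x)\<^sup>2) * ennreal (D * (1 + \<bar>x\<bar>) ^ m) + ennreal ((\<sigma> x)\<^sup>2) * ennreal (exp (- 2 * \<delta> * \<bar>x\<bar>))) \<partial>lborel)
         \<le> (\<integral>\<^sup>+x. ennreal (Q * (18 * D + 1)) * ennreal (exp (- (\<delta> / 2) * \<bar>x\<bar>) * (1 + \<bar>x\<bar>) ^ (k + m)) \<partial>lborel)"
        by (rule nn_integral_mono)
      also have "\<dots> = ennreal (Q * (18 * D + 1)) * ennreal L"
        unfolding L(1)[symmetric] by (rule nn_integral_cmult) measurable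
      also have "\<dots> = ennreal (Q * c2)"
        using Q D(1) L(2) by (simp add: ennreal_mult[symmetric] c2_def mult.assoc)
      finally show ?thesis unfolding Q_def .
    qed
    finally have "ennreal c0 * ennreal (n\<^sup>2) \<le> ennreal C * (ennreal c1 * ennreal (2 * wnorm_sq N k F) + ennreal ((S\<^sup>2 + T\<^sup>2 * exp (- (\<delta> / 4) * R)) * c2))"
      by (simp add: mult_left_mono add_left_mono)
    also have "\<dots> = ennreal (C * (c1 * (2 * wnorm_sq N k F) + (S\<^sup>2 + T\<^sup>2 * exp (- (\<delta> / 4) * R)) * c2))"
      using C c wnorm_sq_nonneg[of N k F] by (simp add: ennreal_mult ennreal_plus)
    also have "ennreal c0 * ennreal (n\<^sup>2) = ennreal (c0 * n\<^sup>2)" using c by (simp add: ennreal_mult)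
    finally have "c0 * n\<^sup>2 \<le> C * (c1 * (2 * wnorm_sq N k F) + (S\<^sup>2 + T\<^sup>2 * exp (- (\<delta> / 4) * R)) * c2)"
      using C c wnorm_sq_nonneg[of N k F] by (subst (asm) ennreal_le_iff) (auto intro!: mult_nonneg_nonneg add_nonneg_nonneg)
    then have "n\<^sup>2 \<le> C * (c1 * (2 * wnorm_sq N k F) + (S\<^sup>2 + T\<^sup>2 * exp (- (\<delta> / 4) * R)) * c2) / c0"
      using c by (simp add: pos_le_divide_eq mult.commute)
    also have "\<dots> = a1 * wnorm_sq N k F + a2 * S\<^sup>2 + (a2 * K'\<^sup>2 * exp (- (\<delta> / 4) * R)) * n\<^sup>2"
      by (simp add: a1_def a2_def T_def power_mult_distrib add_divide_distrib distrib_left distrib_right mult_ac)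
    also have "\<dots> \<le> a1 * wnorm_sq N k F + a2 * S\<^sup>2 + 1 / 2 * n\<^sup>2"
      by (intro add_left_mono mult_right_mono tail) simp
    finally show ?thesis unfolding n_def[symmetric] by linarith
  qed
  show ?thesis
  proof (rule that[of "2 * a1 + 2 * a2 + 1" "R + 4"])
    show "2 * a1 + 2 * a2 + 1 > 0" using a by simp
    show "R + 4 \<ge> 1" using R by simp
    fix F S assume F: "F \<in> PW b" "\<And>z. cmod z \<le> R + 4 \<Longrightarrow> cmod (F z) \<le> S"
    have m: "(L2_norm M (\<lambda>t. F (of_real t)))\<^sup>2 \<le> 2 * a1 * wnorm_sq N k F + 2 * a2 * S\<^sup>2"
      by (rule main[OF F])
    have "2 * a1 * wnorm_sq N k F + 2 * a2 * S\<^sup>2 \<le> (2 * a1 + 2 * a2 + 1) * wnorm_sq N k F + (2 * a1 + 2 * a2 + 1) * S\<^sup>2"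
      using a wnorm_sq_nonneg[of N k F] by (intro add_mono mult_right_mono) auto
    then show "(L2_norm M (\<lambda>t. F (of_real t)))\<^sup>2 \<le> (2 * a1 + 2 * a2 + 1) * (wnorm_sq N k F + S\<^sup>2)"
      unfolding distrib_left[of "2 * a1 + 2 * a2 + 1" "wnorm_sq N k F"] by (rule order_trans[OF m])
  qed
qed

end

section \<open>Transfer of density\<close>

text \<open>
  The entire function \<open>sin (s * z) / z\<close>: multiplication by it costs the type \<open>s\<close>
  and gains one power of decay.
\<close>

definition sinc :: "real \<Rightarrow> complex \<Rightarrow> complex" where
  "sinc s z = (if z = 0 then of_real s else sin (of_real s * z) / z)"

lemma sinc_mult: "z * sinc s z = sin (of_real s * z)"
  by (simp add: sinc_def)

lemma PW_sin:
  assumes "F \<in> PW a" "s > 0"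
  shows "(\<lambda>z. sin (of_real s * z) * F z) \<in> PW (a + s)"
proof -
  have 1: "(\<lambda>z. exp (\<i> * of_real s * z) * F z) \<in> PW (a + s)" using PW_exp[OF assms(1), of s] assms(2) by simp
  have 2: "(\<lambda>z. exp (\<i> * of_real (- s) * z) * F z) \<in> PW (a + s)" using PW_exp[OF assms(1), of "- s"] assms(2) by simp
  have "sin (of_real s * z) * F z = 1 / (2 * \<i>) * (exp (\<i> * of_real s * z) * F z) + - (1 / (2 * \<i>)) * (exp (\<i> * of_real (- s) * z) * F z)" for z
    unfolding sin_exp_eq by (simp add: mult.assoc field_simps)
  then show ?thesis using PW_lin[OF 1 2, of "1 / (2 * \<i>)" "- (1 / (2 * \<i>))"] by (simp only:)
qed

lemma PW_sinc:
  assumes F: "F \<in> PW a" and s: "s > 0"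
  shows "(\<lambda>z. sinc s z * F z) \<in> PW (a + s)"
proof -
  have G: "(\<lambda>z. sin (of_real s * z) * F z) \<in> PW (a + s)" by (rule PW_sin[OF F s])
  have G0: "sin (of_real s * 0) * F 0 = 0" by simp
  obtain H where H: "H \<in> PW (a + s)" "\<And>z. (z - 0) * H z = sin (of_real s * z) * F z"
    using PW_divide[OF G G0] by blast
  have der: "(f has_field_derivative deriv f 0) (at 0)" if "f \<in> PW c" for f c
    by (rule holomorphic_derivI[OF PW_holomorphic[OF that] open_UNIV]) simp
  \<comment> \<open>at the removable singularity the values agree because the derivatives of \<open>z * H z\<close> and of \<open>sin (s * z) * F z\<close> do\<close>
  have 1: "((\<lambda>z. z * H z) has_field_derivative 1 * H 0 + deriv H 0 * 0) (at 0)"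
    by (rule DERIV_mult[OF DERIV_ident der[OF H(1)]])
  have "((\<lambda>z. sin (of_real s * z)) has_field_derivative of_real s) (at (0 :: complex))"
    by (auto intro!: derivative_eq_intros)
  from DERIV_mult[OF this der[OF F]]
  have 2: "((\<lambda>z. sin (of_real s * z) * F z) has_field_derivative of_real s * F 0 + deriv F 0 * sin (of_real s * 0)) (at 0)" .
  have "(\<lambda>z. z * H z) = (\<lambda>z. sin (of_real s * z) * F z)" using H(2) by simp
  with 2 have "1 * H 0 + deriv H 0 * 0 = of_real s * F 0 + deriv F 0 * sin (of_real s * 0)"
    by (intro DERIV_unique[OF 1]) simp
  then have "H 0 = sinc s 0 * F 0" by (simp add: sinc_def)
  moreover have "H z = sinc s z * F z" if "z \<noteq> 0" for z
    using H(2)[of z] that by (simp add: sinc_def field_simps)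
  ultimately have "H = (\<lambda>z. sinc s z * F z)" by (metis ext)
  then show ?thesis using H(1) by simp
qed

lemma PW_sinc_power:
  assumes F: "F \<in> PW a" and s: "s > 0"
  shows "(\<lambda>z. sinc s z ^ n * F z) \<in> PW (a + real n * s)"
proof (induction n)
  case 0
  show ?case using F by simp
next
  case (Suc n)
  have "(\<lambda>z. sinc s z * (sinc s z ^ n * F z)) \<in> PW (a + real n * s + s)" by (rule PW_sinc[OF Suc s])
  then show ?case by (simp add: algebra_simps)
qed

lemma PW_power_times:
  assumes F: "F \<in> PW a"
  shows "(\<lambda>z. z ^ n * F z) \<in> PW a"
proof (induction n)
  case 0
  show ?case using F by simp
next
  case (Suc n)
  show ?case using PW_times_z[OF Suc] by (simp add: mult.assoc)
qed

lemma sinc_decay: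
  assumes "s > 0" shows "cmod (sinc s (of_real t)) \<le> (s + 1) / (1 + \<bar>t\<bar>)"
proof -
  have sin: "cmod (sin (of_real s * of_real t)) = \<bar>sin (s * t)\<bar>"
    by (simp flip: of_real_mult add: sin_of_real)
  have 1: "\<bar>t\<bar> * cmod (sinc s (of_real t)) \<le> 1"
  proof -
    have "\<bar>t\<bar> * cmod (sinc s (of_real t)) = cmod (of_real t * sinc s (of_real t))" by (simp add: norm_mult)
    also have "\<dots> = \<bar>sin (s * t)\<bar>" unfolding sinc_mult by (rule sin)
    finally show ?thesis by simp
  qed
  have 2: "cmod (sinc s (of_real t)) \<le> s"
  proof (cases "t = 0")
    case True
    then show ?thesis using assms by (simp add: sinc_def)
  next
    case False
    have "\<bar>sin (s * t)\<bar> \<le> \<bar>s * t\<bar>" by (rule abs_sin_x_le_abs_x)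
    then have "\<bar>sin (s * t)\<bar> / \<bar>t\<bar> \<le> s" using False assms by (simp add: pos_divide_le_eq abs_mult)
    then show ?thesis using False sin by (simp add: sinc_def norm_divide)
  qed
  have "cmod (sinc s (of_real t)) * (1 + \<bar>t\<bar>) \<le> s + 1"
    using 1 2 by (simp add: algebra_simps)
  then show ?thesis by (simp add: pos_le_divide_eq)
qed

lemma complex_sin_nonzero:
  assumes "w \<noteq> 0" "cmod w < pi" shows "sin w \<noteq> 0"
proof
  assume "sin w = 0"
  then obtain n :: int where n: "w = of_real (real_of_int n * pi)" using sin_eq_0 by blast
  then have "n \<noteq> 0" using assms(1) by auto
  then have "1 \<le> \<bar>real_of_int n\<bar>" by linarith
  then have "pi \<le> \<bar>real_of_int n\<bar> * pi" by simp
  then show False using assms(2) n by (simp add: norm_mult abs_mult)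
qed

lemma maximum_on_disc:
  assumes "F holomorphic_on UNIV" "r > 0"
  obtains w where "cmod w = r" "\<And>z. cmod z \<le> r \<Longrightarrow> cmod (F z) \<le> cmod (F w)"
proof -
  have c: "continuous_on A F" for A
    by (rule continuous_on_subset[OF holomorphic_on_imp_continuous_on[OF assms(1)]]) simp
  have ne: "sphere (0::complex) r \<noteq> {}" using assms(2) by (auto intro!: exI[of _ "of_real r"])
  have "\<exists>w\<in>sphere 0 r. \<forall>z\<in>sphere 0 r. cmod (F z) \<le> cmod (F w)"
    by (intro continuous_attains_sup continuous_on_norm c compact_sphere ne)
  then obtain w where w: "cmod w = r" "\<forall>z\<in>sphere 0 r. cmod (F z) \<le> cmod (F w)" by auto
  have "cmod (F z) \<le> cmod (F w)" if "cmod z \<le> r" for z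
  proof (rule maximum_modulus_frontier[of F "cball 0 r"])
    show "F holomorphic_on interior (cball 0 r)" by (rule holomorphic_on_subset[OF assms(1)]) simp
  qed (use c w that assms(2) in auto)
  then show ?thesis using that[OF w(1)] by blast
qed

text \<open>
  Let \<open>G = sin (s * z) ^ p * F z\<close>. Dividing out \<open>z ^ p\<close>, the maximum principle
  shows that \<open>cmod G\<close> is at most \<open>T / 2 ^ p\<close> on the disc of radius
  \<open>R\<close>, where \<open>T\<close> is a value on the circle of radius \<open>2 * R\<close>. The
  two hypotheses give \<open>T\<^sup>2 \<le> K * A * (wnorm_sq N k F + T\<^sup>2 / 4 ^ p)\<close>, and for
  large \<open>p\<close> the last term is absorbed. As \<open>s * 2 * R < pi\<close>, the sine has no zero
  on that circle and can be divided out again. The abstract quantity \<open>n F\<close> stands for the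
  square of the norm of \<open>F\<close> in \<open>L2 \<mu>\<close>.
\<close>

lemma point_evaluation:
  assumes N: "tempered N" and a: "0 < a" "a < b" and R: "R \<ge> 1" and A: "A > 0" and K: "K > 0"
    and est: "\<And>F S. F \<in> PW b \<Longrightarrow> (\<And>z. cmod z \<le> R \<Longrightarrow> cmod (F z) \<le> S) \<Longrightarrow>
      n F \<le> A * (wnorm_sq N k F + S\<^sup>2)"
    and eval: "\<And>F z. F \<in> PW b \<Longrightarrow> cmod z \<le> 2 * R \<Longrightarrow> (cmod (F z))\<^sup>2 \<le> K * n F"
  obtains B where "B \<ge> 0" "\<And>F. F \<in> PW a \<Longrightarrow> (cmod (F \<i>))\<^sup>2 \<le> B * wnorm_sq N k F"
proof -
  define \<sigma> where "\<sigma> = b - a"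
  have \<sigma>: "\<sigma> > 0" using a by (simp add: \<sigma>_def)
  obtain n1 :: nat where n1: "max (2 * (K * A)) (2 * R * \<sigma>) < real n1" using reals_Archimedean2 by blast
  define p where "p = Suc n1"
  have p: "2 * (K * A) < real p" "2 * R * \<sigma> < real p" "p > 0" using n1 by (auto simp: p_def)
  define s where "s = \<sigma> / real p"
  have s: "s > 0" "real p * s = \<sigma>" using \<sigma> p by (auto simp: s_def)
  have "2 * R * s < 1" using p by (simp add: s_def divide_simps)
  then have s1: "2 * R * s < pi" using pi_gt3 by linarith
  \<comment> \<open>the gain \<open>4 ^ p\<close> beats the constant of the estimate\<close>
  have four: "2 * (K * A) \<le> 4 ^ p"
  proof -
    have "real p < 2 ^ p" by (rule of_nat_less_two_power)
    also have "(2::real) ^ p \<le> 4 ^ p" by (intro power_mono) auto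
    finally show ?thesis using p(1) by linarith
  qed
  have "\<exists>w\<in>sphere 0 (2 * R). \<forall>z\<in>sphere 0 (2 * R). cmod (sin (of_real s * w) ^ p) \<le> cmod (sin (of_real s * z) ^ p)"
  proof (rule continuous_attains_inf)
    show "sphere (0::complex) (2 * R) \<noteq> {}" using R by (auto intro!: exI[of _ "of_real (2 * R)"])
  qed (auto intro!: continuous_intros)
  then obtain w where w: "cmod w = 2 * R"
    "\<And>z. cmod z = 2 * R \<Longrightarrow> cmod (sin (of_real s * w) ^ p) \<le> cmod (sin (of_real s * z) ^ p)" by auto
  define c where "c = cmod (sin (of_real s * w) ^ p)"
  have "sin (of_real s * w) \<noteq> 0"
  proof (rule complex_sin_nonzero)
    show "of_real s * w \<noteq> 0" using w(1) s R by auto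
    show "cmod (of_real s * w) < pi" using w(1) s s1 by (simp add: norm_mult mult.commute)
  qed
  then have c: "c > 0" by (simp add: c_def)
  define B where "B = 2 * (K * A) / c\<^sup>2"
  have main: "(cmod (F \<i>))\<^sup>2 \<le> B * wnorm_sq N k F" if F: "F \<in> PW a" for F
  proof -
    define H where "H z = sinc s z ^ p * F z" for z
    define G where "G z = z ^ p * H z" for z
    have HPW: "H \<in> PW b"
      using PW_sinc_power[OF F s(1), of p] s(2) by (simp add: H_def[abs_def] \<sigma>_def)
    have GPW: "G \<in> PW b" unfolding G_def[abs_def] by (rule PW_power_times[OF HPW])
    have G: "G z = sin (of_real s * z) ^ p * F z" for z
      unfolding G_def H_def by (simp only: mult.assoc[symmetric] power_mult_distrib[symmetric] sinc_mult)
    obtain v where v: "cmod v = 2 * R" "\<And>z. cmod z \<le> 2 * R \<Longrightarrow> cmod (H z) \<le> cmod (H v)"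
      using maximum_on_disc[OF PW_holomorphic[OF HPW], of "2 * R"] R by auto
    define T where "T = cmod (G v)"
    have T: "T = (2 * R) ^ p * cmod (H v)" by (simp add: T_def G_def norm_mult norm_power v(1))
    have inner: "cmod (G z) \<le> T / 2 ^ p" if z: "cmod z \<le> R" for z
    proof -
      have "cmod (G z) = cmod z ^ p * cmod (H z)" by (simp add: G_def norm_mult norm_power)
      also have "\<dots> \<le> R ^ p * cmod (H v)"
        using z v(2)[of z] R by (intro mult_mono power_mono) auto
      also have "\<dots> = T / 2 ^ p" by (simp add: T power_mult_distrib)
      finally show ?thesis .
    qed
    have PG: "wnorm_sq N k G \<le> wnorm_sq N k F"
      unfolding wnorm_sq_def
    proof (rule integral_mono[OF tempered_PW_integrable[OF N GPW] tempered_PW_integrable[OF N F a(1)]])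
      show "b > 0" using a by simp
      fix t
      have "cmod (sin (of_real s * of_real t)) \<le> 1"
        by (simp flip: of_real_mult add: sin_of_real)
      then have "cmod (sin (of_real s * of_real t)) ^ p * cmod (F (of_real t)) \<le> 1 * cmod (F (of_real t))"
        by (intro mult_right_mono power_le_one) auto
      then have "cmod (G (of_real t)) \<le> cmod (F (of_real t))"
        by (simp add: G norm_mult norm_power)
      then show "(1 + \<bar>t\<bar>) ^ k * (cmod (G (of_real t)))\<^sup>2 \<le> (1 + \<bar>t\<bar>) ^ k * (cmod (F (of_real t)))\<^sup>2"
        by (intro mult_left_mono power_mono) auto
    qed
    have "T\<^sup>2 \<le> K * n G" unfolding T_def by (rule eval[OF GPW]) (simp add: v(1))
    also have "\<dots> \<le> K * (A * (wnorm_sq N k G + (T / 2 ^ p)\<^sup>2))"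
      using K by (intro mult_left_mono est[OF GPW] inner) auto
    also have "\<dots> \<le> K * (A * (wnorm_sq N k F + (T / 2 ^ p)\<^sup>2))"
      using K A PG by (intro mult_left_mono add_right_mono) auto
    also have "\<dots> = K * A * wnorm_sq N k F + (2 * (K * A)) * (T\<^sup>2 / 2) / 4 ^ p"
    proof -
      have "((2::real) ^ p)\<^sup>2 = (2\<^sup>2) ^ p" by (simp only: power_mult[symmetric] mult.commute)
      then have "((2::real) ^ p)\<^sup>2 = 4 ^ p" by simp
      then show ?thesis by (simp add: power_divide distrib_left)
    qed
    also have "(2 * (K * A)) * (T\<^sup>2 / 2) / 4 ^ p \<le> 4 ^ p * (T\<^sup>2 / 2) / 4 ^ p"
      by (intro divide_right_mono mult_right_mono four) auto
    finally have T2: "T\<^sup>2 \<le> 2 * (K * A) * wnorm_sq N k F" by simp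
    obtain u where u: "cmod u = 2 * R" "\<And>z. cmod z \<le> 2 * R \<Longrightarrow> cmod (F z) \<le> cmod (F u)"
      using maximum_on_disc[OF PW_holomorphic[OF F], of "2 * R"] R by auto
    have "cmod (F \<i>) * c \<le> cmod (F u) * cmod (sin (of_real s * u) ^ p)"
      using u(2)[of \<i>] w(2)[OF u(1)] R c by (intro mult_mono) (auto simp: c_def)
    also have "\<dots> = cmod (G u)" by (simp add: G norm_mult mult.commute)
    also have "\<dots> = (2 * R) ^ p * cmod (H u)" by (simp add: G_def norm_mult norm_power u(1))
    also have "\<dots> \<le> T" unfolding T using v(2)[of u] u(1) R by (intro mult_left_mono) auto
    finally have "(cmod (F \<i>) * c)\<^sup>2 \<le> T\<^sup>2" using c by (intro power_mono) auto
    also note T2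
    finally show ?thesis using c by (simp add: B_def power_mult_distrib pos_le_divide_eq)
  qed
  have "B \<ge> 0" using K A by (simp add: B_def)
  then show ?thesis using main that by blast
qed

text \<open>
  Approximate \<open>g t = u t / (t - \<i>)\<close> by \<open>f\<close> and consider \<open>u t - (t -
  \<i>) * f t = (t - \<i>) * (g t - f t)\<close>. Its value at \<open>\<i>\<close> is \<open>u
  \<i>\<close>; the factor \<open>sinc s ^ J\<close> with \<open>J = k + 2\<close> compensates the weight
  \<open>(1 + \<bar>t\<bar>) ^ k\<close> and the factor \<open>t - \<i>\<close>.
\<close>

lemma dense_imp_not_point_evaluation:
  assumes N: "tempered N" and a: "0 < a" "a < b" and dense: "dense_in_L2 N (\<E> a)"
    and B: "B \<ge> 0" "\<And>F. F \<in> PW b \<Longrightarrow> (cmod (F \<i>))\<^sup>2 \<le> B * wnorm_sq N k F"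
  shows False
proof -
  have "\<exists>u. u \<in> PW a \<and> u \<i> \<noteq> 0" using PW_bump[OF a(1)] by (elim exE conjE) (intro exI conjI)
  then obtain u where u: "u \<in> PW a" "u \<i> \<noteq> 0" by blast
  define J where "J = k + 2"
  define s where "s = (b - a) / real J"
  have s: "s > 0" "real J * s = b - a" using a by (auto simp: s_def J_def)
  define Q where "Q = (s + 1) ^ (2 * J)"
  have Q: "Q > 0" using s by (simp add: Q_def)
  have sets: "sets N = sets borel" by (rule tempered_sets[OF N])
  define g where "g t = u (of_real t) / (of_real t - \<i>)" for t
  have ne: "of_real t - \<i> \<noteq> 0" for t :: real by (simp add: complex_eq_iff)
  have gL: "g \<in> L2 N"
  proof (rule L2_dominated[OF PW_L2[OF N u(1) a(1)], of _ 1])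
    show "g \<in> borel_measurable N"
      unfolding g_def[abs_def] using L2_D(1)[OF PW_L2[OF N u(1) a(1)]] sets
      by (intro borel_measurable_divide) (auto cong: measurable_cong_sets)
    show "cmod (g t) \<le> 1 * cmod (u (of_real t))" for t
    proof -
      have "1 \<le> cmod (of_real t - \<i>)" using abs_Im_le_cmod[of "of_real t - \<i>"] by simp
      then have "cmod (u (of_real t)) / cmod (of_real t - \<i>) \<le> cmod (u (of_real t)) / 1" by (intro frac_le) auto
      then show ?thesis by (simp add: g_def norm_divide)
    qed
  qed
  have sinc_i: "sinc s \<i> \<noteq> 0"
  proof
    assume "sinc s \<i> = 0"
    then have "sin (of_real s * \<i>) = 0" by (simp add: sinc_def)
    then obtain m :: int where m: "of_real s * \<i> = of_real (real_of_int m * pi)" using sin_eq_0 by blast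
    then have "Im (of_real s * \<i>) = 0" by (simp only: Im_complex_of_real)
    then show False using s by simp
  qed
  define q where "q = (cmod (sinc s \<i> ^ J * u \<i>))\<^sup>2"
  have q: "q > 0" using sinc_i u(2) by (simp add: q_def)
  \<comment> \<open>chosen such that \<open>B * (Q * e\<^sup>2) < q\<close>\<close>
  define e where "e = sqrt (q / (2 * (B + 1) * Q))"
  have e: "e > 0" "e\<^sup>2 = q / (2 * (B + 1) * Q)" using q B(1) Q by (auto simp: e_def)
  obtain f where f: "f \<in> PW a" "L2_norm N (\<lambda>t. g t - f (of_real t)) < e"
    using dense gL e(1) unfolding dense_in_L2_def E_eq_PW by blast
  define p0 where "p0 z = 1 * u z + (-1) * (z * f z + (- \<i>) * f z)" for z
  have "(\<lambda>z. 1 * (z * f z) + (- \<i>) * f z) \<in> PW a" by (rule PW_lin[OF PW_times_z[OF f(1)] f(1)])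
  then have "p0 \<in> PW a" unfolding p0_def[abs_def] by (intro PW_lin[OF u(1)]) simp
  from PW_sinc_power[OF this s(1), of J]
  have pPW: "(\<lambda>z. sinc s z ^ J * p0 z) \<in> PW b" using s(2) by simp
  have dL: "(\<lambda>t. g t - f (of_real t)) \<in> L2 N" by (rule L2_diff[OF gL PW_L2[OF N f(1) a(1)]])
  have "q \<le> B * wnorm_sq N k (\<lambda>z. sinc s z ^ J * p0 z)"
    using B(2)[OF pPW] by (simp add: q_def p0_def)
  also have "wnorm_sq N k (\<lambda>z. sinc s z ^ J * p0 z) \<le> (LINT t|N. Q * (cmod (g t - f (of_real t)))\<^sup>2)"
    unfolding wnorm_sq_def
  proof (rule integral_mono[OF tempered_PW_integrable[OF N pPW] integrable_mult_right[OF L2_D(2)[OF dL]]])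
    show "b > 0" using a by simp
    fix t :: real
    define X where "X = 1 + \<bar>t\<bar>"
    have X: "X > 0" by (simp add: X_def)
    have "p0 (of_real t) = (of_real t - \<i>) * (g t - f (of_real t))"
    proof -
      have "(of_real t - \<i>) * g t = u (of_real t)" using ne[of t] by (simp add: g_def)
      moreover have "p0 (of_real t) = u (of_real t) - (of_real t - \<i>) * f (of_real t)"
        by (simp add: p0_def algebra_simps)
      ultimately show ?thesis by (simp only: right_diff_distrib)
    qed
    moreover have "cmod (of_real t - \<i>) \<le> X"
      using norm_triangle_ineq4[of "of_real t" \<i>] by (simp add: X_def)
    ultimately have "cmod (p0 (of_real t)) \<le> X * cmod (g t - f (of_real t))"
      by (simp add: norm_mult mult_right_mono)
    then have "cmod (sinc s (of_real t) ^ J * p0 (of_real t)) \<le> ((s + 1) / X) ^ J * (X * cmod (g t - f (of_real t)))"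
      unfolding norm_mult norm_power using sinc_decay[OF s(1), of t] s X
      by (intro mult_mono power_mono) (auto simp: X_def)
    then have "(cmod (sinc s (of_real t) ^ J * p0 (of_real t)))\<^sup>2 \<le> (((s + 1) / X) ^ J * (X * cmod (g t - f (of_real t))))\<^sup>2"
      by (intro power_mono) auto
    also have "\<dots> = Q * (X\<^sup>2 / X ^ (2 * J)) * (cmod (g t - f (of_real t)))\<^sup>2"
      by (simp add: Q_def power_mult_distrib power_divide power_mult[symmetric] mult.commute)
    finally have "X ^ k * (cmod (sinc s (of_real t) ^ J * p0 (of_real t)))\<^sup>2
       \<le> X ^ k * (Q * (X\<^sup>2 / X ^ (2 * J)) * (cmod (g t - f (of_real t)))\<^sup>2)"
      using X by (intro mult_left_mono) auto
    also have "\<dots> = Q * (1 / X ^ J) * (cmod (g t - f (of_real t)))\<^sup>2"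
    proof -
      have "X ^ (2 * J) = X ^ J * (X ^ k * X\<^sup>2)" by (simp only: mult_2 power_add J_def)
      then have "X ^ k * (X\<^sup>2 / X ^ (2 * J)) = 1 / X ^ J" using X by simp
      then show ?thesis by (metis mult.assoc mult.left_commute)
    qed
    also have "\<dots> \<le> Q * 1 * (cmod (g t - f (of_real t)))\<^sup>2"
    proof -
      have "1 \<le> X ^ J" by (rule one_le_power) (simp add: X_def)
      then have "1 / X ^ J \<le> 1" by simp
      then show ?thesis using Q by (intro mult_right_mono mult_left_mono) auto
    qed
    finally show "(1 + \<bar>t\<bar>) ^ k * (cmod (sinc s (of_real t) ^ J * p0 (of_real t)))\<^sup>2 \<le> Q * (cmod (g t - f (of_real t)))\<^sup>2"
      by (simp add: X_def)
  qed
  also have "(LINT t|N. Q * (cmod (g t - f (of_real t)))\<^sup>2) = Q * (L2_norm N (\<lambda>t. g t - f (of_real t)))\<^sup>2"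
    by (simp add: L2_norm_sq)
  also have "\<dots> \<le> Q * e\<^sup>2" using Q f(2) L2_norm_nonneg by (intro mult_left_mono power_mono) auto
  finally have "q \<le> B * (Q * e\<^sup>2)" using B(1) by (simp add: mult_left_mono)
  also have "\<dots> = B * q / (2 * (B + 1))" using Q B(1) by (simp add: e(2))
  also have "\<dots> < q" using q B(1) by (simp add: divide_less_eq)
  finally show False by simp
qed

text \<open>
  Point evaluations are needed twice: on a strip of height \<open>1\<close>, with growth \<open>exp
  (\<delta> / 8 * \<bar>Re z\<bar>)\<close>, to compare the norms, and then on the disc of radius \<open>2
  * R\<close>, whose size is dictated by that comparison.
\<close>

lemma (in comparison) dense_transfer:
  assumes a: "0 < a" "a < b" and dense: "dense_in_L2 N (\<E> a)"
  shows "dense_in_L2 M (\<E> b)"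
proof (rule ccontr)
  assume nd: "\<not> dense_in_L2 M (\<E> b)"
  have b: "b > 0" using a by simp
  have d8: "\<delta> / 8 > 0" using \<delta> by simp
  obtain K where K: "K > 0" "\<forall>F\<in>PW b. \<forall>z. \<bar>Im z\<bar> \<le> 1 \<longrightarrow>
      cmod (F z) \<le> K * L2_norm M (\<lambda>t. F (of_real t)) * exp (\<delta> / 8 * \<bar>Re z\<bar>)"
    using evaluation_bound[OF tempered_M b nd d8, of 1] by auto
  show False
  proof (rule norm_estimate[OF b K(1) K(2)[rule_format]])
    fix A R :: real assume A: "A > 0" "R \<ge> 1" and est:
      "\<And>F S. F \<in> PW b \<Longrightarrow> (\<And>z. cmod z \<le> R \<Longrightarrow> cmod (F z) \<le> S) \<Longrightarrow>
        (L2_norm M (\<lambda>t. F (of_real t)))\<^sup>2 \<le> A * (wnorm_sq N k F + S\<^sup>2)"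
    obtain L where L: "L > 0" "\<forall>F\<in>PW b. \<forall>z. \<bar>Im z\<bar> \<le> 2 * R \<longrightarrow>
        cmod (F z) \<le> L * L2_norm M (\<lambda>t. F (of_real t)) * exp (1 * \<bar>Re z\<bar>)"
      using evaluation_bound[OF tempered_M b nd, of 1 "2 * R"] A by auto
    define L' where "L' = (L * exp (2 * R))\<^sup>2"
    have L': "L' > 0" using L by (simp add: L'_def)
    have eval: "(cmod (F z))\<^sup>2 \<le> L' * (L2_norm M (\<lambda>t. F (of_real t)))\<^sup>2" if F: "F \<in> PW b" and z: "cmod z \<le> 2 * R" for F z
    proof -
      have "\<bar>Im z\<bar> \<le> 2 * R" "\<bar>Re z\<bar> \<le> 2 * R" using z abs_Im_le_cmod[of z] abs_Re_le_cmod[of z] by linarith+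
      then have "cmod (F z) \<le> L * L2_norm M (\<lambda>t. F (of_real t)) * exp (1 * \<bar>Re z\<bar>)" using L(2) F by blast
      also have "\<dots> \<le> L * L2_norm M (\<lambda>t. F (of_real t)) * exp (2 * R)"
        using \<open>\<bar>Re z\<bar> \<le> 2 * R\<close> L(1) L2_norm_nonneg[of M "\<lambda>t. F (of_real t)"] by (intro mult_left_mono) auto
      finally have "(cmod (F z))\<^sup>2 \<le> (L * L2_norm M (\<lambda>t. F (of_real t)) * exp (2 * R))\<^sup>2"
        by (intro power_mono) auto
      then show ?thesis by (simp add: L'_def power_mult_distrib mult_ac)
    qed
    define a1 where "a1 = (a + b) / 2"
    have a1: "0 < a1" "a1 < b" "a < a1" using a by (auto simp: a1_def)
    show False
    proof (rule point_evaluation[OF N a1(1,2) A(2,1) L' est eval])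
      fix B assume "B \<ge> 0" "\<And>F. F \<in> PW a1 \<Longrightarrow> (cmod (F \<i>))\<^sup>2 \<le> B * wnorm_sq N k F"
      then show False by (rule dense_imp_not_point_evaluation[OF N a(1) a1(3) dense])
    qed
  qed
qed

theorem corollary1p4:
  fixes \<mu> \<mu>' :: "real measure"
  assumes "sets \<mu> = sets borel"
    and "sets \<mu>' = sets borel"
    and "polynomial_growth \<mu>'"
    and "\<mu> \<preceq> \<mu>'"
  shows "measure_type \<mu> \<le> measure_type \<mu>'"
proof -
  have t: "tempered \<mu>'" by (rule polynomial_growth_tempered[OF assms(2,3)])
  obtain \<delta> C k where "comparison \<mu> \<mu>' \<delta> C k" by (rule preccurly_comparison[OF assms(1) t assms(4)])
  then interpret comparison \<mu> \<mu>' \<delta> C k .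
  have "measure_type \<mu> \<le> ereal a" if a: "a > 0" "dense_in_L2 \<mu>' (\<E> a)" for a
  proof (rule ereal_le_epsilon2)
    fix e :: real assume "e > 0"
    then have "dense_in_L2 \<mu> (\<E> (a + e))" by (intro dense_transfer[OF a(1) _ a(2)]) simp
    then have "ereal (a + e) \<in> {ereal a | a. a > 0 \<and> dense_in_L2 \<mu> (\<E> a)}"
      using a(1) \<open>e > 0\<close> by auto
    then have "measure_type \<mu> \<le> ereal (a + e)" unfolding measure_type_def by (rule Inf_lower)
    then show "measure_type \<mu> \<le> ereal a + ereal e" by simp
  qed
  then show ?thesis unfolding measure_type_def[of \<mu>'] by (intro Inf_greatest) auto
qed

end
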